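(* Let $H$ be a separable infinite-dimensional Hilbert space, $\mathcal L_{1,\infty}=\mathcal L_{1,\infty}(H)$, and let $S$, $D$ and ${\rm diag}$ be as in the context. (i) For every trace $\tau$ on $\mathcal L_{1,\infty}$, the linear functional $\theta:=\tau\circ{\rm diag}\circ D$ on $l_\infty$ satisfies $\theta=\theta\circ S$ and $$\tau(A)=\theta\left(\frac1{\log 2}\left\{\sum_{k=2^n-1}^{2^{n+1}-2}\mu(k,A)\right\}_{n\ge0}\right)\quad\text{for all } 0\le A\in\mathcal L_{1,\infty},$$ and $\theta$ is the unique $S$-invariant linear functional on $l_\infty$ with this property. (ii) Conversely, for every linear functional $\theta$ on $l_\infty$ with $\theta=\theta\circ S$, the functional defined on the positive cone of $\mathcal L_{1,\infty}$ by the displayed formula extends by linearity to a trace on $\mathcal L_{1,\infty}$. In particular, there is a bijective linear correspondence between the set of all traces on $\mathcal L_{1,\infty}$ and the set of all $S$-invariant linear functionals on $l_\infty$.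
   Context: For a compact operator $A$ on $H$, $\{\mu(n,A)\}_{n\ge0}$ is its sequence of singular values (decreasing). $\mathcal L_{1,\infty}=\{A \text{ compact}: \sup_{n\ge0}(n+1)\mu(n,A)<\infty\}$. A trace on $\mathcal L_{1,\infty}$ is a unitarily invariant linear functional on $\mathcal L_{1,\infty}$ (no continuity assumed). $l_\infty$ is the space of bounded real sequences $x=(x_0,x_1,\dots)$; $S$ is the right shift $S(x_0,x_1,\dots)=(0,x_0,x_1,\dots)$; linear functionals are not assumed bounded. $D:l_\infty\to l_{1,\infty}$ is defined by $(Dx)_k=\log 2\cdot x_n/2^n$ for $2^n-1\le k\le 2^{n+1}-2$, $n\ge0$ (so each $x_n/2^n$ is repeated $2^n$ times), where $l_{1,\infty}$ is the space of sequences $x$ with $\sup_n (n+1)x^*_n<\infty$, $x^*$ being the decreasing rearrangement of $|x|$. ${\rm diag}(x)$ denotes the diagonal operator with diagonal $x$ with respect to a fixed orthonormal basis of $H$. *)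

theory Defs
  imports "HOL-Analysis.Analysis"
begin

text \<open>A complex Hilbert space is modelled as a real Hilbert space (real inner product space,
  complete) together with a scalar multiplication by complex numbers extending the real one,
  such that multiplication by the imaginary unit is an isometry of the real inner product.
  The complex inner product is then recovered from the real one (linear in the first argument).\<close>

class chilbert = real_inner + complete_space +
  fixes scaleC :: "complex \<Rightarrow> 'a \<Rightarrow> 'a"
  assumes scaleC_of_real: "scaleC (complex_of_real r) x = r *\<^sub>R x"
    and scaleC_add_right: "scaleC a (x + y) = scaleC a x + scaleC a y"
    and scaleC_add_left: "scaleC (a + b) x = scaleC a x + scaleC b x"
    and scaleC_scaleC: "scaleC a (scaleC b x) = scaleC (a * b) x"
    and inner_scaleC_ii: "inner (scaleC \<i> x) (scaleC \<i> y) = inner x y"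

definition cinner :: "'a::chilbert \<Rightarrow> 'a \<Rightarrow> complex" where
  "cinner x y = Complex (inner x y) (inner x (scaleC \<i> y))"

definition cbounded :: "('a::chilbert \<Rightarrow>\<^sub>L 'a) set" where
  "cbounded = {A. \<forall>c x. blinfun_apply A (scaleC c x) = scaleC c (blinfun_apply A x)}"

definition compact_op :: "('a::chilbert \<Rightarrow>\<^sub>L 'a) \<Rightarrow> bool" where
  "compact_op A \<longleftrightarrow> compact (closure (blinfun_apply A ` ball 0 1))"

definition rank_le :: "('a::chilbert \<Rightarrow>\<^sub>L 'a) \<Rightarrow> nat \<Rightarrow> bool" where
  "rank_le F n \<longleftrightarrow> (\<exists>v::nat \<Rightarrow> 'a. \<forall>x. \<exists>c::nat \<Rightarrow> complex.
      blinfun_apply F x = (\<Sum>i<n. scaleC (c i) (v i)))"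

text \<open>Singular values via approximation numbers: mu(n,A) = inf { ||A - F|| : rank F \<le> n }.\<close>
definition sing_val :: "nat \<Rightarrow> ('a::chilbert \<Rightarrow>\<^sub>L 'a) \<Rightarrow> real" where
  "sing_val n A = Inf {norm (A - F) | F. F \<in> cbounded \<and> rank_le F n}"

definition L1inf :: "('a::chilbert \<Rightarrow>\<^sub>L 'a) set" where
  "L1inf = {A. A \<in> cbounded \<and> compact_op A \<and>
              bdd_above (range (\<lambda>n. real (n + 1) * sing_val n A))}"

definition pos_op :: "('a::chilbert \<Rightarrow>\<^sub>L 'a) \<Rightarrow> bool" where
  "pos_op A \<longleftrightarrow> (\<forall>x. Im (cinner (blinfun_apply A x) x) = 0 \<and> 0 \<le> Re (cinner (blinfun_apply A x) x))"

definition unitary :: "('a::chilbert \<Rightarrow>\<^sub>L 'a) \<Rightarrow> bool" where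
  "unitary U \<longleftrightarrow> U \<in> cbounded \<and> surj (blinfun_apply U) \<and> (\<forall>x. norm (blinfun_apply U x) = norm x)"

text \<open>Traces on L_{1,infinity}: complex-linear, unitarily invariant functionals (no continuity).
  Unitary invariance tau(U A U^*) = tau(A) is phrased as: B U = U A implies tau B = tau A.\<close>
definition is_trace :: "(('a::chilbert \<Rightarrow>\<^sub>L 'a) \<Rightarrow> complex) \<Rightarrow> bool" where
  "is_trace \<tau> \<longleftrightarrow>
     (\<forall>A\<in>L1inf. \<forall>B\<in>L1inf. \<tau> (A + B) = \<tau> A + \<tau> B) \<and>
     (\<forall>c. \<forall>A\<in>L1inf. \<forall>B\<in>L1inf. (\<forall>x. blinfun_apply B x = scaleC c (blinfun_apply A x))
          \<longrightarrow> \<tau> B = c * \<tau> A) \<and>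
     (\<forall>U. \<forall>A\<in>L1inf. \<forall>B\<in>L1inf. unitary U \<and>
          (\<forall>x. blinfun_apply B (blinfun_apply U x) = blinfun_apply U (blinfun_apply A x))
          \<longrightarrow> \<tau> B = \<tau> A)"

definition separable_space :: "'a::metric_space itself \<Rightarrow> bool" where
  "separable_space _ \<longleftrightarrow> (\<exists>D::'a set. countable D \<and> closure D = UNIV)"

definition orthonormal_basis :: "(nat \<Rightarrow> 'a::chilbert) \<Rightarrow> bool" where
  "orthonormal_basis e \<longleftrightarrow>
     (\<forall>i j. cinner (e i) (e j) = (if i = j then 1 else 0)) \<and>
     (\<forall>y. (\<forall>n. cinner y (e n) = 0) \<longrightarrow> y = 0)"

definition diag :: "(nat \<Rightarrow> 'a::chilbert) \<Rightarrow> (nat \<Rightarrow> real) \<Rightarrow> ('a \<Rightarrow>\<^sub>L 'a)" where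
  "diag e x = Blinfun (\<lambda>y. \<Sum>n. scaleC (complex_of_real (x n) * cinner y (e n)) (e n))"

definition linf :: "(nat \<Rightarrow> real) set" where
  "linf = {x. bdd_above (range (\<lambda>n. \<bar>x n\<bar>))}"

definition shiftS :: "(nat \<Rightarrow> real) \<Rightarrow> (nat \<Rightarrow> real)" where
  "shiftS x = (\<lambda>n. if n = 0 then 0 else x (n - 1))"

definition Dop :: "(nat \<Rightarrow> real) \<Rightarrow> (nat \<Rightarrow> real)" where
  "Dop x = (\<lambda>k. let n = (THE n::nat. 2 ^ n - 1 \<le> k \<and> k \<le> 2 ^ (n + 1) - 2)
                in ln 2 * x n / 2 ^ n)"

definition linear_on_linf :: "((nat \<Rightarrow> real) \<Rightarrow> complex) \<Rightarrow> bool" where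
  "linear_on_linf \<theta> \<longleftrightarrow>
     (\<forall>x\<in>linf. \<forall>y\<in>linf. \<theta> (\<lambda>n. x n + y n) = \<theta> x + \<theta> y) \<and>
     (\<forall>c::real. \<forall>x\<in>linf. \<theta> (\<lambda>n. c * x n) = complex_of_real c * \<theta> x)"

definition shift_invariant :: "((nat \<Rightarrow> real) \<Rightarrow> complex) \<Rightarrow> bool" where
  "shift_invariant \<theta> \<longleftrightarrow> (\<forall>x\<in>linf. \<theta> (shiftS x) = \<theta> x)"

definition block_seq :: "('a::chilbert \<Rightarrow>\<^sub>L 'a) \<Rightarrow> (nat \<Rightarrow> real)" where
  "block_seq A = (\<lambda>n. (1 / ln 2) * (\<Sum>k = 2 ^ n - 1 .. 2 ^ (n + 1) - 2. sing_val k A))"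

end

theory Submission
  imports Defs
begin

text \<open>
  A positive \<open>A\<close> in the ideal is diagonal in an orthonormal sequence of eigenvectors with
  eigenvalues \<open>\<mu>(k, A)\<close>. A trace takes the same value on diagonal operators with the same diagonal in
  different orthonormal sequences, so \<open>\<tau>(A)\<close> only depends on the sequence \<open>\<mu>(A)\<close>. Averaging \<open>\<mu>(A)\<close> over the
  dyadic blocks changes it by a sequence with vanishing block sums. Within each block such a sequence
  can be permuted so that its partial sums \<open>y\<close> stay of the order of its entries; it then becomes the
  difference of \<open>y\<close> and the shift of \<open>y\<close>, which has trace zero. Conversely, the Ky Fan inequalities
  \<open>\<Sum>\<^sub>k\<^sub><\<^sub>n \<mu>(k, A + B) \<le> \<Sum>\<^sub>k\<^sub><\<^sub>n (\<mu>(k, A) + \<mu>(k, B)) \<le> \<Sum>\<^sub>k\<^sub><\<^sub>2\<^sub>n \<mu>(k, A + B)\<close> show that the defect of additivity of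
  the block sums has bounded partial sums, hence is of the form \<open>y - S y\<close> and is killed by every
  \<open>S\<close>-invariant functional.
\<close>

section \<open>Complex Hilbert spaces\<close>

text \<open>Traces carry no continuity, so nothing may be passed to a limit under \<tau>: every
  identity between traces has to be exact and reached by finitely many sums, scalar multiples and
  unitary conjugations. This is why zero block sums are telescoped inside the ideal instead of being
  approximated. Unitary invariance alone does not compare diagonals along two orthonormal sequences,
  because their orthogonal complements may have different dimensions; each sequence is therefore cut
  into two halves of infinite codimension. Singular values are defined as approximation numbers.
  Vectors for them come from a greedy choice: unit vectors at which \<open>A\<close> attains its
  norm on the complement of the vectors already chosen. For positive \<open>A\<close> these turn out
  to be eigenvectors. Uniqueness of \<theta> holds because every sequence with values between 1 and
  2 is the block sequence of a positive diagonal operator, and such sequences span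
  \<open>linf\<close>. The passage from the positive cone to the whole ideal uses polarization into
  four positive operators.\<close>

instance chilbert \<subseteq> banach ..

lemma scaleC_1 [simp]: "scaleC 1 x = (x::'a::chilbert)"
  using scaleC_of_real[of 1 x] by simp

lemma scaleC_0_left [simp]: "scaleC 0 x = (0::'a::chilbert)"
  using scaleC_of_real[of 0 x] by simp

lemma scaleC_0_right [simp]: "scaleC c 0 = (0::'a::chilbert)"
  using scaleC_add_right[of c 0 "0::'a"] by simp

lemma scaleC_minus_right: "scaleC c (- x) = - scaleC c (x::'a::chilbert)"
  using scaleC_add_right[of c x "-x"] by (simp add: eq_neg_iff_add_eq_0 add.commute)

lemma scaleC_minus_left: "scaleC (- c) x = - scaleC c (x::'a::chilbert)"
  using scaleC_add_left[of c "-c" x] by (simp add: eq_neg_iff_add_eq_0 add.commute)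

lemma scaleC_diff_right: "scaleC c (x - y) = scaleC c x - scaleC c (y::'a::chilbert)"
  using scaleC_add_right[of c x "-y"] by (simp add: scaleC_minus_right)

lemma scaleC_sum_right: "scaleC c (sum f I) = (\<Sum>i\<in>I. scaleC c (f i :: 'a::chilbert))"
  by (induction I rule: infinite_finite_induct) (auto simp: scaleC_add_right)

lemma scaleC_sum_left: "scaleC (sum c I) x = (\<Sum>i\<in>I. scaleC (c i) (x :: 'a::chilbert))"
  by (induction I rule: infinite_finite_induct) (auto simp: scaleC_add_left)

lemma scaleC_scaleR: "scaleC c (r *\<^sub>R x) = r *\<^sub>R scaleC c (x::'a::chilbert)"
  by (simp add: scaleC_of_real[symmetric] scaleC_scaleC mult.commute)

lemma scaleC_eq_Re_Im: "scaleC c x = Re c *\<^sub>R x + Im c *\<^sub>R scaleC \<i> (x::'a::chilbert)"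
proof -
  have "scaleC c x = scaleC (of_real (Re c) + of_real (Im c) * \<i>) x"
    by (metis complex_eq mult.commute)
  thus ?thesis
    by (simp add: scaleC_add_left scaleC_of_real flip: scaleC_scaleC)
qed

text \<open>Multiplication by \<i> is an isometry with square -1, and such a map is skew for the
  real inner product.\<close>

lemma inner_scaleC_ii_left: "inner (scaleC \<i> x) y = - inner x (scaleC \<i> (y::'a::chilbert))"
  using inner_scaleC_ii[of x "scaleC \<i> y"] inner_scaleC_ii[of "scaleC \<i> x" y]
  by (simp add: scaleC_scaleC scaleC_minus_left)

lemma cinner_add_left: "cinner (x + y) z = cinner x z + cinner y (z::'a::chilbert)"
  by (simp add: cinner_def inner_add_left complex_eq_iff)

lemma cinner_add_right: "cinner z (x + y) = cinner z x + cinner z (y::'a::chilbert)"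
  by (simp add: cinner_def inner_add_right scaleC_add_right complex_eq_iff)

lemma cinner_zero_left [simp]: "cinner 0 (x::'a::chilbert) = 0"
  by (simp add: cinner_def complex_eq_iff)

lemma cinner_zero_right [simp]: "cinner (x::'a::chilbert) 0 = 0"
  by (simp add: cinner_def complex_eq_iff)

lemma cinner_scaleC_left [simp]: "cinner (scaleC c x) y = c * cinner x (y::'a::chilbert)"
  by (simp add: cinner_def scaleC_eq_Re_Im[of c x] inner_add_left complex_eq_iff
      inner_scaleC_ii_left scaleC_scaleC scaleC_minus_left)

lemma cinner_commute: "cinner y x = cnj (cinner x (y::'a::chilbert))"
  by (simp add: cinner_def complex_eq_iff inner_commute inner_scaleC_ii_left[symmetric])

lemma cinner_scaleC_right [simp]: "cinner x (scaleC c y) = cnj c * cinner x (y::'a::chilbert)"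
  by (subst (1 2) cinner_commute) simp

lemma cinner_minus_left: "cinner (- x) y = - cinner x (y::'a::chilbert)"
  by (simp add: cinner_def complex_eq_iff)

lemma cinner_minus_right: "cinner x (- y) = - cinner x (y::'a::chilbert)"
  by (simp add: cinner_def complex_eq_iff scaleC_minus_right)

lemma cinner_diff_left: "cinner (x - y) z = cinner x z - cinner y (z::'a::chilbert)"
  using cinner_add_left[of x "-y" z] by (simp add: cinner_minus_left)

lemma cinner_scaleR_left [simp]: "cinner (r *\<^sub>R x) y = of_real r * cinner x (y::'a::chilbert)"
  by (simp flip: scaleC_of_real)

lemma cinner_scaleR_right [simp]: "cinner x (r *\<^sub>R y) = of_real r * cinner x (y::'a::chilbert)"
  by (simp flip: scaleC_of_real)

lemma cinner_sum_left: "cinner (sum f I) y = (\<Sum>i\<in>I. cinner (f i) (y::'a::chilbert))"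
  by (induction I rule: infinite_finite_induct) (auto simp: cinner_add_left)

lemma cinner_sum_right: "cinner y (sum f I) = (\<Sum>i\<in>I. cinner y (f i :: 'a::chilbert))"
  by (induction I rule: infinite_finite_induct) (auto simp: cinner_add_right)

lemma cinner_self: "cinner x x = complex_of_real ((norm (x::'a::chilbert))\<^sup>2)"
proof -
  have "inner x (scaleC \<i> x) = 0"
    using inner_scaleC_ii_left[of x x] by (simp add: inner_commute)
  thus ?thesis
    by (simp add: cinner_def complex_eq_iff power2_norm_eq_inner)
qed

lemma cinner_self_eq_0 [simp]: "cinner x x = 0 \<longleftrightarrow> x = (0::'a::chilbert)"
  by (simp add: cinner_self)

lemma Re_cinner: "Re (cinner x y) = inner x (y::'a::chilbert)"
  by (simp add: cinner_def)

lemma norm_scaleC: "norm (scaleC c x) = cmod c * norm (x::'a::chilbert)"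
proof -
  have "complex_of_real ((norm (scaleC c x))\<^sup>2) = (c * cnj c) * of_real ((norm x)\<^sup>2)"
    by (simp only: cinner_self[symmetric] cinner_scaleC_left cinner_scaleC_right mult_ac)
  hence "complex_of_real ((norm (scaleC c x))\<^sup>2) = complex_of_real ((cmod c * norm x)\<^sup>2)"
    by (simp only: complex_norm_square[symmetric] power_mult_distrib of_real_mult)
  hence "(norm (scaleC c x))\<^sup>2 = (cmod c * norm x)\<^sup>2"
    using of_real_eq_iff by blast
  thus ?thesis by (simp add: power2_eq_iff_nonneg)
qed

lemma cinner_eq_0_commute: "cinner x y = 0 \<longleftrightarrow> cinner y (x::'a::chilbert) = 0"
  by (subst cinner_commute) simp

text \<open>Rotating \<open>x\<close> by a phase makes the complex inner product real and
  nonnegative, where the real Cauchy-Schwarz inequality applies.\<close>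

lemma norm_cinner_le: "cmod (cinner x y) \<le> norm x * norm (y::'a::chilbert)"
proof -
  define c where "c = (if cinner x y = 0 then 1 else cnj (cinner x y) / cmod (cinner x y))"
  have c1: "cmod c = 1" by (simp add: c_def norm_divide)
  have "c * cinner x y = cmod (cinner x y)"
    by (simp add: c_def complex_norm_square[symmetric] mult.commute power2_eq_square)
  hence "cmod (cinner x y) = Re (cinner (scaleC c x) y)" by simp
  also have "\<dots> \<le> norm (scaleC c x) * norm y"
    unfolding Re_cinner by (rule norm_cauchy_schwarz)
  finally show ?thesis by (simp add: norm_scaleC c1)
qed

lemma bounded_linear_cinner_left: "bounded_linear (\<lambda>x. cinner x (y::'a::chilbert))"
  by (rule bounded_linear_intro[where K = "norm y"])
     (auto simp: cinner_add_left scaleR_conv_of_real norm_cinner_le)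

lemma bounded_linear_scaleC_right: "bounded_linear (scaleC c :: 'a::chilbert \<Rightarrow> 'a)"
  by (rule bounded_linear_intro[where K = "cmod c"])
     (auto simp: scaleC_add_right scaleC_scaleR norm_scaleC mult.commute)

lemma bounded_linear_scaleC_left: "bounded_linear (\<lambda>c. scaleC c (x::'a::chilbert))"
  by (rule bounded_linear_intro[where K = "norm x"])
     (auto simp: scaleC_add_left scaleR_conv_of_real scaleC_of_real norm_scaleC simp flip: scaleC_scaleC)

lemma closed_cinner_eq_0: "closed {x. cinner x (y::'a::chilbert) = 0}"
  by (intro closed_Collect_eq continuous_intros linear_continuous_on bounded_linear_cinner_left)

lemma norm_diff_sq:
  "(norm (x - y))\<^sup>2 = (norm x)\<^sup>2 - 2 * Re (cinner x y) + (norm (y::'a::chilbert))\<^sup>2"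
  by (simp add: Re_cinner power2_norm_eq_inner inner_diff_left inner_diff_right inner_commute)

lemma cboundedD: "A \<in> cbounded \<Longrightarrow> blinfun_apply A (scaleC c x) = scaleC c (blinfun_apply A x)"
  by (simp add: cbounded_def)

lemma cbounded_sum_scaleC:
  "A \<in> cbounded \<Longrightarrow> blinfun_apply A (\<Sum>i\<in>I. scaleC (c i) (f i)) = (\<Sum>i\<in>I. scaleC (c i) (blinfun_apply A (f i)))"
  by (simp add: blinfun.sum_right cboundedD)

lemma cbounded_add: "A \<in> cbounded \<Longrightarrow> B \<in> cbounded \<Longrightarrow> A + B \<in> cbounded"
  by (simp add: cbounded_def blinfun.add_left scaleC_add_right)

lemma cbounded_diff: "A \<in> cbounded \<Longrightarrow> B \<in> cbounded \<Longrightarrow> A - B \<in> cbounded"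
  by (simp add: cbounded_def blinfun.diff_left scaleC_diff_right)

section \<open>Orthogonal systems\<close>

definition onseq :: "(nat \<Rightarrow> 'a::chilbert) \<Rightarrow> bool" where
  "onseq f \<longleftrightarrow> (\<forall>i j. cinner (f i) (f j) = (if i = j then 1 else 0))"

text \<open>Short and zero vectors are allowed, so that operators of finite rank need no special treatment.\<close>

definition subon :: "(nat \<Rightarrow> 'a::chilbert) \<Rightarrow> bool" where
  "subon f \<longleftrightarrow> (\<forall>i j. i \<noteq> j \<longrightarrow> cinner (f i) (f j) = 0) \<and> (\<forall>i. norm (f i) \<le> 1)"

lemma onseq_norm [simp]: "onseq f \<Longrightarrow> norm (f i) = 1"
proof -
  assume "onseq f"
  hence "complex_of_real ((norm (f i))\<^sup>2) = 1"
    unfolding cinner_self[symmetric] by (simp add: onseq_def)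
  hence "(norm (f i))\<^sup>2 = 1" by (simp only: of_real_eq_1_iff)
  thus ?thesis by (simp add: power2_eq_1_iff) (smt (verit) norm_ge_zero)
qed

lemma onseq_subon: "onseq f \<Longrightarrow> subon f"
  by (simp add: subon_def) (simp add: onseq_def)

lemma onseq_comp: "onseq f \<Longrightarrow> inj p \<Longrightarrow> onseq (\<lambda>k. f (p k))"
  by (simp add: onseq_def inj_eq)

lemma norm_sum_orthogonal:
  fixes f :: "'i \<Rightarrow> 'a::chilbert"
  assumes "finite I" "\<And>i j. i \<in> I \<Longrightarrow> j \<in> I \<Longrightarrow> i \<noteq> j \<Longrightarrow> cinner (f i) (f j) = 0"
  shows "(norm (\<Sum>i\<in>I. f i))\<^sup>2 = (\<Sum>i\<in>I. (norm (f i))\<^sup>2)"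
  using assms
proof (induction I rule: finite_induct)
  case (insert i I)
  have "cinner (f i) (f j) = 0" if "j \<in> I" for j
    using insert.prems[of i j] insert.hyps that by auto
  hence "cinner (f i) (\<Sum>i\<in>I. f i) = 0"
    by (simp add: cinner_sum_right)
  moreover have "(norm (\<Sum>i\<in>I. f i))\<^sup>2 = (\<Sum>i\<in>I. (norm (f i))\<^sup>2)"
    using insert by auto
  ultimately show ?case
    using insert.hyps norm_diff_sq[of "f i" "- (\<Sum>i\<in>I. f i)"] by (simp add: cinner_minus_right)
qed simp

lemma norm_sum_subon:
  assumes "subon g" "finite I"
  shows "(norm (\<Sum>i\<in>I. scaleC (c i) (g i)))\<^sup>2 \<le> (\<Sum>i\<in>I. (cmod (c i))\<^sup>2)"
proof -
  have "(norm (\<Sum>i\<in>I. scaleC (c i) (g i)))\<^sup>2 = (\<Sum>i\<in>I. (norm (scaleC (c i) (g i)))\<^sup>2)"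
    using assms by (intro norm_sum_orthogonal) (auto simp: subon_def)
  also have "\<dots> \<le> (\<Sum>i\<in>I. (cmod (c i))\<^sup>2)"
    using assms by (intro sum_mono power_mono) (auto simp: norm_scaleC subon_def mult_left_le)
  finally show ?thesis .
qed

lemma norm_sum_onseq:
  assumes "onseq g" "finite I"
  shows "(norm (\<Sum>i\<in>I. scaleC (c i) (g i)))\<^sup>2 = (\<Sum>i\<in>I. (cmod (c i))\<^sup>2)"
proof -
  have "(norm (\<Sum>i\<in>I. scaleC (c i) (g i)))\<^sup>2 = (\<Sum>i\<in>I. (norm (scaleC (c i) (g i)))\<^sup>2)"
    using assms by (intro norm_sum_orthogonal) (auto simp: onseq_def)
  thus ?thesis using assms by (simp add: norm_scaleC)
qed

text \<open>Expand the square of the norm of \<open>x - y\<close> for the would-be projection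
  \<open>y\<close>. Vectors shorter than 1 only decrease the norm of \<open>y\<close>, so an
  inequality suffices there.\<close>

lemma bessel:
  assumes "subon f" "finite I"
  shows "(\<Sum>i\<in>I. (cmod (cinner x (f i)))\<^sup>2) \<le> (norm x)\<^sup>2"
proof -
  define y where "y = (\<Sum>i\<in>I. scaleC (cinner x (f i)) (f i))"
  define S where "S = (\<Sum>i\<in>I. (cmod (cinner x (f i)))\<^sup>2)"
  have "cinner x y = (\<Sum>i\<in>I. cnj (cinner x (f i)) * cinner x (f i))"
    by (simp add: y_def cinner_sum_right)
  also have "\<dots> = of_real S"
    by (simp only: S_def of_real_sum complex_norm_square) (simp add: mult.commute)
  finally have "Re (cinner x y) = S" by simp
  moreover have "(norm y)\<^sup>2 \<le> S"
    unfolding y_def S_def by (rule norm_sum_subon[OF assms])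
  moreover have "0 \<le> (norm (x - y))\<^sup>2" by simp
  ultimately show ?thesis
    unfolding S_def[symmetric] norm_diff_sq by linarith
qed

lemma cinner_sum_onseq:
  assumes "onseq f" "finite I"
  shows "cinner (\<Sum>i\<in>I. scaleC (c i) (f i)) (f k) = (if k \<in> I then c k else 0)"
  using assms by (simp add: cinner_sum_left onseq_def if_distrib[of "\<lambda>t. _ * t"] cong: if_cong)

lemma pythagoras_projection:
  assumes "onseq f" "finite I"
  shows "(norm (x - (\<Sum>i\<in>I. scaleC (cinner x (f i)) (f i))))\<^sup>2
           = (norm x)\<^sup>2 - (\<Sum>i\<in>I. (cmod (cinner x (f i)))\<^sup>2)"
proof -
  define y where "y = (\<Sum>i\<in>I. scaleC (cinner x (f i)) (f i))"
  define S where "S = (\<Sum>i\<in>I. (cmod (cinner x (f i)))\<^sup>2)"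
  have "cinner x y = (\<Sum>i\<in>I. cnj (cinner x (f i)) * cinner x (f i))"
    by (simp add: y_def cinner_sum_right)
  also have "\<dots> = of_real S"
    by (simp only: S_def of_real_sum complex_norm_square) (simp add: mult.commute)
  finally have "Re (cinner x y) = S" by simp
  moreover have "(norm y)\<^sup>2 = S"
    unfolding y_def S_def by (rule norm_sum_onseq[OF assms])
  ultimately show ?thesis
    unfolding S_def[symmetric] y_def[symmetric] norm_diff_sq by linarith
qed

section \<open>Operators diagonal with respect to two orthogonal systems\<close>

text \<open>The Schmidt series of an operator. With \<open>f = g\<close> it is diagonal, with
  normalised images of \<open>f\<close> as \<open>g\<close> it is a singular value decomposition,
  and with \<open>s = 1\<close> and orthonormal sequences it is a projection or a partial
  isometry.\<close>

definition sop :: "(nat \<Rightarrow> real) \<Rightarrow> (nat \<Rightarrow> 'a::chilbert) \<Rightarrow> (nat \<Rightarrow> 'a) \<Rightarrow> 'a \<Rightarrow>\<^sub>L 'a" where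
  "sop s f g = Blinfun (\<lambda>x. \<Sum>n. scaleC (complex_of_real (s n) * cinner x (f n)) (g n))"

lemma diag_eq_sop: "diag e x = sop x e e"
  by (simp add: diag_def sop_def)

lemma norm_partial_sop_le:
  assumes "subon f" "subon g" "finite I" "\<And>k. k \<in> I \<Longrightarrow> \<bar>s k\<bar> \<le> C" "0 \<le> C"
  shows "norm (\<Sum>k\<in>I. scaleC (complex_of_real (s k) * cinner x (f k)) (g k))
           \<le> C * sqrt (\<Sum>k\<in>I. (cmod (cinner x (f k)))\<^sup>2)"
proof (rule power2_le_imp_le)
  have "(norm (\<Sum>k\<in>I. scaleC (complex_of_real (s k) * cinner x (f k)) (g k)))\<^sup>2
          \<le> (\<Sum>k\<in>I. (cmod (complex_of_real (s k) * cinner x (f k)))\<^sup>2)"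
    by (rule norm_sum_subon[OF assms(2,3)])
  also have "\<dots> \<le> (\<Sum>k\<in>I. C\<^sup>2 * (cmod (cinner x (f k)))\<^sup>2)"
    using assms(4,5)
    by (intro sum_mono) (auto simp: norm_mult power_mult_distrib abs_le_square_iff
        intro!: mult_right_mono power2_le_iff_abs_le[THEN iffD2])
  also have "\<dots> = (C * sqrt (\<Sum>k\<in>I. (cmod (cinner x (f k)))\<^sup>2))\<^sup>2"
    by (simp add: power_mult_distrib sum_distrib_left sum_nonneg)
  finally show "(norm (\<Sum>k\<in>I. scaleC (complex_of_real (s k) * cinner x (f k)) (g k)))\<^sup>2
      \<le> (C * sqrt (\<Sum>k\<in>I. (cmod (cinner x (f k)))\<^sup>2))\<^sup>2" .
qed (use assms in \<open>auto intro!: mult_nonneg_nonneg sum_nonneg\<close>)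

lemma bessel_summable:
  assumes "subon f"
  shows "summable (\<lambda>k. (cmod (cinner x (f k)))\<^sup>2)"
  by (rule summableI_nonneg_bounded[where x = "(norm x)\<^sup>2"]) (use bessel[OF assms] in auto)

lemma sop_summable:
  assumes f: "subon f" and g: "subon g" and s: "\<forall>k. \<bar>s k\<bar> \<le> C"
  shows "summable (\<lambda>n. scaleC (complex_of_real (s n) * cinner x (f n)) (g n))"
  unfolding summable_Cauchy
proof (intro allI impI)
  fix \<epsilon> :: real assume "\<epsilon> > 0"
  have C: "C \<ge> 0" using spec[OF s, of 0] by linarith
  \<comment> \<open>Adding 1 to \<open>C\<close> covers the case \<open>C = 0\<close> and makes
    \<open>C * \<delta> < \<epsilon>\<close> strict.\<close>
  define \<delta> where "\<delta> = \<epsilon> / (C + 1)"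
  have \<delta>: "\<delta> > 0" "C * \<delta> < \<epsilon>" using \<open>\<epsilon> > 0\<close> C by (auto simp: \<delta>_def field_simps)
  from bessel_summable[OF f, of x] \<delta>(1) obtain N where
    N: "\<And>m n. m \<ge> N \<Longrightarrow> norm (\<Sum>k=m..<n. (cmod (cinner x (f k)))\<^sup>2) < \<delta>\<^sup>2"
    unfolding summable_Cauchy by (metis zero_less_power)
  show "\<exists>N. \<forall>m\<ge>N. \<forall>n. norm (\<Sum>k=m..<n. scaleC (complex_of_real (s k) * cinner x (f k)) (g k)) < \<epsilon>"
  proof (intro exI allI impI)
    fix m n assume "m \<ge> N"
    have "norm (\<Sum>k=m..<n. scaleC (complex_of_real (s k) * cinner x (f k)) (g k))
            \<le> C * sqrt (\<Sum>k=m..<n. (cmod (cinner x (f k)))\<^sup>2)"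
      by (rule norm_partial_sop_le[OF f g]) (use s C in auto)
    also have "sqrt (\<Sum>k=m..<n. (cmod (cinner x (f k)))\<^sup>2) \<le> \<delta>"
      using N[OF \<open>m \<ge> N\<close>, of n] \<delta>(1) by (intro real_le_lsqrt) (auto simp: sum_nonneg)
    hence "C * sqrt (\<Sum>k=m..<n. (cmod (cinner x (f k)))\<^sup>2) \<le> C * \<delta>"
      using C by (rule mult_left_mono)
    finally show "norm (\<Sum>k=m..<n. scaleC (complex_of_real (s k) * cinner x (f k)) (g k)) < \<epsilon>"
      using \<delta>(2) by linarith
  qed
qed

lemma norm_sop_suminf_le:
  assumes f: "subon f" and g: "subon g" and s: "\<forall>k. \<bar>s k\<bar> \<le> C"
  shows "norm (\<Sum>n. scaleC (complex_of_real (s n) * cinner x (f n)) (g n)) \<le> C * norm x"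
proof (rule LIMSEQ_le_const2)
  have C: "C \<ge> 0" using spec[OF s, of 0] by linarith
  show "(\<lambda>m. norm (\<Sum>n<m. scaleC (complex_of_real (s n) * cinner x (f n)) (g n)))
     \<longlonglongrightarrow> norm (\<Sum>n. scaleC (complex_of_real (s n) * cinner x (f n)) (g n))"
    by (intro tendsto_norm summable_LIMSEQ sop_summable[OF f g s])
  show "\<exists>N. \<forall>n\<ge>N. norm (\<Sum>n<n. scaleC (complex_of_real (s n) * cinner x (f n)) (g n)) \<le> C * norm x"
  proof (intro exI allI impI)
    fix n
    have "norm (\<Sum>k<n. scaleC (complex_of_real (s k) * cinner x (f k)) (g k))
            \<le> C * sqrt (\<Sum>k<n. (cmod (cinner x (f k)))\<^sup>2)"
      by (rule norm_partial_sop_le[OF f g]) (use s C in auto)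
    also have "\<dots> \<le> C * norm x"
      using bessel[OF f, of "{..<n}" x] C by (intro mult_left_mono real_le_lsqrt) (auto simp: sum_nonneg)
    finally show "norm (\<Sum>k<n. scaleC (complex_of_real (s k) * cinner x (f k)) (g k)) \<le> C * norm x" .
  qed
qed

lemma sop_apply:
  assumes f: "subon f" and g: "subon g" and s: "\<forall>k. \<bar>s k\<bar> \<le> C"
  shows "blinfun_apply (sop s f g) x = (\<Sum>n. scaleC (complex_of_real (s n) * cinner x (f n)) (g n))"
proof -
  have sm: "summable (\<lambda>n. scaleC (complex_of_real (s n) * cinner x (f n)) (g n))" for x
    by (rule sop_summable[OF assms])
  have "bounded_linear (\<lambda>x. \<Sum>n. scaleC (complex_of_real (s n) * cinner x (f n)) (g n))"
  proof (rule bounded_linear_intro[where K = C])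
    show "(\<Sum>n. scaleC (complex_of_real (s n) * cinner (x + y) (f n)) (g n)) =
      (\<Sum>n. scaleC (complex_of_real (s n) * cinner x (f n)) (g n)) + (\<Sum>n. scaleC (complex_of_real (s n) * cinner y (f n)) (g n))" for x y
      by (subst suminf_add[OF sm sm]) (simp add: cinner_add_left distrib_left scaleC_add_left)
    show "(\<Sum>n. scaleC (complex_of_real (s n) * cinner (r *\<^sub>R x) (f n)) (g n)) =
      r *\<^sub>R (\<Sum>n. scaleC (complex_of_real (s n) * cinner x (f n)) (g n))" for r x
      by (subst suminf_scaleR_right[OF sm]) (simp add: mult_ac scaleC_scaleC flip: scaleC_of_real)
    show "norm (\<Sum>n. scaleC (complex_of_real (s n) * cinner x (f n)) (g n)) \<le> norm x * C" for x
      using norm_sop_suminf_le[OF assms] by (simp add: mult.commute)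
  qed
  thus ?thesis unfolding sop_def by (simp add: bounded_linear_Blinfun_apply)
qed

lemma sop_sums:
  assumes f: "subon f" and g: "subon g" and s: "\<forall>k. \<bar>s k\<bar> \<le> C"
  shows "(\<lambda>n. scaleC (complex_of_real (s n) * cinner x (f n)) (g n)) sums blinfun_apply (sop s f g) x"
  unfolding sop_apply[OF assms] by (intro summable_sums sop_summable[OF assms])

lemma sop_cbounded:
  assumes f: "subon f" and g: "subon g" and s: "\<forall>k. \<bar>s k\<bar> \<le> C"
  shows "sop s f g \<in> cbounded"
  unfolding cbounded_def
proof (intro CollectI allI)
  fix c x
  have "(\<lambda>n. scaleC c (scaleC (complex_of_real (s n) * cinner x (f n)) (g n))) sums scaleC c (blinfun_apply (sop s f g) x)"
    by (intro bounded_linear.sums[OF bounded_linear_scaleC_right] sop_sums[OF assms])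
  also have "(\<lambda>n. scaleC c (scaleC (complex_of_real (s n) * cinner x (f n)) (g n)))
     = (\<lambda>n. scaleC (complex_of_real (s n) * cinner (scaleC c x) (f n)) (g n))"
    by (simp add: scaleC_scaleC mult_ac)
  finally show "blinfun_apply (sop s f g) (scaleC c x) = scaleC c (blinfun_apply (sop s f g) x)"
    by (rule sums_unique2[OF sop_sums[OF assms]])
qed

lemma sop_perp:
  assumes f: "subon f" and g: "subon g" and s: "\<forall>k. \<bar>s k\<bar> \<le> C" and "\<And>k. cinner x (f k) = 0"
  shows "blinfun_apply (sop s f g) x = 0"
  by (simp add: sop_apply[OF f g s] assms(4))

lemma sop_basis:
  assumes f: "onseq f" and g: "subon g" and s: "\<forall>k. \<bar>s k\<bar> \<le> C"
  shows "blinfun_apply (sop s f g) (f k) = s k *\<^sub>R g k"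
proof -
  have "(\<lambda>n. if n = k then s k *\<^sub>R g k else 0) sums (s k *\<^sub>R g k)"
    using sums_single[of k "\<lambda>n. s n *\<^sub>R g n"] by (simp add: if_distrib cong: if_cong)
  also have "(\<lambda>n. if n = k then s k *\<^sub>R g k else 0)
      = (\<lambda>n. scaleC (complex_of_real (s n) * cinner (f k) (f n)) (g n))"
    using f by (auto simp: onseq_def scaleC_of_real)
  finally show ?thesis by (rule sums_unique2[OF sop_sums[OF onseq_subon[OF f] g s]])
qed

lemma norm_sop_tail_le:
  assumes f: "subon f" and g: "subon g" and s: "\<forall>k. \<bar>s k\<bar> \<le> C"
    and t: "\<And>k. k \<ge> n \<Longrightarrow> \<bar>s k\<bar> \<le> t" and x: "\<And>k. k < n \<Longrightarrow> cinner x (f k) = 0"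
  shows "norm (blinfun_apply (sop s f g) x) \<le> t * norm x"
proof -
  have t0: "0 \<le> t" using t[of n] by auto
  have "blinfun_apply (sop s f g) x = (\<Sum>k. scaleC (complex_of_real (if k < n then 0 else s k) * cinner x (f k)) (g k))"
    unfolding sop_apply[OF f g s] by (rule suminf_cong) (use x in auto)
  also have "norm \<dots> \<le> t * norm x"
    by (rule norm_sop_suminf_le[OF f g]) (use t t0 in auto)
  finally show ?thesis .
qed

lemma sop_add:
  assumes f: "subon f" and g: "subon g" and s: "\<forall>k. \<bar>s k\<bar> \<le> C" and t: "\<forall>k. \<bar>t k\<bar> \<le> C'"
  shows "sop (\<lambda>k. s k + t k) f g = sop s f g + sop t f g"
proof (rule blinfun_eqI)
  fix x
  have st: "\<forall>k. \<bar>s k + t k\<bar> \<le> C + C'" using s t by (auto intro!: order_trans[OF abs_triangle_ineq] add_mono)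
  show "blinfun_apply (sop (\<lambda>k. s k + t k) f g) x = blinfun_apply (sop s f g + sop t f g) x"
    using sums_add[OF sop_sums[OF f g s, of x] sop_sums[OF f g t, of x]] sop_sums[OF f g st, of x]
    by (simp add: blinfun.add_left distrib_right scaleC_add_left sums_iff)
qed

lemma sop_scaleR:
  assumes f: "subon f" and g: "subon g" and s: "\<forall>k. \<bar>s k\<bar> \<le> C"
  shows "sop (\<lambda>k. c * s k) f g = c *\<^sub>R sop s f g"
proof (rule blinfun_eqI)
  fix x
  have cs: "\<forall>k. \<bar>c * s k\<bar> \<le> \<bar>c\<bar> * C" using s by (simp add: abs_mult mult_left_mono)
  show "blinfun_apply (sop (\<lambda>k. c * s k) f g) x = blinfun_apply (c *\<^sub>R sop s f g) x"
    using sums_scaleR_right[OF sop_sums[OF f g s, of x], of c] sop_sums[OF f g cs, of x]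
    by (simp add: blinfun.scaleR_left scaleC_scaleC mult.assoc sums_iff flip: scaleC_of_real)
qed

lemma sop_sums_cinner:
  assumes f: "subon f" and g: "subon g" and s: "\<forall>k. \<bar>s k\<bar> \<le> C"
  shows "(\<lambda>n. complex_of_real (s n) * cinner x (f n) * cinner (g n) y) sums cinner (blinfun_apply (sop s f g) x) y"
  using bounded_linear.sums[OF bounded_linear_cinner_left sop_sums[OF assms, of x], of y] by simp

text \<open>The orthogonal projection onto the closed span of \<open>f\<close> is \<open>sop (\<lambda>_. 1) f f\<close>.\<close>

lemma sop_projection_perp:
  assumes f: "onseq f"
  shows "cinner (x - blinfun_apply (sop (\<lambda>_. 1) f f) x) (f k) = 0"
proof -
  have "(\<lambda>n. cinner x (f n) * cinner (f n) (f k)) sums cinner (blinfun_apply (sop (\<lambda>_. 1) f f) x) (f k)"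
    using sop_sums_cinner[OF onseq_subon[OF f] onseq_subon[OF f], of "\<lambda>_. 1" 1 x "f k"] by simp
  also have "(\<lambda>n. cinner x (f n) * cinner (f n) (f k)) = (\<lambda>n. if n = k then cinner x (f n) else 0)"
    using f by (auto simp: onseq_def)
  finally have "cinner (blinfun_apply (sop (\<lambda>_. 1) f f) x) (f k) = cinner x (f k)"
    by (rule sums_unique2) (rule sums_single)
  thus ?thesis by (simp add: cinner_diff_left)
qed

text \<open>Every \<open>x\<close> is its projection onto the closed span of \<open>f\<close> plus a
  vector orthogonal to \<open>f\<close>; the last condition takes care of the part that an
  incomplete \<open>f\<close> does not see.\<close>

lemma cbounded_eqI:
  assumes f: "onseq f" and A: "A \<in> cbounded" and B: "B \<in> cbounded"
    and 1: "\<And>k. blinfun_apply A (f k) = blinfun_apply B (f k)"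
    and 2: "\<And>y. (\<And>k. cinner y (f k) = 0) \<Longrightarrow> blinfun_apply A y = blinfun_apply B y"
  shows "A = B"
proof (rule blinfun_eqI)
  fix x
  let ?P = "blinfun_apply (sop (\<lambda>_. 1) f f) x"
  have s: "(\<lambda>n. scaleC (cinner x (f n)) (f n)) sums ?P"
    using sop_sums[OF onseq_subon[OF f] onseq_subon[OF f], of "\<lambda>_. 1" 1 x] by simp
  have "(\<lambda>n. blinfun_apply A (scaleC (cinner x (f n)) (f n))) sums blinfun_apply A ?P"
       "(\<lambda>n. blinfun_apply B (scaleC (cinner x (f n)) (f n))) sums blinfun_apply B ?P"
    using bounded_linear.sums[OF blinfun.bounded_linear_right s] by auto
  moreover have "blinfun_apply A (scaleC (cinner x (f n)) (f n)) = blinfun_apply B (scaleC (cinner x (f n)) (f n))" for n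
    using A B 1 by (simp add: cboundedD)
  ultimately have "blinfun_apply A ?P = blinfun_apply B ?P"
    using sums_unique2 by force
  moreover have "blinfun_apply A (x - ?P) = blinfun_apply B (x - ?P)"
    by (rule 2) (rule sop_projection_perp[OF f])
  ultimately show "blinfun_apply A x = blinfun_apply B x"
    by (simp add: blinfun.diff_right)
qed

lemma sop_eqI:
  assumes "onseq f" "subon g" "\<forall>k. \<bar>s k\<bar> \<le> C" "A \<in> cbounded"
    and "\<And>k. blinfun_apply A (f k) = s k *\<^sub>R g k"
    and "\<And>y. (\<And>k. cinner y (f k) = 0) \<Longrightarrow> blinfun_apply A y = 0"
  shows "A = sop s f g"
  by (rule cbounded_eqI[OF assms(1,4) sop_cbounded[OF onseq_subon[OF assms(1)] assms(2,3)]])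
     (simp_all add: assms(5,6) sop_basis[OF assms(1-3)] sop_perp[OF onseq_subon[OF assms(1)] assms(2,3)])

lemma orthonormal_basisD:
  assumes "orthonormal_basis e"
  shows "onseq e" "\<And>y. (\<And>n. cinner y (e n) = 0) \<Longrightarrow> y = 0"
  using assms by (auto simp: orthonormal_basis_def onseq_def)

lemma cbounded_eqI_basis:
  assumes "orthonormal_basis e" "A \<in> cbounded" "B \<in> cbounded"
    and "\<And>k. blinfun_apply A (e k) = blinfun_apply B (e k)"
  shows "A = B"
  by (rule cbounded_eqI[OF orthonormal_basisD(1)[OF assms(1)] assms(2-4)])
     (use orthonormal_basisD(2)[OF assms(1)] in fastforce)

section \<open>Singular vectors\<close>

text \<open>Gaussian elimination, one equation per induction step. The dimension counts below rest
  on it: a span of \<open>n + 1\<close> independent vectors contains a nonzero vector satisfying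
  \<open>n\<close> linear conditions.\<close>

lemma homogeneous_system_nontrivial:
  fixes a :: "'i \<Rightarrow> 'k \<Rightarrow> 'f::field"
  assumes "finite I" "finite K" "card I < card K"
  shows "\<exists>c. (\<exists>k\<in>K. c k \<noteq> 0) \<and> (\<forall>i\<in>I. (\<Sum>k\<in>K. a i k * c k) = 0)"
  using assms
proof (induction I arbitrary: K a rule: finite_induct)
  case empty
  then obtain k where "k \<in> K" by fastforce
  thus ?case by (intro exI[of _ "\<lambda>_. 1"]) auto
next
  case (insert i I)
  show ?case
  proof (cases "\<forall>k\<in>K. a i k = 0")
    case True
    have "card I < card K" using insert.prems insert.hyps by simp
    from insert.IH[OF insert.prems(1) this, of a] True show ?thesis by auto
  next
    case False
    then obtain p where p: "p \<in> K" "a i p \<noteq> 0" by auto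
    define K' where "K' = K - {p}"
    have K: "K = insert p K'" "p \<notin> K'" "finite K'"
      using p insert.prems by (auto simp: K'_def)
    have "card I < card K'" using insert.prems insert.hyps K by simp
    \<comment> \<open>These are the remaining equations after elimination of the unknown at the
      pivot \<open>p\<close>.\<close>
    from insert.IH[OF K(3) this, of "\<lambda>j k. a j k - a j p * a i k / a i p"] obtain c where
      c: "\<exists>k\<in>K'. c k \<noteq> 0" "\<And>j. j \<in> I \<Longrightarrow> (\<Sum>k\<in>K'. (a j k - a j p * a i k / a i p) * c k) = 0"
      by blast
    define S where "S = (\<Sum>k\<in>K'. a i k * c k)"
    define d where "d = c(p := - S / a i p)"
    have dK': "(\<Sum>k\<in>K'. a j k * d k) = (\<Sum>k\<in>K'. a j k * c k)" for j
      using K(2) by (intro sum.cong) (auto simp: d_def)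
    have d: "(\<Sum>k\<in>K. a j k * d k) = a j p * (- S / a i p) + (\<Sum>k\<in>K'. a j k * c k)" for j
      using K dK'[of j] by (simp add: d_def)
    have "(\<Sum>k\<in>K. a i k * d k) = 0"
      unfolding d using p by (simp add: S_def)
    moreover have "(\<Sum>k\<in>K. a j k * d k) = 0" if "j \<in> I" for j
    proof -
      have "(\<Sum>k\<in>K'. (a j k - a j p * a i k / a i p) * c k)
          = (\<Sum>k\<in>K'. a j k * c k) - (a j p / a i p) * S"
        unfolding S_def sum_distrib_left sum_subtractf[symmetric]
        by (intro sum.cong) (auto simp: algebra_simps)
      thus ?thesis using c(2)[OF that] by (simp add: d)
    qed
    moreover have "\<exists>k\<in>K. d k \<noteq> 0" using c(1) K by (auto simp: d_def)
    ultimately show ?thesis by auto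
  qed
qed

text \<open>Compactness makes only the images of a maximising sequence converge. The sequence itself
  is then Cauchy because near-maximisers with nearly equal images must be nearly equal, which
  requires \<open>S > 0\<close>; for \<open>S = 0\<close> any unit vector of \<open>M\<close>
  serves.\<close>

lemma norm_attained:
  fixes A :: "'a::chilbert \<Rightarrow>\<^sub>L 'a"
  assumes cpt: "compact_op A" and M: "subspace M" "closed M" and ne: "\<exists>x\<in>M. x \<noteq> 0"
  shows "\<exists>f\<in>M. norm f = 1 \<and> (\<forall>x\<in>M. norm (blinfun_apply A x) \<le> norm (blinfun_apply A f) * norm x)"
proof -
  define X where "X = (\<lambda>x. norm (blinfun_apply A x)) ` {x \<in> M. norm x = 1}"
  obtain x0 where x0: "x0 \<in> M" "x0 \<noteq> 0" using ne by auto
  define u0 where "u0 = (1 / norm x0) *\<^sub>R x0"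
  have u0: "u0 \<in> M" "norm u0 = 1" using x0 M by (auto simp: u0_def subspace_scale)
  have Xne: "X \<noteq> {}" using u0 by (auto simp: X_def)
  have Xb: "bdd_above X"
    unfolding X_def using norm_blinfun[of A] by (intro bdd_aboveI[of _ "norm A"]) (auto, metis mult.right_neutral)
  define S where "S = Sup X"
  have le: "norm (blinfun_apply A x) \<le> S * norm x" if "x \<in> M" for x
  proof (cases "x = 0")
    case False
    have "(1 / norm x) *\<^sub>R x \<in> {x \<in> M. norm x = 1}" using that M False by (auto simp: subspace_scale)
    hence "norm (blinfun_apply A ((1 / norm x) *\<^sub>R x)) \<in> X" unfolding X_def by blast
    hence "norm (blinfun_apply A ((1 / norm x) *\<^sub>R x)) \<le> S" unfolding S_def by (rule cSup_upper[OF _ Xb])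
    thus ?thesis using False by (simp add: blinfun.scaleR_right field_simps)
  qed simp
  have S0: "0 \<le> S" using order_trans[OF norm_ge_zero le[OF u0(1)]] u0 by simp
  show ?thesis
  proof (cases "S = 0")
    case True
    hence "blinfun_apply A x = 0" if "x \<in> M" for x using le[OF that] by simp
    thus ?thesis using u0 by auto
  next
    case False
    hence S: "S > 0" using S0 by simp
    have "\<exists>x. x \<in> M \<and> norm x = 1 \<and> S - 1 / real (Suc n) < norm (blinfun_apply A x)" for n
    proof -
      have "S - 1 / real (Suc n) < Sup X" by (simp add: S_def)
      from less_cSupD[OF Xne this] show ?thesis by (auto simp: X_def)
    qed
    then obtain x where x: "\<And>n. x n \<in> M" "\<And>n. norm (x n) = 1" "\<And>n. S - 1 / real (Suc n) < norm (blinfun_apply A (x n))"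
      by metis
    have lim: "(\<lambda>n. norm (blinfun_apply A (x n))) \<longlonglongrightarrow> S"
    proof (rule tendsto_sandwich)
      show "(\<lambda>n. S - 1 / real (Suc n)) \<longlonglongrightarrow> S"
        using tendsto_diff[OF tendsto_const[of S] LIMSEQ_inverse_real_of_nat]
        by (simp add: inverse_eq_divide)
      show "eventually (\<lambda>n. S - 1 / real (Suc n) \<le> norm (blinfun_apply A (x n))) sequentially"
        using x(3) by (simp add: less_imp_le)
      show "eventually (\<lambda>n. norm (blinfun_apply A (x n)) \<le> S) sequentially"
        using le x by (metis (mono_tags, lifting) always_eventually mult.right_neutral)
    qed simp
    \<comment> \<open>\<open>compact_op\<close> speaks of the open unit ball, which misses the unit
      vectors; halving puts them inside.\<close>
    have "blinfun_apply A ((1/2) *\<^sub>R x n) \<in> closure (blinfun_apply A ` ball 0 1)" for n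
      using x(2)[of n] by (intro closure_subset[THEN subsetD] imageI) simp
    then obtain l r where r: "strict_mono (r :: nat \<Rightarrow> nat)"
      and l: "((\<lambda>n. blinfun_apply A ((1/2) *\<^sub>R x n)) \<circ> r) \<longlonglongrightarrow> l"
      using cpt unfolding compact_op_def compact_def by metis
    define y where "y n = x (r n)" for n
    have y: "y n \<in> M" "norm (y n) = 1" for n by (auto simp: y_def x)
    have Ay: "(\<lambda>n. blinfun_apply A (y n)) \<longlonglongrightarrow> 2 *\<^sub>R l"
      using tendsto_scaleR[OF tendsto_const[of 2] l] by (simp add: o_def y_def blinfun.scaleR_right)
    have "(\<lambda>n. norm (blinfun_apply A (y n))) \<longlonglongrightarrow> S"
      using LIMSEQ_subseq_LIMSEQ[OF lim r] by (simp add: o_def y_def)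
    hence nl: "norm (2 *\<^sub>R l) = S"
      by (rule LIMSEQ_unique[OF tendsto_norm[OF Ay]])
    \<comment> \<open>\<open>A (y m + y n)\<close> is close to \<open>4 l\<close>, which forces \<open>norm (y m + y n)\<close> to be close to \<open>2\<close>;
      the parallelogram law then makes \<open>y\<close> a Cauchy sequence.\<close>
    have "Cauchy y"
    proof (rule metric_CauchyI)
      fix \<epsilon> :: real assume \<epsilon>: "\<epsilon> > 0"
      \<comment> \<open>The 1 in the minimum keeps \<open>2 * S - \<delta>\<close> positive, so that
        it may be squared; the divisor 5 leaves room above the error
        \<open>4 * S * \<delta>\<close>.\<close>
      define \<delta> where "\<delta> = min 1 (\<epsilon>\<^sup>2 / 5) * S"
      have \<delta>: "\<delta> > 0" "\<delta> \<le> S" "5 * \<delta> \<le> \<epsilon>\<^sup>2 * S" using \<epsilon> S by (auto simp: \<delta>_def min_def)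
      obtain N where N: "\<And>n. n \<ge> N \<Longrightarrow> norm (blinfun_apply A (y n) - 2 *\<^sub>R l) < \<delta> / 2"
        using LIMSEQ_D[OF Ay, of "\<delta>/2"] \<delta>(1) by auto
      show "\<exists>M. \<forall>m\<ge>M. \<forall>n\<ge>M. dist (y m) (y n) < \<epsilon>"
      proof (intro exI[of _ N] allI impI)
        fix m n assume mn: "m \<ge> N" "n \<ge> N"
        have "norm (blinfun_apply A (y m + y n) - 2 *\<^sub>R (2 *\<^sub>R l))
               \<le> norm (blinfun_apply A (y m) - 2 *\<^sub>R l) + norm (blinfun_apply A (y n) - 2 *\<^sub>R l)"
          using norm_triangle_ineq[of "blinfun_apply A (y m) - 2 *\<^sub>R l" "blinfun_apply A (y n) - 2 *\<^sub>R l"]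
          by (simp add: blinfun.add_right algebra_simps scaleR_2)
        hence "norm (blinfun_apply A (y m + y n) - 2 *\<^sub>R (2 *\<^sub>R l)) < \<delta>"
          using N[OF mn(1)] N[OF mn(2)] by linarith
        moreover have "norm (2 *\<^sub>R (2 *\<^sub>R l)) = 2 * S" using nl by simp
        ultimately have "2 * S - \<delta> < norm (blinfun_apply A (y m + y n))"
          using norm_triangle_ineq2[of "2 *\<^sub>R (2 *\<^sub>R l)" "blinfun_apply A (y m + y n)"]
          by (simp add: norm_minus_commute)
        also have "\<dots> \<le> S * norm (y m + y n)" using le M y by (simp add: subspace_add)
        finally have "(2 * S - \<delta>)\<^sup>2 < (S * norm (y m + y n))\<^sup>2" using \<delta> by (intro power_strict_mono) auto
        moreover have "(2 * S - \<delta>)\<^sup>2 \<ge> 4 * S\<^sup>2 - 4 * S * \<delta>" by (simp add: power2_diff)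
        ultimately have *: "4 * S\<^sup>2 - 4 * S * \<delta> < S\<^sup>2 * (norm (y m + y n))\<^sup>2" by (simp add: power_mult_distrib)
        have "(norm (y m - y n))\<^sup>2 + (norm (y m + y n))\<^sup>2 = 2 * (norm (y m))\<^sup>2 + 2 * (norm (y n))\<^sup>2"
          by (simp add: power2_norm_eq_inner inner_add_left inner_add_right inner_diff_left inner_diff_right)
        hence "(norm (y m + y n))\<^sup>2 = 4 - (norm (y m - y n))\<^sup>2" using y by simp
        with * have "S\<^sup>2 * (norm (y m - y n))\<^sup>2 < 4 * S * \<delta>" by (simp add: algebra_simps)
        also have "\<dots> \<le> S * (5 * \<delta>)" using S \<delta>(1) by simp
        also have "\<dots> \<le> S * (\<epsilon>\<^sup>2 * S)" using \<delta>(3) S by (intro mult_left_mono) auto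
        finally have "(norm (y m - y n))\<^sup>2 < \<epsilon>\<^sup>2" using S by (simp add: power2_eq_square)
        thus "dist (y m) (y n) < \<epsilon>" using \<epsilon> unfolding dist_norm by (simp add: power2_less_imp_less)
      qed
    qed
    then obtain f where f: "y \<longlonglongrightarrow> f" by (metis Cauchy_convergent_iff convergent_def)
    have "f \<in> M" using closed_sequentially[OF M(2) _ f] y by blast
    moreover have "norm f = 1" using tendsto_norm[OF f] y LIMSEQ_unique[OF _ tendsto_const] by fastforce
    moreover have "norm (blinfun_apply A f) = S"
    proof -
      have "(\<lambda>n. blinfun_apply A (y n)) \<longlonglongrightarrow> blinfun_apply A f"
        by (rule bounded_linear.tendsto[OF blinfun.bounded_linear_right f])
      hence "blinfun_apply A f = 2 *\<^sub>R l" by (rule LIMSEQ_unique[OF _ Ay])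
      with nl show ?thesis by simp
    qed
    ultimately show ?thesis using le by blast
  qed
qed

text \<open>A greedy choice of singular vectors: at \<open>f n\<close> the operator attains its norm
  on the orthogonal complement of the earlier vectors. It replaces an eigensystem of the absolute
  value of \<open>A\<close>, without forming that operator.\<close>

definition maxsys :: "('a::chilbert \<Rightarrow>\<^sub>L 'a) \<Rightarrow> (nat \<Rightarrow> 'a) \<Rightarrow> bool" where
  "maxsys A f \<longleftrightarrow> onseq f \<and> (\<forall>n x. (\<forall>i<n. cinner x (f i) = 0) \<longrightarrow>
      norm (blinfun_apply A x) \<le> norm (blinfun_apply A (f n)) * norm x)"

lemma maxsysD:
  assumes "maxsys A f"
  shows "onseq f"
    and "\<And>n x. (\<And>i. i < n \<Longrightarrow> cinner x (f i) = 0) \<Longrightarrow>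
      norm (blinfun_apply A x) \<le> norm (blinfun_apply A (f n)) * norm x"
  using assms by (auto simp: maxsys_def)

lemma ex_perp_in_span:
  fixes e f :: "nat \<Rightarrow> 'a::chilbert"
  assumes e: "onseq e"
  shows "\<exists>c. (\<exists>k\<le>n. c k \<noteq> 0) \<and> (\<forall>i<n. cinner (\<Sum>k\<le>n. scaleC (c k) (e k)) (f i) = 0)"
proof -
  have "\<exists>c. (\<exists>k\<in>{..n}. c k \<noteq> 0) \<and> (\<forall>i\<in>{..<n}. (\<Sum>k\<in>{..n}. cinner (e k) (f i) * c k) = 0)"
    by (rule homogeneous_system_nontrivial) auto
  thus ?thesis by (auto simp: cinner_sum_left mult.commute)
qed

lemma span_onseq_nonzero:
  assumes "onseq e" "\<exists>k\<le>n. c k \<noteq> 0"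
  shows "(\<Sum>k\<le>n. scaleC (c k) (e k)) \<noteq> 0"
proof
  assume "(\<Sum>k\<le>n. scaleC (c k) (e k)) = 0"
  moreover from assms(2) obtain k where "k \<le> n" "c k \<noteq> 0" by auto
  ultimately show False using cinner_sum_onseq[OF assms(1), of "{..n}" c k] by simp
qed

text \<open>The sequence \<open>e\<close> witnesses infinite dimension: the complement of
  \<open>n\<close> vectors meets the span of \<open>n + 1\<close> members of \<open>e\<close>
  nontrivially, so the greedy choice never stops.\<close>

lemma ex_maxsys:
  fixes A :: "'a::chilbert \<Rightarrow>\<^sub>L 'a"
  assumes cpt: "compact_op A" and e: "onseq (e :: nat \<Rightarrow> 'a)"
  shows "\<exists>f. maxsys A f"
proof -
  define P where "P f n r \<longleftrightarrow> norm r = 1 \<and> (\<forall>i<n. cinner r (f i) = 0) \<and>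
     (\<forall>x. (\<forall>i<n. cinner x (f i) = 0) \<longrightarrow> norm (blinfun_apply A x) \<le> norm (blinfun_apply A r) * norm x)"
    for f :: "nat \<Rightarrow> 'a" and n r
  have "\<exists>f. \<forall>n. P f n (f n)"
  proof (rule dependent_wf_choice[OF wf_less])
    fix f g :: "nat \<Rightarrow> 'a" and n r
    assume "\<And>z. (z, n) \<in> {(x, y). x < y} \<Longrightarrow> f z = g z"
    hence "\<And>z. z < n \<Longrightarrow> f z = g z" by auto
    thus "P f n r = P g n r" unfolding P_def by auto
  next
    fix n and f :: "nat \<Rightarrow> 'a"
    define M where "M = {x. \<forall>i<n. cinner x (f i) = 0}"
    have "subspace M" by (auto simp: M_def subspace_def cinner_add_left)
    moreover have "closed M"
    proof -
      have "M = (\<Inter>i\<in>{..<n}. {x. cinner x (f i) = 0})" by (auto simp: M_def)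
      thus ?thesis by (auto intro: closed_cinner_eq_0)
    qed
    moreover have "\<exists>x\<in>M. x \<noteq> 0"
      using ex_perp_in_span[OF e, of n f] span_onseq_nonzero[OF e] unfolding M_def by blast
    ultimately show "\<exists>r. P f n r"
      using norm_attained[OF cpt, of M] unfolding P_def M_def by blast
  qed
  then obtain f where f: "\<And>n. P f n (f n)" by blast
  have perp: "cinner (f n) (f i) = 0" if "i < n" for i n using f[of n] that by (simp add: P_def)
  have "onseq f" unfolding onseq_def
  proof (intro allI)
    fix i j
    have "norm (f i) = 1" using f[of i] by (simp add: P_def)
    thus "cinner (f i) (f j) = (if i = j then 1 else 0)"
      using perp[of i j] perp[of j i] by (cases i j rule: linorder_cases) (auto simp: cinner_self cinner_eq_0_commute)
  qed
  with f show ?thesis unfolding maxsys_def P_def by blast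
qed

text \<open>For small \<open>t\<close> the linear term would outweigh the quadratic one;
  \<open>t = b / D\<close> with \<open>D > C\<close> makes this explicit.\<close>

lemma quadratic_bound_imp_zero:
  fixes b C :: real
  assumes "\<And>t. 2 * t * b \<le> t\<^sup>2 * C"
  shows "b = 0"
proof (rule ccontr)
  assume b: "b \<noteq> 0"
  define D where "D = \<bar>C\<bar> + 1"
  have D: "D > 0" "C < D" by (auto simp: D_def)
  have "2 * (b / D) * b \<le> (b / D)\<^sup>2 * C" by (rule assms)
  also have "\<dots> \<le> (b / D)\<^sup>2 * D" using D by (intro mult_left_mono) auto
  also have "\<dots> = (b / D) * b" using D by (simp add: power2_eq_square)
  finally have "2 * (b * b / D) \<le> b * b / D" by (simp add: mult.assoc)
  hence "b * b / D \<le> 0" by linarith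
  moreover have "b * b / D > 0" using b D by (auto simp: zero_less_mult_iff zero_less_divide_iff)
  ultimately show False by simp
qed

lemma norm_add_scaleR_sq:
  fixes x y :: "'b::real_inner"
  shows "(norm (x + t *\<^sub>R y))\<^sup>2 = (norm x)\<^sup>2 + 2 * t * inner x y + t\<^sup>2 * (norm y)\<^sup>2"
  by (simp add: power2_norm_eq_inner inner_add_left inner_add_right inner_commute[of y x])
     (simp add: power2_eq_square algebra_simps)

text \<open>First-order condition at a maximum: moving from \<open>f n\<close> in the direction
  \<open>h\<close> stays in the admissible subspace, so the linear term of the variation must
  vanish.\<close>

lemma maxsys_orthogonal_image:
  assumes A: "A \<in> cbounded" and m: "maxsys A f"
    and h: "\<And>i. i \<le> n \<Longrightarrow> cinner h (f i) = 0"
  shows "cinner (blinfun_apply A (f n)) (blinfun_apply A h) = 0"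
proof -
  let ?S = "norm (blinfun_apply A (f n))"
  have on: "onseq f" by (rule maxsysD(1)[OF m])
  have real: "inner (blinfun_apply A (f n)) (blinfun_apply A k) = 0"
    if k: "\<And>i. i \<le> n \<Longrightarrow> cinner k (f i) = 0" for k
  proof (rule quadratic_bound_imp_zero)
    fix t :: real
    have "norm (blinfun_apply A (f n + t *\<^sub>R k)) \<le> ?S * norm (f n + t *\<^sub>R k)"
      by (rule maxsysD(2)[OF m]) (use on k in \<open>auto simp: cinner_add_left onseq_def\<close>)
    hence "(norm (blinfun_apply A (f n) + t *\<^sub>R blinfun_apply A k))\<^sup>2 \<le> ?S\<^sup>2 * (norm (f n + t *\<^sub>R k))\<^sup>2"
      by (metis blinfun.add_right blinfun.scaleR_right norm_ge_zero power_mono power_mult_distrib)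
    moreover have "inner (f n) k = 0" using k[of n] by (metis Re_cinner cinner_eq_0_commute order_refl zero_complex.sel(1))
    hence "(norm (f n + t *\<^sub>R k))\<^sup>2 = 1 + t\<^sup>2 * (norm k)\<^sup>2"
      using onseq_norm[OF on, of n] by (simp add: norm_add_scaleR_sq)
    moreover have "(norm (blinfun_apply A (f n) + t *\<^sub>R blinfun_apply A k))\<^sup>2
        = ?S\<^sup>2 + 2 * t * inner (blinfun_apply A (f n)) (blinfun_apply A k) + t\<^sup>2 * (norm (blinfun_apply A k))\<^sup>2"
      by (rule norm_add_scaleR_sq)
    ultimately show "2 * t * inner (blinfun_apply A (f n)) (blinfun_apply A k)
        \<le> t\<^sup>2 * (?S\<^sup>2 * (norm k)\<^sup>2 - (norm (blinfun_apply A k))\<^sup>2)"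
      by (simp add: algebra_simps)
  qed
  \<comment> \<open>The imaginary part is the real statement for the direction
    \<open>scaleC \<i> h\<close>.\<close>
  have "inner (blinfun_apply A (f n)) (scaleC \<i> (blinfun_apply A h)) = 0"
    using real[of "scaleC \<i> h"] h A by (simp add: cboundedD)
  with real[of h] h show ?thesis by (simp add: cinner_def complex_eq_iff)
qed

lemma maxsys_image_orthogonal:
  assumes "A \<in> cbounded" "maxsys A f" "i \<noteq> j"
  shows "cinner (blinfun_apply A (f i)) (blinfun_apply A (f j)) = 0"
proof -
  have on: "onseq f" by (rule maxsysD(1)[OF assms(2)])
  have *: "cinner (blinfun_apply A (f i)) (blinfun_apply A (f j)) = 0" if "i < j" for i j
    by (rule maxsys_orthogonal_image[OF assms(1,2)]) (use on that in \<open>auto simp: onseq_def\<close>)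
  show ?thesis using *[of i j] *[of j i] assms(3) by (metis cinner_eq_0_commute linorder_neqE_nat)
qed

lemma maxsys_norm_antimono:
  assumes "maxsys A f" "m \<le> n"
  shows "norm (blinfun_apply A (f n)) \<le> norm (blinfun_apply A (f m))"
proof -
  have on: "onseq f" by (rule maxsysD(1)[OF assms(1)])
  have "norm (blinfun_apply A (f n)) \<le> norm (blinfun_apply A (f m)) * norm (f n)"
    by (rule maxsysD(2)[OF assms(1)]) (use on assms(2) in \<open>auto simp: onseq_def\<close>)
  thus ?thesis using on by simp
qed

section \<open>Approximation numbers and maximal systems\<close>

lemma sing_val_le:
  assumes "F \<in> cbounded" "rank_le F n"
  shows "sing_val n A \<le> norm (A - F)"
  unfolding sing_val_def
  by (rule cInf_lower) (use assms in \<open>auto intro!: bdd_belowI[of _ 0]\<close>)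

lemma zero_cbounded: "0 \<in> cbounded"
  by (simp add: cbounded_def)

lemma zero_rank_le: "rank_le 0 n"
  unfolding rank_le_def by (intro exI[of _ "\<lambda>_. 0"]) simp

lemma sing_val_ge:
  assumes "\<And>F. F \<in> cbounded \<Longrightarrow> rank_le F n \<Longrightarrow> c \<le> norm (A - F)"
  shows "c \<le> sing_val n A"
  unfolding sing_val_def
  by (rule cInf_greatest) (use assms zero_cbounded zero_rank_le[of n] in blast)+

lemma sing_val_nonneg: "0 \<le> sing_val n A"
  by (rule sing_val_ge) simp

definition head_op :: "('a::chilbert \<Rightarrow>\<^sub>L 'a) \<Rightarrow> (nat \<Rightarrow> 'a) \<Rightarrow> nat \<Rightarrow> 'a \<Rightarrow>\<^sub>L 'a" where
  "head_op A f n = Blinfun (\<lambda>x. \<Sum>k<n. scaleC (cinner x (f k)) (blinfun_apply A (f k)))"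

lemma head_op_apply:
  "blinfun_apply (head_op A f n) x = (\<Sum>k<n. scaleC (cinner x (f k)) (blinfun_apply A (f k)))"
proof -
  have "bounded_linear (\<lambda>x. \<Sum>k<n. scaleC (cinner x (f k)) (blinfun_apply A (f k)))"
    by (intro bounded_linear_sum bounded_linear_compose[OF bounded_linear_scaleC_left bounded_linear_cinner_left])
  thus ?thesis by (simp add: head_op_def bounded_linear_Blinfun_apply)
qed

lemma maxsys_tail:
  assumes A: "A \<in> cbounded" and m: "maxsys A f"
  shows "norm (blinfun_apply A x - (\<Sum>k<n. scaleC (cinner x (f k)) (blinfun_apply A (f k))))
          \<le> norm (blinfun_apply A (f n)) * norm x"
proof -
  have on: "onseq f" by (rule maxsysD(1)[OF m])
  define y where "y = x - (\<Sum>k<n. scaleC (cinner x (f k)) (f k))"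
  have "norm (blinfun_apply A y) \<le> norm (blinfun_apply A (f n)) * norm y"
    by (rule maxsysD(2)[OF m]) (simp add: y_def cinner_diff_left cinner_sum_onseq[OF on])
  also have "(norm y)\<^sup>2 \<le> (norm x)\<^sup>2"
    unfolding y_def pythagoras_projection[OF on finite_lessThan] by (simp add: sum_nonneg)
  hence "norm (blinfun_apply A (f n)) * norm y \<le> norm (blinfun_apply A (f n)) * norm x"
    by (intro mult_left_mono power2_le_imp_le[of "norm y" "norm x"]) auto
  finally show ?thesis
    by (simp add: y_def blinfun.diff_right cbounded_sum_scaleC[OF A])
qed

text \<open>The Schmidt truncation \<open>head_op A f n\<close> attains the infimum. Conversely, a
  competitor of rank at most \<open>n\<close> kills a nonzero \<open>x\<close> in the span of
  \<open>f 0, ..., f n\<close>. There \<open>A\<close> expands by at least the norm of its value at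
  \<open>f n\<close>, because the images of the \<open>f k\<close> are orthogonal with decreasing
  norms.\<close>

theorem sing_val_maxsys:
  assumes A: "A \<in> cbounded" and m: "maxsys A f"
  shows "sing_val n A = norm (blinfun_apply A (f n))"
proof (rule antisym)
  have on: "onseq f" by (rule maxsysD(1)[OF m])
  have "head_op A f n \<in> cbounded"
    by (simp add: cbounded_def head_op_apply scaleC_sum_right scaleC_scaleC)
  moreover have "rank_le (head_op A f n) n"
    unfolding rank_le_def head_op_apply
    by (intro exI[of _ "\<lambda>k. blinfun_apply A (f k)"] allI) (rule exI, rule refl)
  ultimately have "sing_val n A \<le> norm (A - head_op A f n)" by (rule sing_val_le)
  also have "\<dots> \<le> norm (blinfun_apply A (f n))"
    using maxsys_tail[OF A m] by (intro norm_blinfun_bound) (auto simp: blinfun.diff_left head_op_apply)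
  finally show "sing_val n A \<le> norm (blinfun_apply A (f n))" .
  show "norm (blinfun_apply A (f n)) \<le> sing_val n A"
  proof (rule sing_val_ge)
    fix F :: "'a \<Rightarrow>\<^sub>L 'a" assume F: "F \<in> cbounded" "rank_le F n"
    then obtain v a where a: "\<And>x. blinfun_apply F x = (\<Sum>i<n. scaleC (a x i) (v i))"
      unfolding rank_le_def by metis
    \<comment> \<open>The coefficients \<open>a x i\<close> need not be linear in \<open>x\<close>,
      so only those at the \<open>f k\<close> are used: \<open>n\<close> equations for
      \<open>n + 1\<close> unknowns.\<close>
    obtain c where c: "\<exists>k\<le>n. c k \<noteq> 0" "\<And>i. i < n \<Longrightarrow> (\<Sum>k\<le>n. a (f k) i * c k) = 0"
      using homogeneous_system_nontrivial[of "{..<n}" "{..n}" "\<lambda>i k. a (f k) i"] by auto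
    define x where "x = (\<Sum>k\<le>n. scaleC (c k) (f k))"
    have x0: "x \<noteq> 0" unfolding x_def by (rule span_onseq_nonzero[OF on c(1)])
    have "blinfun_apply F x = (\<Sum>k\<le>n. \<Sum>i<n. scaleC (c k) (scaleC (a (f k) i) (v i)))"
      unfolding x_def cbounded_sum_scaleC[OF F(1)] by (simp add: a scaleC_sum_right)
    also have "\<dots> = (\<Sum>i<n. scaleC (\<Sum>k\<le>n. a (f k) i * c k) (v i))"
      by (subst sum.swap) (simp add: scaleC_sum_left scaleC_scaleC mult.commute)
    finally have Fx: "blinfun_apply F x = 0" using c(2) by simp
    have "(norm (blinfun_apply A (f n)) * norm x)\<^sup>2 = (\<Sum>k\<le>n. (cmod (c k) * norm (blinfun_apply A (f n)))\<^sup>2)"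
      by (simp add: x_def power_mult_distrib norm_sum_onseq[OF on] sum_distrib_left mult.commute)
    also have "\<dots> \<le> (\<Sum>k\<le>n. (norm (scaleC (c k) (blinfun_apply A (f k))))\<^sup>2)"
      using maxsys_norm_antimono[OF m]
      by (intro sum_mono power_mono) (auto simp: norm_scaleC intro!: mult_left_mono)
    also have "\<dots> = (norm (\<Sum>k\<le>n. scaleC (c k) (blinfun_apply A (f k))))\<^sup>2"
      by (rule norm_sum_orthogonal[symmetric]) (auto simp: maxsys_image_orthogonal[OF A m])
    also have "\<dots> = (norm (blinfun_apply (A - F) x))\<^sup>2"
      by (simp add: blinfun.diff_left Fx) (simp add: x_def cbounded_sum_scaleC[OF A])
    finally have "norm (blinfun_apply A (f n)) * norm x \<le> norm (blinfun_apply (A - F) x)"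
      by (rule power2_le_imp_le) simp
    also have "\<dots> \<le> norm (A - F) * norm x" by (rule norm_blinfun)
    finally show "norm (blinfun_apply A (f n)) \<le> norm (A - F)" using x0 by simp
  qed
qed

section \<open>The ideal of weak trace class operators\<close>

lemma L1infD: "A \<in> L1inf \<Longrightarrow> A \<in> cbounded" "A \<in> L1inf \<Longrightarrow> compact_op A"
  by (auto simp: L1inf_def)

lemma L1inf_sing_val_bound:
  assumes "A \<in> L1inf"
  shows "\<exists>C. \<forall>n. sing_val n A \<le> C / real (n + 1)"
proof -
  from assms obtain C where "\<And>n. real (n + 1) * sing_val n A \<le> C"
    unfolding L1inf_def bdd_above_def by auto
  thus ?thesis by (intro exI[of _ C]) (auto simp: field_simps)
qed

lemma L1infI:
  assumes "A \<in> cbounded" "compact_op A" "\<And>n. sing_val n A \<le> C / real (n + 1)"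
  shows "A \<in> L1inf"
  unfolding L1inf_def
  using assms by (auto simp: field_simps intro!: bdd_aboveI[of _ C])

lemma sum_lessThan_add:
  fixes h :: "nat \<Rightarrow> 'b::comm_monoid_add"
  shows "(\<Sum>i<m + n. h i) = (\<Sum>i<m. h i) + (\<Sum>i<n. h (m + i))"
  by (induction n) (simp_all add: add.assoc)

lemma rank_le_add:
  assumes "rank_le F m" "rank_le G n"
  shows "rank_le (F + G) (m + n)"
proof -
  from assms(1) obtain v a where a: "\<And>x. blinfun_apply F x = (\<Sum>i<m. scaleC (a x i) (v i))"
    unfolding rank_le_def by metis
  from assms(2) obtain w b where b: "\<And>x. blinfun_apply G x = (\<Sum>i<n. scaleC (b x i) (w i))"
    unfolding rank_le_def by metis
  show ?thesis
    unfolding rank_le_def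
  proof (intro exI allI)
    fix x
    show "blinfun_apply (F + G) x = (\<Sum>i<m + n. scaleC (if i < m then a x i else b x (i - m))
        (if i < m then v i else w (i - m)))"
      unfolding sum_lessThan_add by (simp add: blinfun.add_left a b)
  qed
qed

lemma rank_le_mono:
  assumes "rank_le F m" "m \<le> n"
  shows "rank_le F n"
  using rank_le_add[OF assms(1) zero_rank_le[of "n - m"]] assms(2) by simp

lemma sing_val_antimono: "m \<le> n \<Longrightarrow> sing_val n A \<le> sing_val m A"
  by (rule sing_val_ge) (auto intro: sing_val_le rank_le_mono)

text \<open>Approximants add up together with their ranks; the two infima are taken one after the
  other.\<close>

lemma sing_val_add: "sing_val (m + n) (A + B) \<le> sing_val m A + sing_val n B"
proof -
  have 1: "sing_val (m + n) (A + B) \<le> norm (A - F) + norm (B - G)"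
    if "F \<in> cbounded" "rank_le F m" "G \<in> cbounded" "rank_le G n" for F G
  proof -
    have "sing_val (m + n) (A + B) \<le> norm ((A + B) - (F + G))"
      using that by (intro sing_val_le cbounded_add rank_le_add)
    also have "(A + B) - (F + G) = (A - F) + (B - G)" by simp
    finally show ?thesis using norm_triangle_ineq order_trans by blast
  qed
  have "sing_val (m + n) (A + B) - norm (A - F) \<le> sing_val n B" if "F \<in> cbounded" "rank_le F m" for F
    by (rule sing_val_ge) (use 1[OF that] in \<open>simp add: algebra_simps\<close>)
  hence "sing_val (m + n) (A + B) - sing_val n B \<le> sing_val m A"
    by (intro sing_val_ge) (simp add: algebra_simps)
  thus ?thesis by simp
qed

lemma compact_closed_subset: "compact K \<Longrightarrow> closed S \<Longrightarrow> S \<subseteq> K \<Longrightarrow> compact S"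
  using compact_Int_closed[of K S] by (simp add: Int_absorb1)

lemma compact_op_add:
  fixes A B :: "'a::chilbert \<Rightarrow>\<^sub>L 'a"
  assumes "compact_op A" "compact_op B"
  shows "compact_op (A + B)"
proof -
  let ?K = "{x + y |x y. x \<in> closure (blinfun_apply A ` ball 0 1) \<and> y \<in> closure (blinfun_apply B ` ball 0 1)}"
  have K: "compact ?K" using assms by (intro compact_sums) (auto simp: compact_op_def)
  have "blinfun_apply (A + B) ` ball 0 1 \<subseteq> ?K"
  proof (intro image_subsetI)
    fix x :: 'a assume x: "x \<in> ball 0 1"
    have "blinfun_apply T x \<in> closure (blinfun_apply T ` ball 0 1)" for T :: "'a \<Rightarrow>\<^sub>L 'a"
      using x by (intro subsetD[OF closure_subset] imageI)
    thus "blinfun_apply (A + B) x \<in> ?K" unfolding blinfun.add_left by blast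
  qed
  hence "closure (blinfun_apply (A + B) ` ball 0 1) \<subseteq> ?K"
    using K by (intro closure_minimal compact_imp_closed)
  thus ?thesis unfolding compact_op_def
    by (rule compact_closed_subset[OF K closed_closure])
qed

lemma L1inf_add:
  assumes "A \<in> L1inf" "B \<in> L1inf"
  shows "A + B \<in> L1inf"
proof -
  obtain C where C: "\<And>n. sing_val n A \<le> C / real (n + 1)" using L1inf_sing_val_bound[OF assms(1)] by blast
  obtain D where D: "\<And>n. sing_val n B \<le> D / real (n + 1)" using L1inf_sing_val_bound[OF assms(2)] by blast
  have "0 \<le> C" "0 \<le> D"
    using C[of 0] D[of 0] sing_val_nonneg[of 0 A] sing_val_nonneg[of 0 B] by auto
  show ?thesis
  proof (rule L1infI[where C = "2 * (C + D)"])
    fix n :: nat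
    \<comment> \<open>Splitting the index evenly costs the factor 2 in the bound.\<close>
    define k where "k = n div 2"
    have k: "k + k \<le> n" "real (n + 1) \<le> 2 * real (k + 1)" by (auto simp: k_def)
    have "sing_val n (A + B) \<le> sing_val (k + k) (A + B)" by (rule sing_val_antimono[OF k(1)])
    also have "\<dots> \<le> sing_val k A + sing_val k B" by (rule sing_val_add)
    also have "\<dots> \<le> (C + D) / real (k + 1)" using C[of k] D[of k] by (simp add: add_divide_distrib)
    also have "\<dots> = 2 * (C + D) / (2 * real (k + 1))" by (subst mult_divide_mult_cancel_left) auto
    also have "\<dots> \<le> 2 * (C + D) / real (n + 1)"
      using k(2) \<open>0 \<le> C\<close> \<open>0 \<le> D\<close> by (intro divide_left_mono) auto
    finally show "sing_val n (A + B) \<le> 2 * (C + D) / real (n + 1)" .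
  qed (use assms in \<open>auto intro: cbounded_add compact_op_add dest: L1infD\<close>)
qed

definition cscale :: "complex \<Rightarrow> ('a::chilbert \<Rightarrow>\<^sub>L 'a) \<Rightarrow> 'a \<Rightarrow>\<^sub>L 'a" where
  "cscale c A = Blinfun (\<lambda>x. scaleC c (blinfun_apply A x))"

lemma cscale_apply [simp]: "blinfun_apply (cscale c A) x = scaleC c (blinfun_apply A x)"
proof -
  have "bounded_linear (\<lambda>x. scaleC c (blinfun_apply A x))"
    by (intro bounded_linear_compose[OF bounded_linear_scaleC_right] blinfun.bounded_linear_right)
  thus ?thesis by (simp add: cscale_def bounded_linear_Blinfun_apply)
qed

lemma cscale_of_real: "cscale (complex_of_real r) A = r *\<^sub>R A"
  by (rule blinfun_eqI) (simp add: scaleC_of_real blinfun.scaleR_left)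

lemma cscale_diff: "cscale c A - cscale c B = cscale c (A - B)"
  by (rule blinfun_eqI) (simp add: blinfun.diff_left scaleC_diff_right)

lemma norm_cscale_le: "norm (cscale c A) \<le> cmod c * norm A"
proof (rule norm_blinfun_bound)
  fix x
  show "norm (blinfun_apply (cscale c A) x) \<le> cmod c * norm A * norm x"
    using norm_blinfun[of A x] by (simp add: norm_scaleC mult_left_mono mult.assoc)
qed simp

lemma cscale_cbounded: "A \<in> cbounded \<Longrightarrow> cscale c A \<in> cbounded"
  by (simp add: cbounded_def scaleC_scaleC mult.commute)

lemma sing_val_cscale_le: "sing_val n (cscale c A) \<le> cmod c * sing_val n A"
proof -
  have 1: "sing_val n (cscale c A) \<le> cmod c * norm (A - F)" if F: "F \<in> cbounded" "rank_le F n" for F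
  proof -
    from F(2) obtain v a where a: "\<And>x. blinfun_apply F x = (\<Sum>i<n. scaleC (a x i) (v i))"
      unfolding rank_le_def by metis
    have "rank_le (cscale c F) n"
      unfolding rank_le_def
    proof (intro exI allI)
      fix x
      show "blinfun_apply (cscale c F) x = (\<Sum>i<n. scaleC (c * a x i) (v i))"
        by (simp add: a scaleC_sum_right scaleC_scaleC)
    qed
    hence "sing_val n (cscale c A) \<le> norm (cscale c A - cscale c F)"
      using F by (intro sing_val_le cscale_cbounded)
    also have "\<dots> \<le> cmod c * norm (A - F)" unfolding cscale_diff by (rule norm_cscale_le)
    finally show ?thesis .
  qed
  show ?thesis
  proof (cases "c = 0")
    case True
    thus ?thesis using 1[OF zero_cbounded zero_rank_le] by simp
  next
    case False
    hence "sing_val n (cscale c A) / cmod c \<le> sing_val n A"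
      using 1 by (intro sing_val_ge) (simp add: field_simps)
    thus ?thesis using False by (simp add: field_simps)
  qed
qed

lemma compact_op_cscale:
  fixes A :: "'a::chilbert \<Rightarrow>\<^sub>L 'a"
  assumes "compact_op A"
  shows "compact_op (cscale c A)"
proof -
  let ?K = "scaleC c ` closure (blinfun_apply A ` ball 0 1)"
  have K: "compact ?K" using assms
    by (intro compact_continuous_image linear_continuous_on bounded_linear_scaleC_right)
       (auto simp: compact_op_def)
  have "blinfun_apply (cscale c A) ` ball 0 1 \<subseteq> ?K"
  proof (intro image_subsetI)
    fix x :: 'a assume "x \<in> ball 0 1"
    hence "blinfun_apply A x \<in> closure (blinfun_apply A ` ball 0 1)"
      by (intro subsetD[OF closure_subset] imageI)
    thus "blinfun_apply (cscale c A) x \<in> ?K" by simp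
  qed
  hence "closure (blinfun_apply (cscale c A) ` ball 0 1) \<subseteq> ?K"
    using K by (intro closure_minimal compact_imp_closed)
  thus ?thesis unfolding compact_op_def
    by (rule compact_closed_subset[OF K closed_closure])
qed

lemma L1inf_cscale:
  assumes "A \<in> L1inf"
  shows "cscale c A \<in> L1inf"
proof -
  obtain C where C: "\<And>n. sing_val n A \<le> C / real (n + 1)" using L1inf_sing_val_bound[OF assms] by blast
  show ?thesis
  proof (rule L1infI[where C = "cmod c * C"])
    fix n
    show "sing_val n (cscale c A) \<le> cmod c * C / real (n + 1)"
      using sing_val_cscale_le[of n c A] mult_left_mono[OF C[of n], of "cmod c"] by simp
  qed (use assms in \<open>auto intro: cscale_cbounded compact_op_cscale dest: L1infD\<close>)
qed

lemma L1inf_scaleR: "A \<in> L1inf \<Longrightarrow> r *\<^sub>R A \<in> L1inf"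
  using L1inf_cscale[of A "complex_of_real r"] by (simp add: cscale_of_real)

section \<open>Membership of Schmidt series in the ideal\<close>

lemma compact_op_approx:
  fixes A :: "'a::chilbert \<Rightarrow>\<^sub>L 'a"
  assumes "\<And>\<epsilon>. \<epsilon> > 0 \<Longrightarrow> \<exists>K. compact K \<and> (\<forall>x\<in>ball 0 1. \<exists>y\<in>K. dist y (blinfun_apply A x) < \<epsilon>)"
  shows "compact_op A"
  unfolding compact_op_def compact_eq_totally_bounded
proof (intro conjI allI impI)
  show "complete (closure (blinfun_apply A ` ball 0 1))" by (simp add: complete_eq_closed)
  fix \<epsilon> :: real assume "\<epsilon> > 0"
  then obtain K where K: "compact K" "\<And>x. x \<in> ball 0 1 \<Longrightarrow> \<exists>y\<in>K. dist y (blinfun_apply A x) < \<epsilon> / 4"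
    using assms[of "\<epsilon> / 4"] by auto
  obtain k where k: "finite k" "K \<subseteq> (\<Union>x\<in>k. ball x (\<epsilon> / 4))"
    using K(1) \<open>\<epsilon> > 0\<close> unfolding compact_eq_totally_bounded by (meson divide_pos_pos zero_less_numeral)
  \<comment> \<open>A net for the compact set also serves the image. Closed balls of half the radius
    are used because a finite union of them is closed and so contains the closure of the
    image.\<close>
  have "blinfun_apply A ` ball 0 1 \<subseteq> (\<Union>x\<in>k. cball x (\<epsilon> / 2))"
  proof (intro subsetI)
    fix z assume "z \<in> blinfun_apply A ` ball 0 1"
    then obtain x where x: "x \<in> ball 0 1" "z = blinfun_apply A x" by blast
    obtain y where y: "y \<in> K" "dist y z < \<epsilon> / 4" using K(2)[OF x(1)] x(2) by blast
    then obtain w where w: "w \<in> k" "dist w y < \<epsilon> / 4" using k(2) by auto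
    have "dist w z \<le> \<epsilon> / 2" using dist_triangle[of w z y] y w by simp
    thus "z \<in> (\<Union>x\<in>k. cball x (\<epsilon> / 2))" using w by auto
  qed
  hence "closure (blinfun_apply A ` ball 0 1) \<subseteq> (\<Union>x\<in>k. cball x (\<epsilon> / 2))"
    using k(1) by (intro closure_minimal) auto
  also have "\<dots> \<subseteq> (\<Union>x\<in>k. ball x \<epsilon>)" using \<open>\<epsilon> > 0\<close> by (auto simp: mem_cball)
  finally show "\<exists>k. finite k \<and> closure (blinfun_apply A ` ball 0 1) \<subseteq> (\<Union>x\<in>k. ball x \<epsilon>)"
    using k(1) by blast
qed

text \<open>Truncated Schmidt series take such values on the unit ball, with coefficients in a fixed
  disc.\<close>

lemma compact_bounded_combinations:
  fixes g :: "nat \<Rightarrow> 'a::chilbert"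
  shows "\<exists>K. compact K \<and> (\<forall>c. (\<forall>k. cmod (c k) \<le> C) \<longrightarrow> (\<Sum>k<n. scaleC (c k) (g k)) \<in> K)"
proof (induction n)
  case 0
  thus ?case by (intro exI[of _ "{0}"]) simp
next
  case (Suc n)
  then obtain K where K: "compact K" "\<And>c. (\<forall>k. cmod (c k) \<le> C) \<Longrightarrow> (\<Sum>k<n. scaleC (c k) (g k)) \<in> K"
    by blast
  let ?L = "(\<lambda>c. scaleC c (g n)) ` cball 0 C"
  have "compact ?L"
    by (intro compact_continuous_image linear_continuous_on bounded_linear_scaleC_left) auto
  hence "compact {x + y |x y. x \<in> K \<and> y \<in> ?L}" by (intro compact_sums K)
  moreover have "(\<Sum>k<Suc n. scaleC (c k) (g k)) \<in> {x + y |x y. x \<in> K \<and> y \<in> ?L}"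
    if "\<forall>k. cmod (c k) \<le> C" for c
    unfolding sum.lessThan_Suc using K(2)[OF that] that
    by (intro CollectI exI[of _ "\<Sum>k<n. scaleC (c k) (g k)"] exI[of _ "scaleC (c n) (g n)"]) auto
  ultimately show ?case by blast
qed

lemma sop_truncate:
  assumes f: "subon f" and g: "subon g" and s: "\<forall>k. \<bar>s k\<bar> \<le> C"
    and t: "\<And>k. k \<ge> n \<Longrightarrow> \<bar>s k\<bar> \<le> t"
  shows "norm (blinfun_apply (sop s f g) x - (\<Sum>k<n. scaleC (complex_of_real (s k) * cinner x (f k)) (g k)))
           \<le> t * norm x"
proof -
  have t0: "0 \<le> t" using t[of n] by auto
  let ?h = "\<lambda>k. scaleC (complex_of_real (s k) * cinner x (f k)) (g k)"
  have "(\<lambda>k. ?h k - (if k \<in> {..<n} then ?h k else 0)) sums (blinfun_apply (sop s f g) x - (\<Sum>k<n. ?h k))"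
    by (intro sums_diff sop_sums[OF f g s] sums_If_finite_set) simp
  also have "(\<lambda>k. ?h k - (if k \<in> {..<n} then ?h k else 0))
     = (\<lambda>k. scaleC (complex_of_real (if k < n then 0 else s k) * cinner x (f k)) (g k))"
    by auto
  finally have "blinfun_apply (sop s f g) x - (\<Sum>k<n. ?h k)
     = (\<Sum>k. scaleC (complex_of_real (if k < n then 0 else s k) * cinner x (f k)) (g k))"
    by (rule sums_unique)
  also have "norm \<dots> \<le> t * norm x"
    by (rule norm_sop_suminf_le[OF f g]) (use t t0 in auto)
  finally show ?thesis .
qed

text \<open>A bound on the entries in their given order, hence stronger than membership in the weak
  l1 space. It is not preserved by permutations with the same constant, so a reordered sequence gets
  its own bound.\<close>

definition decay :: "(nat \<Rightarrow> real) \<Rightarrow> real \<Rightarrow> bool" where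
  "decay s C \<longleftrightarrow> (\<forall>k. \<bar>s k\<bar> \<le> C / real (k + 1))"

lemma decay_nonneg: "decay s C \<Longrightarrow> 0 \<le> C"
  unfolding decay_def by (metis abs_ge_zero add_0 div_by_1 of_nat_1 order_trans)

lemma decay_bounded: "decay s C \<Longrightarrow> \<forall>k. \<bar>s k\<bar> \<le> C"
proof
  fix k assume d: "decay s C"
  have "\<bar>s k\<bar> \<le> C / real (k + 1)" using d by (simp add: decay_def)
  also have "\<dots> \<le> C / 1" using decay_nonneg[OF d] by (intro divide_left_mono) auto
  finally show "\<bar>s k\<bar> \<le> C" by simp
qed

lemma decay_tail:
  assumes "decay s C" "n \<le> k"
  shows "\<bar>s k\<bar> \<le> C / real (n + 1)"
proof -
  have "\<bar>s k\<bar> \<le> C / real (k + 1)" using assms by (simp add: decay_def)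
  also have "\<dots> \<le> C / real (n + 1)" using decay_nonneg[OF assms(1)] assms(2) by (intro divide_left_mono) auto
  finally show ?thesis .
qed

lemma decay_add: "decay s C \<Longrightarrow> decay t D \<Longrightarrow> decay (\<lambda>k. s k + t k) (C + D)"
  unfolding decay_def add_divide_distrib by (blast intro: order_trans[OF abs_triangle_ineq add_mono])

lemma decay_scale: "decay s C \<Longrightarrow> decay (\<lambda>k. c * s k) (\<bar>c\<bar> * C)"
proof -
  assume d: "decay s C"
  show ?thesis unfolding decay_def
  proof
    fix k
    show "\<bar>c * s k\<bar> \<le> \<bar>c\<bar> * C / real (k + 1)"
      using mult_left_mono[OF d[unfolded decay_def, rule_format, of k], of "\<bar>c\<bar>"] by (simp add: abs_mult)
  qed
qed

text \<open>Cutting the series after \<open>n\<close> terms leaves an error of norm at most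
  \<open>C / (n + 1)\<close>. This gives compactness, and it bounds the singular values because the
  cut series has rank at most \<open>n\<close>.\<close>

lemma sop_L1inf:
  assumes f: "subon f" and g: "subon g" and d: "decay s C"
  shows "sop s f g \<in> L1inf"
proof (rule L1infI[where C = C])
  note s = decay_bounded[OF d]
  have C: "0 \<le> C" by (rule decay_nonneg[OF d])
  show "sop s f g \<in> cbounded" by (rule sop_cbounded[OF f g s])
  show "compact_op (sop s f g)"
  proof (rule compact_op_approx)
    fix \<epsilon> :: real assume \<epsilon>: "\<epsilon> > 0"
    obtain n where n: "C / \<epsilon> < real n" using reals_Archimedean2 by blast
    hence n': "C / real (n + 1) < \<epsilon>" using \<epsilon> C by (simp add: field_simps)
    obtain K where K: "compact K" "\<And>c. (\<forall>k. cmod (c k) \<le> C) \<Longrightarrow> (\<Sum>k<n. scaleC (c k) (g k)) \<in> K"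
      using compact_bounded_combinations[where C = C and n = n and g = g] by auto
    have "\<exists>y\<in>K. dist y (blinfun_apply (sop s f g) x) < \<epsilon>" if x: "x \<in> ball 0 1" for x
    proof (rule bexI)
      let ?y = "\<Sum>k<n. scaleC (complex_of_real (s k) * cinner x (f k)) (g k)"
      have "cmod (complex_of_real (s k) * cinner x (f k)) \<le> C" for k
      proof -
        have "cmod (cinner x (f k)) \<le> norm x * norm (f k)" by (rule norm_cinner_le)
        also have "\<dots> \<le> 1 * 1" using x f by (intro mult_mono) (auto simp: subon_def)
        finally have "\<bar>s k\<bar> * cmod (cinner x (f k)) \<le> C * 1" using s C by (intro mult_mono) auto
        thus ?thesis by (simp add: norm_mult)
      qed
      thus "?y \<in> K" by (intro K(2)) auto
      have "norm (blinfun_apply (sop s f g) x - ?y) \<le> C / real (n + 1) * norm x"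
        by (rule sop_truncate[OF f g s]) (rule decay_tail[OF d])
      also have "\<dots> \<le> C / real (n + 1) * 1" using x C by (intro mult_left_mono) auto
      finally show "dist ?y (blinfun_apply (sop s f g) x) < \<epsilon>" using n' by (simp add: dist_norm norm_minus_commute)
    qed
    thus "\<exists>K. compact K \<and> (\<forall>x\<in>ball 0 1. \<exists>y\<in>K. dist y (blinfun_apply (sop s f g) x) < \<epsilon>)"
      using K(1) by blast
  qed
  fix n
  define F where "F = sop (\<lambda>k. if k < n then s k else 0) f g"
  have s': "\<forall>k. \<bar>if k < n then s k else 0\<bar> \<le> C" using s C by auto
  have F: "blinfun_apply F x = (\<Sum>k<n. scaleC (complex_of_real (s k) * cinner x (f k)) (g k))" for x
  proof -
    have "norm (blinfun_apply F x - (\<Sum>k<n. scaleC (complex_of_real (if k < n then s k else 0) * cinner x (f k)) (g k))) \<le> 0 * norm x"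
      unfolding F_def by (rule sop_truncate[OF f g s']) simp
    thus ?thesis by simp
  qed
  have "F \<in> cbounded" unfolding F_def by (rule sop_cbounded[OF f g s'])
  moreover have "rank_le F n" unfolding rank_le_def F by (intro exI[of _ g] allI) (rule exI, rule refl)
  ultimately have "sing_val n (sop s f g) \<le> norm (sop s f g - F)" by (rule sing_val_le)
  also have "\<dots> \<le> C / real (n + 1)"
    by (rule norm_blinfun_bound) (use C sop_truncate[OF f g s decay_tail[OF d]] in \<open>auto simp: blinfun.diff_left F\<close>)
  finally show "sing_val n (sop s f g) \<le> C / real (n + 1)" .
qed

section \<open>Singular value and spectral decompositions\<close>

lemma L1inf_decay:
  assumes "A \<in> L1inf"
  shows "\<exists>C. decay (\<lambda>n. sing_val n A) C"
  using L1inf_sing_val_bound[OF assms] by (simp add: decay_def sing_val_nonneg)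

text \<open>Orthogonality to all \<open>f k\<close> allows the maximality bound for every
  \<open>n\<close>, and these bounds tend to 0.\<close>

lemma L1inf_vanish:
  assumes A: "A \<in> L1inf" and m: "maxsys A f" and y: "\<And>k. cinner y (f k) = 0"
  shows "blinfun_apply A y = 0"
proof -
  obtain C where C: "decay (\<lambda>n. sing_val n A) C" using L1inf_decay[OF A] by blast
  have "norm (blinfun_apply A y) \<le> (C * norm y) / real (Suc n)" for n
  proof -
    have "norm (blinfun_apply A y) \<le> norm (blinfun_apply A (f n)) * norm y"
      by (rule maxsysD(2)[OF m]) (rule y)
    also have "norm (blinfun_apply A (f n)) \<le> C / real (n + 1)"
      using decay_tail[OF C order_refl, of n] by (simp add: sing_val_maxsys[OF L1infD(1)[OF A] m])
    hence "norm (blinfun_apply A (f n)) * norm y \<le> C / real (n + 1) * norm y" by (rule mult_right_mono) simp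
    finally show ?thesis by simp
  qed
  moreover have "(\<lambda>n. (C * norm y) / real (Suc n)) \<longlonglongrightarrow> 0"
    by (rule LIMSEQ_Suc[OF lim_const_over_n])
  ultimately have "norm (blinfun_apply A y) \<le> 0"
    by (intro LIMSEQ_le_const) auto
  thus ?thesis by simp
qed

theorem singular_value_decomposition:
  fixes A :: "'a::chilbert \<Rightarrow>\<^sub>L 'a"
  assumes A: "A \<in> L1inf" and e: "onseq (e :: nat \<Rightarrow> 'a)"
  shows "\<exists>f g. onseq f \<and> subon g \<and> A = sop (\<lambda>n. sing_val n A) f g"
proof -
  note cb = L1infD(1)[OF A]
  obtain f where m: "maxsys A f" using ex_maxsys[OF L1infD(2)[OF A] e] by blast
  have on: "onseq f" by (rule maxsysD(1)[OF m])
  obtain C where C: "decay (\<lambda>n. sing_val n A) C" using L1inf_decay[OF A] by blast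
  \<comment> \<open>Where the singular value is 0 the division gives \<open>g n = 0\<close>, which
    \<open>subon\<close> permits.\<close>
  define g where "g n = (1 / sing_val n A) *\<^sub>R blinfun_apply A (f n)" for n
  have sv: "sing_val n A = norm (blinfun_apply A (f n))" for n by (rule sing_val_maxsys[OF cb m])
  have "subon g"
    unfolding subon_def by (simp add: g_def maxsys_image_orthogonal[OF cb m]) (simp add: sv)
  moreover have "A = sop (\<lambda>n. sing_val n A) f g"
    by (rule sop_eqI[OF on \<open>subon g\<close> decay_bounded[OF C] cb])
       (auto simp: g_def sv intro: L1inf_vanish[OF A m])
  ultimately show ?thesis using on by blast
qed

text \<open>A real-valued quadratic form is symmetric by polarization: \<open>x + y\<close> settles
  the imaginary parts and \<open>x + scaleC \<i> y\<close> the real ones.\<close>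

lemma pos_op_selfadjoint:
  assumes A: "A \<in> cbounded" and p: "pos_op A"
  shows "cinner (blinfun_apply A x) y = cinner x (blinfun_apply A y)"
proof -
  have im: "Im (cinner (blinfun_apply A z) z) = 0" for z using p by (simp add: pos_op_def)
  have "Im (cinner (blinfun_apply A x) y + cinner (blinfun_apply A y) x) = 0"
    using im[of "x + y"] im[of x] im[of y] by (simp add: blinfun.add_right cinner_add_left cinner_add_right)
  moreover have "Re (cinner (blinfun_apply A x) y) = Re (cinner (blinfun_apply A y) x)"
    using im[of "x + scaleC \<i> y"] im[of x] im[of y]
    by (simp add: blinfun.add_right cinner_add_left cinner_add_right cboundedD[OF A])
  ultimately show ?thesis
    unfolding cinner_commute[of x "blinfun_apply A y"] by (simp add: complex_eq_iff cinner_commute[of x] )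
qed

text \<open>By induction \<open>A\<close> maps the complement of the earlier vectors into itself.
  Hence the defect \<open>h\<close> of \<open>A\<^sup>2 f = s\<^sup>2 f\<close> at
  \<open>f n\<close> is orthogonal to \<open>f 0, ..., f n\<close>, and
  \<open>maxsys_orthogonal_image\<close> makes it orthogonal to itself. Positivity then excludes the
  eigenvalue \<open>-s\<close> when \<open>s > 0\<close>.\<close>

lemma pos_op_maxsys_eigen:
  assumes A: "A \<in> cbounded" and p: "pos_op A" and m: "maxsys A f"
  shows "blinfun_apply A (f n) = norm (blinfun_apply A (f n)) *\<^sub>R f n"
proof (induction n rule: less_induct)
  case (less n)
  note sa = pos_op_selfadjoint[OF A p]
  have on: "onseq f" by (rule maxsysD(1)[OF m])
  define s where "s = norm (blinfun_apply A (f n))"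
  have inv: "cinner (blinfun_apply A x) (f i) = 0" if "\<And>i. i < n \<Longrightarrow> cinner x (f i) = 0" "i < n" for x i
  proof -
    have "cinner (blinfun_apply A x) (f i) = cinner x (blinfun_apply A (f i))" by (rule sa)
    thus ?thesis using that by (subst (asm) less.IH[OF that(2)]) simp
  qed
  have fi: "cinner (f n) (f i) = 0" if "i < n" for i using on that by (simp add: onseq_def)
  define h where "h = blinfun_apply A (blinfun_apply A (f n)) - (s\<^sup>2) *\<^sub>R f n"
  have hi: "cinner h (f i) = 0" if "i < n" for i
    using that fi inv by (simp add: h_def cinner_diff_left)
  have hn: "cinner h (f n) = 0"
    using on by (simp add: h_def cinner_diff_left sa[of "blinfun_apply A (f n)"] cinner_self s_def)
  have "cinner (blinfun_apply A (f n)) (blinfun_apply A h) = 0"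
    by (rule maxsys_orthogonal_image[OF A m]) (use hi hn le_neq_implies_less in blast)
  hence "cinner (blinfun_apply A (blinfun_apply A (f n))) h = 0" by (simp add: sa)
  hence "cinner h h = 0"
    using hn cinner_eq_0_commute[of h "f n"] by (subst (1) h_def) (simp add: cinner_diff_left)
  hence A2: "blinfun_apply A (blinfun_apply A (f n)) = (s\<^sup>2) *\<^sub>R f n" by (simp add: h_def)
  \<comment> \<open>\<open>A\<^sup>2 f = s\<^sup>2 f\<close> makes \<open>A f - s f\<close> an eigenvector for \<open>-s\<close>.\<close>
  define w where "w = blinfun_apply A (f n) - s *\<^sub>R f n"
  have "blinfun_apply A w = - s *\<^sub>R w"
    by (simp add: w_def blinfun.diff_right blinfun.scaleR_right A2 power2_eq_square scaleR_right_diff_distrib)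
  hence "Re (cinner (blinfun_apply A w) w) = - s * (norm w)\<^sup>2"
    by (simp add: cinner_self cinner_minus_left)
  moreover have "Re (cinner (blinfun_apply A w) w) \<ge> 0" using p by (simp add: pos_op_def)
  ultimately have "s * (norm w)\<^sup>2 \<le> 0" by simp
  hence "s = 0 \<or> w = 0" by (auto simp: s_def mult_le_0_iff)
  hence "blinfun_apply A (f n) = s *\<^sub>R f n"
  proof
    assume "s = 0"
    thus ?thesis by (simp add: s_def)
  qed (simp add: w_def)
  thus ?case by (simp add: s_def)
qed

theorem spectral_decomposition_pos:
  assumes A: "A \<in> L1inf" and p: "pos_op A" and m: "maxsys A f"
  shows "A = sop (\<lambda>n. sing_val n A) f f"
proof -
  note cb = L1infD(1)[OF A]
  have on: "onseq f" by (rule maxsysD(1)[OF m])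
  obtain C where C: "decay (\<lambda>n. sing_val n A) C" using L1inf_decay[OF A] by blast
  show ?thesis
    by (rule sop_eqI[OF on onseq_subon[OF on] decay_bounded[OF C] cb])
       (auto simp: sing_val_maxsys[OF cb m] intro: L1inf_vanish[OF A m] pos_op_maxsys_eigen[OF cb p m])
qed

section \<open>Traces of diagonal operators\<close>

lemma trace_add: "is_trace \<tau> \<Longrightarrow> A \<in> L1inf \<Longrightarrow> B \<in> L1inf \<Longrightarrow> \<tau> (A + B) = \<tau> A + \<tau> B"
  by (simp add: is_trace_def)

lemma trace_cscale: "is_trace \<tau> \<Longrightarrow> A \<in> L1inf \<Longrightarrow> \<tau> (cscale c A) = c * \<tau> A"
  using L1inf_cscale[of A c] by (simp add: is_trace_def)

lemma trace_scaleR: "is_trace \<tau> \<Longrightarrow> A \<in> L1inf \<Longrightarrow> \<tau> (r *\<^sub>R A) = of_real r * \<tau> A"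
  using trace_cscale[of \<tau> A "of_real r"] by (simp add: cscale_of_real)

lemma trace_unitary:
  "is_trace \<tau> \<Longrightarrow> A \<in> L1inf \<Longrightarrow> B \<in> L1inf \<Longrightarrow> unitary U \<Longrightarrow>
   (\<And>x. blinfun_apply B (blinfun_apply U x) = blinfun_apply U (blinfun_apply A x)) \<Longrightarrow> \<tau> B = \<tau> A"
  unfolding is_trace_def by blast

text \<open>A dependent vector yields \<open>u n = 0\<close> instead of being dropped, so that
  \<open>v n\<close> stays in the span of \<open>u 0, ..., u n\<close>. The last clause expresses
  through annihilators that \<open>u n\<close> comes from \<open>v 0, ..., v n\<close>.\<close>

lemma gram_schmidt:
  fixes v :: "nat \<Rightarrow> 'a::chilbert"
  shows "\<exists>u. (\<forall>n. u n = 0 \<or> norm (u n) = 1) \<and> subon u \<and>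
     (\<forall>n. v n = (\<Sum>i\<le>n. scaleC (cinner (v n) (u i)) (u i))) \<and>
     (\<forall>n y. (\<forall>k\<le>n. cinner (v k) y = 0) \<longrightarrow> cinner (u n) y = 0)"
proof -
  define P where "P u n r \<longleftrightarrow> (r = 0 \<or> norm r = 1) \<and> (\<forall>i<n. cinner r (u i) = 0) \<and>
      v n = (\<Sum>i<n. scaleC (cinner (v n) (u i)) (u i)) + scaleC (cinner (v n) r) r \<and>
      (\<forall>y. (\<forall>i<n. cinner (u i) y = 0) \<and> cinner (v n) y = 0 \<longrightarrow> cinner r y = 0)"
    for u :: "nat \<Rightarrow> 'a" and n r
  have "\<exists>u. \<forall>n. P u n (u n)"
  proof (rule dependent_wf_choice[OF wf_less])
    fix f g :: "nat \<Rightarrow> 'a" and n r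
    assume "\<And>z. (z, n) \<in> {(x, y). x < y} \<Longrightarrow> f z = g z"
    hence "\<And>z. z < n \<Longrightarrow> f z = g z" by auto
    thus "P f n r = P g n r" unfolding P_def by auto
  next
    fix n and u :: "nat \<Rightarrow> 'a"
    assume "\<And>y. (y, n) \<in> {(x, y). x < y} \<Longrightarrow> P u y (u y)"
    hence IH: "\<And>i. i < n \<Longrightarrow> P u i (u i)" by auto
    have un: "cinner (u i) (u i) * c = c \<or> u i = 0" if "i < n" for i c
      using IH[OF that] by (auto simp: P_def cinner_self)
    have orth: "cinner (u i) (u j) = 0" if "i < n" "j < n" "i \<noteq> j" for i j
      using IH[OF that(1)] IH[OF that(2)] that(3) cinner_eq_0_commute[of "u i" "u j"]
      unfolding P_def by (cases i j rule: linorder_cases) auto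
    define S where "S = (\<Sum>i<n. scaleC (cinner (v n) (u i)) (u i))"
    define w where "w = v n - S"
    have Su: "cinner S (u j) = cinner (v n) (u j)" if j: "j < n" for j
    proof -
      have "cinner S (u j) = (\<Sum>i<n. cinner (v n) (u i) * cinner (u i) (u j))"
        by (simp add: S_def cinner_sum_left)
      also have "\<dots> = (\<Sum>i\<in>{j}. cinner (v n) (u i) * cinner (u i) (u j))"
        by (rule sum.mono_neutral_right) (use j orth in auto)
      also have "\<dots> = cinner (v n) (u j)"
        using un[OF j, of "cinner (v n) (u j)"] by (auto simp: mult.commute)
      finally show ?thesis .
    qed
    hence wu: "cinner w (u j) = 0" if "j < n" for j
      using that by (simp add: w_def cinner_diff_left)
    have wS: "cinner w S = 0"
      using wu by (subst S_def) (simp add: cinner_sum_right)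
    have vw: "cinner (v n) w = of_real ((norm w)\<^sup>2)"
    proof -
      have "cinner (v n) w = cinner (w + S) w" by (simp add: w_def)
      thus ?thesis using wS cinner_eq_0_commute[of w S] by (simp add: cinner_add_left cinner_self)
    qed
    define r where "r = (1 / norm w) *\<^sub>R w"
    have "P u n r"
      unfolding P_def
    proof (intro conjI allI impI)
      show "r = 0 \<or> norm r = 1" by (auto simp: r_def)
      show "cinner r (u i) = 0" if "i < n" for i using wu[OF that] by (simp add: r_def)
      have "scaleC (cinner (v n) r) r = w"
      proof (cases "w = 0")
        case False
        have "scaleC (cinner (v n) r) r = scaleC (of_real (1 / norm w * (norm w)\<^sup>2 * (1 / norm w))) w"
          by (simp add: r_def vw scaleC_scaleC flip: scaleC_of_real)
        also have "1 / norm w * (norm w)\<^sup>2 * (1 / norm w) = 1" using False by (simp add: power2_eq_square)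
        finally show ?thesis by simp
      qed (simp add: r_def)
      thus "v n = (\<Sum>i<n. scaleC (cinner (v n) (u i)) (u i)) + scaleC (cinner (v n) r) r"
        by (simp add: w_def flip: S_def)
      show "cinner r y = 0" if "(\<forall>i<n. cinner (u i) y = 0) \<and> cinner (v n) y = 0" for y
        using that by (simp add: r_def w_def S_def cinner_diff_left cinner_sum_left)
    qed
    thus "\<exists>r. P u n r" by blast
  qed
  then obtain u where u: "\<And>n. P u n (u n)" by blast
  have "\<forall>n. u n = 0 \<or> norm (u n) = 1" using u by (simp add: P_def)
  moreover have "subon u"
    unfolding subon_def
  proof (intro conjI allI impI)
    fix i j :: nat assume "i \<noteq> j"
    thus "cinner (u i) (u j) = 0"
      using u[of i] u[of j] cinner_eq_0_commute[of "u i" "u j"]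
      unfolding P_def by (cases i j rule: linorder_cases) auto
  next
    fix i show "norm (u i) \<le> 1" using u[of i] unfolding P_def by auto
  qed
  moreover have "\<forall>n. v n = (\<Sum>i\<le>n. scaleC (cinner (v n) (u i)) (u i))"
    using u unfolding P_def lessThan_Suc_atMost[symmetric] sum.lessThan_Suc by blast
  moreover have "cinner (u n) y = 0" if "\<forall>k\<le>n. cinner (v k) y = 0" for n y
    using that
  proof (induction n rule: less_induct)
    case (less n)
    thus ?case using u[of n] unfolding P_def by (meson less_imp_le_nat order_refl order_trans)
  qed
  ultimately show ?thesis by blast
qed

text \<open>The components of \<open>e\<close> orthogonal to \<open>\<phi>\<close> are
  orthonormalised. The sequence \<open>h\<close> ensures that infinitely many nonzero vectors
  remain, so that \<open>\<phi>\<close> can occupy exactly the even positions.\<close>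

lemma extend_to_basis:
  fixes e \<phi> h :: "nat \<Rightarrow> 'a::chilbert"
  assumes e: "orthonormal_basis e" and \<phi>: "onseq \<phi>" and h: "onseq h"
    and \<phi>h: "\<And>i j. cinner (h i) (\<phi> j) = 0"
  shows "\<exists>b. orthonormal_basis b \<and> (\<forall>k. b (2 * k) = \<phi> k)"
proof -
  let ?P = "sop (\<lambda>_. 1) \<phi> \<phi>"
  define v where "v k = e k - blinfun_apply ?P (e k)" for k
  have v\<phi>: "cinner (v k) (\<phi> j) = 0" for k j
    unfolding v_def by (rule sop_projection_perp[OF \<phi>])
  obtain u where u: "\<And>n. u n = 0 \<or> norm (u n) = 1" "subon u"
      "\<And>n. v n = (\<Sum>i\<le>n. scaleC (cinner (v n) (u i)) (u i))"
      "\<And>n y. (\<forall>k\<le>n. cinner (v k) y = 0) \<Longrightarrow> cinner (u n) y = 0"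
    using gram_schmidt[of v] by blast
  have u\<phi>: "cinner (u n) (\<phi> j) = 0" for n j by (rule u(4)) (simp add: v\<phi>)
  have compl: "y = 0" if y\<phi>: "\<And>k. cinner y (\<phi> k) = 0" and yu: "\<And>k. cinner y (u k) = 0" for y
  proof (rule orthonormal_basisD(2)[OF e])
    fix n
    have "cinner (v n) y = (\<Sum>i\<le>n. cinner (v n) (u i) * cinner (u i) y)"
      by (subst u(3)) (simp add: cinner_sum_left)
    hence "cinner (v n) y = 0" using yu cinner_eq_0_commute by (metis (mono_tags, lifting) mult_zero_right sum.neutral)
    moreover have "(\<lambda>k. complex_of_real 1 * cinner (e n) (\<phi> k) * cinner (\<phi> k) y) sums cinner (blinfun_apply ?P (e n)) y"
      by (rule sop_sums_cinner[OF onseq_subon[OF \<phi>] onseq_subon[OF \<phi>], of _ 1]) simp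
    hence "cinner (blinfun_apply ?P (e n)) y = 0"
      using y\<phi> cinner_eq_0_commute[of y] by (simp add: sums_iff)
    ultimately have "cinner (e n) y = 0" by (simp add: v_def cinner_diff_left)
    thus "cinner y (e n) = 0" by (simp add: cinner_eq_0_commute)
  qed
  define Z where "Z = {k. u k \<noteq> 0}"
  have Z: "infinite Z"
  proof
    assume "finite Z"
    then obtain N where N: "\<And>k. k \<in> Z \<Longrightarrow> k < N" by (auto simp: finite_nat_set_iff_bounded)
    \<comment> \<open>If all nonzero \<open>u k\<close> had index below \<open>N\<close>, the
      \<open>N + 1\<close> vectors \<open>h k\<close> would span a nonzero vector orthogonal to
      every \<open>u k\<close> and every \<open>\<phi> k\<close>.\<close>
    obtain c where c: "\<exists>k\<le>N. c k \<noteq> 0" "\<And>i. i < N \<Longrightarrow> cinner (\<Sum>k\<le>N. scaleC (c k) (h k)) (u i) = 0"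
      using ex_perp_in_span[OF h, of N u] by blast
    have "(\<Sum>k\<le>N. scaleC (c k) (h k)) = 0"
    proof (rule compl)
      fix k
      show "cinner (\<Sum>k\<le>N. scaleC (c k) (h k)) (\<phi> k) = 0" by (simp add: cinner_sum_left \<phi>h)
      show "cinner (\<Sum>k\<le>N. scaleC (c k) (h k)) (u k) = 0"
        using c(2)[of k] N[of k] by (cases "u k = 0") (auto simp: Z_def)
    qed
    with span_onseq_nonzero[OF h c(1)] show False by blast
  qed
  define q where "q n = u (enumerate Z n)" for n
  have qinj: "inj (enumerate Z)" using strict_mono_enumerate[OF Z] by (rule strict_mono_imp_inj_on)
  have qn: "norm (q n) = 1" for n using u(1)[of "enumerate Z n"] enumerate_in_set[OF Z, of n] by (auto simp: q_def Z_def)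
  have q: "onseq q"
    unfolding onseq_def using qn u(2) inj_eq[OF qinj] by (auto simp: q_def subon_def cinner_self)
  define b where "b n = (if even n then \<phi> (n div 2) else q (n div 2))" for n
  have q\<phi>: "cinner (q n) (\<phi> j) = 0" "cinner (\<phi> j) (q n) = 0" for n j
    using u\<phi> cinner_eq_0_commute by (auto simp: q_def)
  have div2: "i div 2 = j div 2 \<longleftrightarrow> i = j" if "even i = even j" for i j :: nat
    using that by presburger
  have "orthonormal_basis b"
    unfolding orthonormal_basis_def
  proof (intro conjI allI impI)
    fix i j
    show "cinner (b i) (b j) = (if i = j then 1 else 0)"
      using \<phi> q q\<phi> div2[of i j] by (auto simp: b_def onseq_def)
  next
    fix y assume y: "\<forall>n. cinner y (b n) = 0"
    show "y = 0"
    proof (rule compl)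
      fix k
      show "cinner y (\<phi> k) = 0" using spec[OF y, of "2 * k"] by (simp add: b_def)
      show "cinner y (u k) = 0"
      proof (cases "k \<in> Z")
        case True
        then obtain n where "enumerate Z n = k" using enumerate_Ex[OF Z True] by blast
        thus ?thesis using spec[OF y, of "2 * n + 1"] by (simp add: b_def q_def)
      qed (simp add: Z_def)
    qed
  qed
  thus ?thesis by (intro exI[of _ b]) (simp add: b_def)
qed

text \<open>The map sends \<open>b k\<close> to \<open>e k\<close>. It is onto because exchanging
  the bases gives a right inverse, and isometric because partial sums with equal coefficients have
  equal norms.\<close>

lemma unitary_between_bases:
  fixes b e :: "nat \<Rightarrow> 'a::chilbert"
  assumes b: "orthonormal_basis b" and e: "orthonormal_basis e"
  shows "unitary (sop (\<lambda>_. 1) b e)"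
proof -
  note ob = orthonormal_basisD(1)[OF b] and oe = orthonormal_basisD(1)[OF e]
  note sb = onseq_subon[OF ob] and se = onseq_subon[OF oe]
  have 1: "\<forall>k::nat. \<bar>1::real\<bar> \<le> 1" by simp
  let ?U = "sop (\<lambda>_. 1) b e" and ?V = "sop (\<lambda>_. 1) e b" and ?I = "sop (\<lambda>_. 1) b b"
  have "id_blinfun = sop (\<lambda>_. 1) b b"
  proof (rule sop_eqI[OF ob sb 1])
    show "blinfun_apply id_blinfun y = 0" if "\<And>k. cinner y (b k) = 0" for y
      using orthonormal_basisD(2)[OF b that] by simp
  qed (auto simp: cbounded_def)
  hence I: "?I = id_blinfun" by simp
  have "?U o\<^sub>L ?V = id_blinfun"
    by (rule cbounded_eqI_basis[OF e])
       (auto simp: cbounded_def cboundedD[OF sop_cbounded[OF sb se 1]] cboundedD[OF sop_cbounded[OF se sb 1]]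
          sop_basis[OF oe sb 1] sop_basis[OF ob se 1])
  hence "blinfun_apply ?U (blinfun_apply ?V x) = x" for x
    by (metis blinfun_apply_blinfun_compose id_blinfun.rep_eq)
  hence "surj (blinfun_apply ?U)" by (metis surjI)
  moreover have "norm (blinfun_apply ?U x) = norm x" for x
  proof -
    let ?p = "\<lambda>g n. \<Sum>k<n. scaleC (complex_of_real 1 * cinner x (b k)) (g k)"
    have U: "(\<lambda>n. norm (?p e n)) \<longlonglongrightarrow> norm (blinfun_apply ?U x)"
      using sop_sums[OF sb se 1, of x] unfolding sums_def by (rule tendsto_norm)
    have B: "(\<lambda>n. norm (?p b n)) \<longlonglongrightarrow> norm (blinfun_apply ?I x)"
      using sop_sums[OF sb sb 1, of x] unfolding sums_def by (rule tendsto_norm)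
    have "(norm (?p e n))\<^sup>2 = (norm (?p b n))\<^sup>2" for n
      unfolding norm_sum_onseq[OF ob finite_lessThan] norm_sum_onseq[OF oe finite_lessThan] by (rule refl)
    hence "norm (?p e n) = norm (?p b n)" for n by (rule power2_eq_imp_eq) auto
    with U have "norm (blinfun_apply ?U x) = norm (blinfun_apply ?I x)"
      by (intro LIMSEQ_unique[OF _ B]) simp
    thus ?thesis by (simp add: I)
  qed
  ultimately show ?thesis
    unfolding unitary_def using sop_cbounded[OF sb se 1] by blast
qed

text \<open>The unitary sending \<open>b k\<close> to \<open>e k\<close> intertwines the two
  diagonal operators.\<close>

lemma trace_sop_bases:
  fixes b e :: "nat \<Rightarrow> 'a::chilbert"
  assumes t: "is_trace \<tau>" and b: "orthonormal_basis b" and e: "orthonormal_basis e" and d: "decay s C"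
  shows "\<tau> (sop s b b) = \<tau> (sop s e e)"
proof -
  note ob = orthonormal_basisD(1)[OF b] and oe = orthonormal_basisD(1)[OF e]
  note sb = onseq_subon[OF ob] and se = onseq_subon[OF oe]
  note bd = decay_bounded[OF d]
  have 1: "\<forall>k::nat. \<bar>1::real\<bar> \<le> 1" by simp
  let ?U = "sop (\<lambda>_. 1) b e"
  have "sop s e e o\<^sub>L ?U = ?U o\<^sub>L sop s b b"
    by (rule cbounded_eqI_basis[OF b])
       (auto simp: cbounded_def cboundedD[OF sop_cbounded[OF sb se 1]] cboundedD[OF sop_cbounded[OF sb sb bd]]
          cboundedD[OF sop_cbounded[OF se se bd]] sop_basis[OF ob se 1] sop_basis[OF ob sb bd] sop_basis[OF oe se bd]
          blinfun.scaleR_right)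
  hence "blinfun_apply (sop s e e) (blinfun_apply ?U x) = blinfun_apply ?U (blinfun_apply (sop s b b) x)" for x
    by (metis blinfun_apply_blinfun_compose)
  thus ?thesis
    by (intro trace_unitary[OF t _ _ unitary_between_bases[OF b e], symmetric] sop_L1inf[OF _ _ d] sb se)
qed

lemma sop_even_basis:
  assumes b: "orthonormal_basis b" and \<phi>: "\<And>k. b (2 * k) = \<phi> k" and d: "\<forall>k. \<bar>s k\<bar> \<le> C"
  shows "sop s \<phi> \<phi> = sop (\<lambda>n. if even n then s (n div 2) else 0) b b"
proof -
  note ob = orthonormal_basisD(1)[OF b]
  have "onseq (\<lambda>k. b (2 * k))" by (rule onseq_comp[OF ob]) (simp add: inj_def)
  hence o\<phi>: "onseq \<phi>" by (simp add: \<phi>)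
  have d': "\<forall>n. \<bar>if even n then s (n div 2) else 0\<bar> \<le> C"
    using d order_trans[OF abs_ge_zero d[rule_format, of 0]] by simp
  show ?thesis
  proof (rule cbounded_eqI_basis[OF b sop_cbounded[OF _ _ d] sop_cbounded[OF _ _ d']])
    fix n
    show "blinfun_apply (sop s \<phi> \<phi>) (b n) = blinfun_apply (sop (\<lambda>n. if even n then s (n div 2) else 0) b b) (b n)"
    proof (cases "even n")
      case True
      hence bn: "b n = \<phi> (n div 2)" using \<phi>[of "n div 2"] by simp
      have "blinfun_apply (sop s \<phi> \<phi>) (b n) = s (n div 2) *\<^sub>R b n"
        unfolding bn by (rule sop_basis[OF o\<phi> onseq_subon[OF o\<phi>] d])
      thus ?thesis unfolding sop_basis[OF ob onseq_subon[OF ob] d'] using True by simp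
    next
      case False
      have "cinner (b n) (\<phi> k) = 0" for k
        using ob False unfolding \<phi>[symmetric] onseq_def by (metis dvd_triv_left)
      thus ?thesis using False sop_basis[OF ob onseq_subon[OF ob] d'] sop_perp[OF onseq_subon[OF o\<phi>] onseq_subon[OF o\<phi>] d] by simp
    qed
  qed (use ob o\<phi> onseq_subon in auto)
qed

lemma decay_even:
  assumes "decay s C"
  shows "decay (\<lambda>n. if even n then s (n div 2) else 0) (2 * C)"
  unfolding decay_def
proof
  fix n
  have C: "0 \<le> C" by (rule decay_nonneg[OF assms])
  have "\<bar>s (n div 2)\<bar> \<le> C / real (n div 2 + 1)" using assms by (simp add: decay_def)
  also have "\<dots> = 2 * C / (2 * real (n div 2 + 1))" by (subst mult_divide_mult_cancel_left) auto
  also have "\<dots> \<le> 2 * C / real (n + 1)"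
    using C by (intro divide_left_mono) auto
  finally show "\<bar>if even n then s (n div 2) else 0\<bar> \<le> 2 * C / real (n + 1)" using C by simp
qed

text \<open>The sequence \<open>h\<close> witnesses infinite codimension. Both \<open>\<phi>\<close>
  and the even part of \<open>e\<close> are then the even members of a basis, and diagonals padded
  with zeros at the odd positions are compared.\<close>

lemma trace_sop_coinfinite:
  fixes e \<phi> h :: "nat \<Rightarrow> 'a::chilbert"
  assumes t: "is_trace \<tau>" and e: "orthonormal_basis e" and \<phi>: "onseq \<phi>" and h: "onseq h"
    and \<phi>h: "\<And>i j. cinner (h i) (\<phi> j) = 0" and d: "decay s C"
  shows "\<tau> (sop s \<phi> \<phi>) = \<tau> (sop s (\<lambda>k. e (2 * k)) (\<lambda>k. e (2 * k)))"
proof -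
  obtain b where b: "orthonormal_basis b" "\<And>k. b (2 * k) = \<phi> k"
    using extend_to_basis[OF e \<phi> h \<phi>h] by blast
  show ?thesis
    unfolding sop_even_basis[OF b decay_bounded[OF d]] sop_even_basis[OF e refl decay_bounded[OF d]]
    by (rule trace_sop_bases[OF t b(1) e decay_even[OF d]])
qed

lemma decay_comp_expanding:
  assumes "decay s C" "\<And>k. k \<le> p k"
  shows "decay (\<lambda>k. s (p k)) C"
  using decay_tail[OF assms(1)] assms(2) by (simp add: decay_def)

lemma sop_split_even_odd:
  assumes f: "onseq f" and d: "\<forall>k. \<bar>s k\<bar> \<le> C"
  shows "sop s f f = sop (\<lambda>k. s (2 * k)) (\<lambda>k. f (2 * k)) (\<lambda>k. f (2 * k))
     + sop (\<lambda>k. s (2 * k + 1)) (\<lambda>k. f (2 * k + 1)) (\<lambda>k. f (2 * k + 1))" (is "_ = ?E + ?O")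
proof (rule sop_eqI[OF f onseq_subon[OF f] d, symmetric])
  have fe: "onseq (\<lambda>k. f (2 * k))" by (rule onseq_comp[OF f]) (simp add: inj_def)
  have fo: "onseq (\<lambda>k. f (2 * k + 1))" by (rule onseq_comp[OF f]) (simp add: inj_def)
  have de: "\<forall>k. \<bar>s (2 * k)\<bar> \<le> C" and do: "\<forall>k. \<bar>s (2 * k + 1)\<bar> \<le> C" using d by auto
  note se = onseq_subon[OF fe] and so = onseq_subon[OF fo]
  show "?E + ?O \<in> cbounded" by (intro cbounded_add sop_cbounded[OF se se de] sop_cbounded[OF so so do])
  show "blinfun_apply (?E + ?O) y = 0" if "\<And>k. cinner y (f k) = 0" for y
    using sop_perp[OF se se de, of y] sop_perp[OF so so do, of y] that by (simp add: blinfun.add_left)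
  fix k
  have ff: "cinner (f i) (f j) = 0" if "i \<noteq> j" for i j using f that by (simp add: onseq_def)
  show "blinfun_apply (?E + ?O) (f k) = s k *\<^sub>R f k"
  proof (cases "even k")
    case True
    then obtain j where k: "k = 2 * j" by (elim evenE)
    have "2 * j \<noteq> 2 * i + 1" for i by presburger
    hence "blinfun_apply ?O (f k) = 0" by (intro sop_perp[OF so so do] ff) (simp add: k)
    thus ?thesis using sop_basis[OF fe se de, of j] by (simp add: k blinfun.add_left)
  next
    case False
    then obtain j where k: "k = 2 * j + 1" by (elim oddE)
    have "2 * j + 1 \<noteq> 2 * i" for i by presburger
    hence "blinfun_apply ?E (f k) = 0" by (intro sop_perp[OF se se de] ff) (simp add: k)
    thus ?thesis using sop_basis[OF fo so do, of j] by (simp add: k blinfun.add_left)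
  qed
qed

text \<open>Splitting into even and odd indices leaves each half with an infinite-dimensional orthogonal
  complement, so that it can be moved by a unitary even if \<open>f\<close> is not a basis.\<close>

theorem trace_sop_onseq:
  fixes e f :: "nat \<Rightarrow> 'a::chilbert"
  assumes t: "is_trace \<tau>" and e: "orthonormal_basis e" and f: "onseq f" and d: "decay s C"
  shows "\<tau> (sop s f f) = \<tau> (sop s e e)"
proof -
  have de: "decay (\<lambda>k. s (2 * k)) C" and do: "decay (\<lambda>k. s (2 * k + 1)) C"
    by (rule decay_comp_expanding[OF d], simp)+
  let ?e = "\<lambda>k. e (2 * k)"
  have "\<tau> (sop s f f) = \<tau> (sop (\<lambda>k. s (2 * k)) ?e ?e) + \<tau> (sop (\<lambda>k. s (2 * k + 1)) ?e ?e)"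
    if f: "onseq f" for f
  proof -
    have fe: "onseq (\<lambda>k. f (2 * k))" by (rule onseq_comp[OF f]) (simp add: inj_def)
    have fo: "onseq (\<lambda>k. f (2 * k + 1))" by (rule onseq_comp[OF f]) (simp add: inj_def)
    have ne: "2 * i + 1 \<noteq> 2 * j" for i j :: nat by presburger
    have oe: "cinner (f (2 * i + 1)) (f (2 * j)) = 0" for i j
      using f ne[of i j] unfolding onseq_def by presburger
    hence eo: "cinner (f (2 * i)) (f (2 * j + 1)) = 0" for i j using cinner_eq_0_commute by blast
    have "\<tau> (sop s f f) = \<tau> (sop (\<lambda>k. s (2 * k)) (\<lambda>k. f (2 * k)) (\<lambda>k. f (2 * k)))
       + \<tau> (sop (\<lambda>k. s (2 * k + 1)) (\<lambda>k. f (2 * k + 1)) (\<lambda>k. f (2 * k + 1)))"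
      unfolding sop_split_even_odd[OF f decay_bounded[OF d]]
      by (intro trace_add[OF t] sop_L1inf[OF _ _ de] sop_L1inf[OF _ _ do] onseq_subon fe fo)
    also have "\<tau> (sop (\<lambda>k. s (2 * k)) (\<lambda>k. f (2 * k)) (\<lambda>k. f (2 * k))) = \<tau> (sop (\<lambda>k. s (2 * k)) ?e ?e)"
      by (rule trace_sop_coinfinite[OF t e fe fo oe de])
    also have "\<tau> (sop (\<lambda>k. s (2 * k + 1)) (\<lambda>k. f (2 * k + 1)) (\<lambda>k. f (2 * k + 1))) = \<tau> (sop (\<lambda>k. s (2 * k + 1)) ?e ?e)"
      by (rule trace_sop_coinfinite[OF t e fo fe eo do])
    finally show ?thesis .
  qed
  from this[OF f] this[OF orthonormal_basisD(1)[OF e]] show ?thesis by simp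
qed

section \<open>Rearranging diagonals\<close>

lemma sop_push:
  assumes e: "orthonormal_basis e" and p: "inj p" and y: "\<forall>k. \<bar>y k\<bar> \<le> C"
    and z: "\<And>k. z (p k) = y k" "\<And>j. j \<notin> range p \<Longrightarrow> z j = 0"
  shows "sop z e e = sop y (\<lambda>k. e (p k)) (\<lambda>k. e (p k))"
proof -
  note oe = orthonormal_basisD(1)[OF e]
  note op = onseq_comp[OF oe p]
  have zb: "\<forall>k. \<bar>z k\<bar> \<le> C"
  proof
    fix k show "\<bar>z k\<bar> \<le> C"
      using y z abs_ge_zero[of "y 0"] order_trans[of 0 "\<bar>y 0\<bar>" C] by (cases "k \<in> range p") auto
  qed
  show ?thesis
  proof (rule cbounded_eqI_basis[OF e sop_cbounded[OF onseq_subon onseq_subon zb, OF oe oe]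
        sop_cbounded[OF onseq_subon onseq_subon y, OF op op]])
    fix k
    show "blinfun_apply (sop z e e) (e k) = blinfun_apply (sop y (\<lambda>k. e (p k)) (\<lambda>k. e (p k))) (e k)"
    proof (cases "k \<in> range p")
      case True
      then obtain j where "k = p j" by auto
      thus ?thesis using sop_basis[OF oe onseq_subon[OF oe] zb, of k] sop_basis[OF op onseq_subon[OF op] y, of j] z by simp
    next
      case False
      hence "cinner (e k) (e (p j)) = 0" for j using oe unfolding onseq_def by auto
      hence "blinfun_apply (sop y (\<lambda>k. e (p k)) (\<lambda>k. e (p k))) (e k) = 0"
        by (rule sop_perp[OF onseq_subon[OF op] onseq_subon[OF op] y])
      thus ?thesis using sop_basis[OF oe onseq_subon[OF oe] zb, of k] z(2)[OF False] by simp
    qed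
  qed
qed

text \<open>Permuting a diagonal or inserting zeros keeps the trace: pushing along \<open>p\<close>
  amounts to replacing \<open>e\<close> by the orthonormal sequence of the
  \<open>e (p k)\<close>.\<close>

lemma trace_diag_push:
  assumes t: "is_trace \<tau>" and e: "orthonormal_basis e" and p: "inj p" and d: "decay y C"
    and z: "\<And>k. z (p k) = y k" "\<And>j. j \<notin> range p \<Longrightarrow> z j = 0"
  shows "\<tau> (diag e z) = \<tau> (diag e y)"
proof -
  have "sop z e e = sop y (\<lambda>k. e (p k)) (\<lambda>k. e (p k))"
    by (rule sop_push[OF e p decay_bounded[OF d]]) (use z in auto)
  thus ?thesis
    unfolding diag_eq_sop
    using trace_sop_onseq[OF t e onseq_comp[OF orthonormal_basisD(1)[OF e] p] d] by simp
qed

lemma diag_L1inf: "orthonormal_basis e \<Longrightarrow> decay s C \<Longrightarrow> diag e s \<in> L1inf"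
  unfolding diag_eq_sop by (intro sop_L1inf onseq_subon orthonormal_basisD)

lemma diag_add:
  assumes "orthonormal_basis e" "decay s C" "decay t D"
  shows "diag e (\<lambda>k. s k + t k) = diag e s + diag e t"
  unfolding diag_eq_sop using assms
  by (intro sop_add[OF _ _ decay_bounded decay_bounded] onseq_subon orthonormal_basisD)

lemma trace_diag_add:
  assumes "is_trace \<tau>" "orthonormal_basis e" "decay s C" "decay t D"
  shows "\<tau> (diag e (\<lambda>k. s k + t k)) = \<tau> (diag e s) + \<tau> (diag e t)"
  unfolding diag_add[OF assms(2-4)] using assms by (intro trace_add diag_L1inf)

lemma trace_diag_scale:
  assumes "is_trace \<tau>" "orthonormal_basis e" "decay s C"
  shows "\<tau> (diag e (\<lambda>k. c * s k)) = of_real c * \<tau> (diag e s)"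
proof -
  have "diag e (\<lambda>k. c * s k) = c *\<^sub>R diag e s"
    unfolding diag_eq_sop using assms
    by (intro sop_scaleR[OF _ _ decay_bounded] onseq_subon orthonormal_basisD)
  thus ?thesis using trace_scaleR[OF assms(1) diag_L1inf[OF assms(2,3)]] by simp
qed

section \<open>Dyadic blocks\<close>

text \<open>The integer part of the binary logarithm of \<open>k + 1\<close>, in the form in which
  it occurs in \<open>Dop\<close>.\<close>

definition blk :: "nat \<Rightarrow> nat" where
  "blk k = (THE n::nat. 2 ^ n - 1 \<le> k \<and> k \<le> 2 ^ (n + 1) - 2)"

text \<open>Adding 1 to \<open>k\<close> removes the truncated subtractions.\<close>

lemma block_iff: "2 ^ n - 1 \<le> k \<and> k \<le> 2 ^ (n + 1) - 2 \<longleftrightarrow> 2 ^ n \<le> k + 1 \<and> k + 1 < (2::nat) ^ (n + 1)"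
proof -
  obtain p where "(2::nat) ^ n = Suc p" by (metis not0_implies_Suc power_not_zero zero_neq_numeral)
  thus ?thesis by auto
qed

lemma blk_eqI:
  assumes "2 ^ n \<le> k + 1" "k + 1 < (2::nat) ^ (n + 1)"
  shows "blk k = n"
  unfolding blk_def block_iff
proof (rule the_equality)
  fix m assume m: "2 ^ m \<le> k + 1 \<and> k + 1 < (2::nat) ^ (m + 1)"
  have "(2::nat) ^ m < 2 ^ (n + 1)" "(2::nat) ^ n < 2 ^ (m + 1)" using assms m by linarith+
  hence "m < n + 1" "n < m + 1"
    using power_strict_increasing_iff[of "2::nat"] by (metis one_less_numeral_iff semiring_norm(76))+
  thus "m = n" by simp
qed (use assms in auto)

lemma blk_bounds: "2 ^ blk k \<le> k + 1" "k + 1 < (2::nat) ^ (blk k + 1)"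
proof -
  obtain n where n: "2 ^ n \<le> k + 1" "k + 1 < (2::nat) ^ (n + 1)"
    using ex_power_ivl1[of 2 "k + 1"] by auto
  thus "2 ^ blk k \<le> k + 1" "k + 1 < (2::nat) ^ (blk k + 1)" using blk_eqI[OF n] by simp_all
qed

lemma mem_block_iff: "k \<in> {2 ^ n - 1 .. 2 ^ (n + 1) - 2} \<longleftrightarrow> blk k = n"
  unfolding atLeastAtMost_iff block_iff using blk_bounds blk_eqI by blast

lemma block_eq: "{2 ^ n - 1 .. 2 ^ (n + 1) - 2} = (\<lambda>i. 2 ^ n - 1 + i) ` {..<(2::nat) ^ n}"
proof -
  obtain p where p: "(2::nat) ^ n = Suc p" by (metis not0_implies_Suc power_not_zero zero_neq_numeral)
  have "\<exists>i<Suc p. x = p + i" if "p \<le> x" "x \<le> 2 * p" for x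
    using that by presburger
  thus ?thesis by (auto simp: p image_iff Bex_def)
qed

lemma card_block: "card {2 ^ n - 1 .. 2 ^ (n + 1) - (2::nat)} = 2 ^ n"
  unfolding block_eq by (subst card_image) (auto simp: inj_on_def)

lemma Dop_eq: "Dop x k = ln 2 * x (blk k) / 2 ^ blk k"
  by (simp add: Dop_def blk_def Let_def)

lemma inverse_pow_blk_le: "1 / 2 ^ blk k \<le> 2 / real (k + 1)"
proof -
  have "real (k + 1) \<le> 2 * 2 ^ blk k"
    using blk_bounds(2)[of k] by (metis less_imp_le of_nat_le_iff of_nat_numeral of_nat_power power_Suc Suc_eq_plus1)
  thus ?thesis by (simp add: field_simps)
qed

text \<open>Within a block, \<open>1 / (k + 1)\<close> and \<open>1 / 2 ^ blk k\<close> differ by a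
  factor of at most 2. Bounds by blocks survive permutations inside a block, which is the form
  needed for rearrangements.\<close>

lemma decay_blk:
  assumes "\<And>k. \<bar>z k\<bar> \<le> C / 2 ^ blk k" "0 \<le> C"
  shows "decay z (2 * C)"
  unfolding decay_def
proof
  fix k
  have "\<bar>z k\<bar> \<le> C * (1 / 2 ^ blk k)" using assms by simp
  also have "\<dots> \<le> C * (2 / real (k + 1))" by (rule mult_left_mono[OF inverse_pow_blk_le assms(2)])
  finally show "\<bar>z k\<bar> \<le> 2 * C / real (k + 1)" by (simp add: mult.commute)
qed

lemma decay_on_block:
  assumes "decay z C"
  shows "\<bar>z k\<bar> \<le> C / 2 ^ blk k"
proof -
  have "\<bar>z k\<bar> \<le> C / real (k + 1)" using assms by (simp add: decay_def)
  also have "\<dots> \<le> C / 2 ^ blk k"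
    using blk_bounds(1)[of k] decay_nonneg[OF assms]
    by (intro divide_left_mono) (auto, metis of_nat_Suc of_nat_le_iff of_nat_numeral of_nat_power Suc_eq_plus1 add.commute)
  finally show ?thesis .
qed

lemma linfD: "x \<in> linf \<Longrightarrow> \<exists>C\<ge>0. \<forall>n. \<bar>x n\<bar> \<le> C"
  unfolding linf_def bdd_above_def by simp (metis abs_ge_zero order_trans rangeI)

lemma linfI: "(\<And>n. \<bar>x n\<bar> \<le> C) \<Longrightarrow> x \<in> linf"
  unfolding linf_def by (auto intro!: bdd_aboveI[of _ C])

lemma decay_Dop:
  assumes "x \<in> linf"
  shows "\<exists>C. decay (Dop x) C"
proof -
  obtain C where C: "0 \<le> C" "\<And>n. \<bar>x n\<bar> \<le> C" using linfD[OF assms] by blast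
  have "\<bar>Dop x k\<bar> \<le> (ln 2 * C) / 2 ^ blk k" for k
    using C by (simp add: Dop_eq abs_mult divide_right_mono)
  from decay_blk[OF this] C(1) show ?thesis by auto
qed

lemma linear_on_linf_trace:
  assumes t: "is_trace \<tau>" and e: "orthonormal_basis e"
  shows "linear_on_linf (\<lambda>x. \<tau> (diag e (Dop x)))"
  unfolding linear_on_linf_def
proof (intro conjI ballI allI)
  fix x y assume "x \<in> linf" "y \<in> linf"
  then obtain C D where "decay (Dop x) C" "decay (Dop y) D" using decay_Dop by blast
  moreover have "Dop (\<lambda>n. x n + y n) = (\<lambda>k. Dop x k + Dop y k)"
    by (simp add: Dop_eq fun_eq_iff distrib_left add_divide_distrib)
  ultimately show "\<tau> (diag e (Dop (\<lambda>n. x n + y n))) = \<tau> (diag e (Dop x)) + \<tau> (diag e (Dop y))"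
    using trace_diag_add[OF t e] by simp
next
  fix c :: real and x assume "x \<in> linf"
  then obtain C where "decay (Dop x) C" using decay_Dop by blast
  moreover have "Dop (\<lambda>n. c * x n) = (\<lambda>k. c * Dop x k)"
    by (simp add: Dop_eq fun_eq_iff)
  ultimately show "\<tau> (diag e (Dop (\<lambda>n. c * x n))) = complex_of_real c * \<tau> (diag e (Dop x))"
    using trace_diag_scale[OF t e] by simp
qed

lemma zero_or_odd_or_even: "j = 0 \<or> (\<exists>k::nat. j = 2 * k + 1) \<or> (\<exists>k. j = 2 * k + 2)"
  by presburger

text \<open>The sequence \<open>D (S x)\<close> lists every entry of \<open>D x\<close>, halved, at the two positions
  \<open>2k + 1\<close> and \<open>2k + 2\<close>.\<close>

lemma shift_invariant_trace:
  assumes t: "is_trace \<tau>" and e: "orthonormal_basis e"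
  shows "shift_invariant (\<lambda>x. \<tau> (diag e (Dop x)))"
  unfolding shift_invariant_def
proof
  fix x assume "x \<in> linf"
  then obtain C where C: "decay (Dop x) C" using decay_Dop by blast
  define y where "y k = (1/2) * Dop x k" for k
  have y: "decay y (\<bar>1/2\<bar> * C)" unfolding y_def by (rule decay_scale[OF C])
  have C0: "0 \<le> C" by (rule decay_nonneg[OF C])
  \<comment> \<open>\<open>trace_diag_push\<close> moves a single copy of \<open>y\<close>, so the
    odd and the even positions are treated as separate sequences.\<close>
  define a where "a j = (if odd j then y (j div 2) else 0)" for j :: nat
  define b where "b j = (if even j \<and> j \<noteq> 0 then y (j div 2 - 1) else 0)" for j :: nat
  have blk1: "blk (2 * k + 1) = Suc (blk k)" for k
    using blk_bounds[of k] by (intro blk_eqI) auto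
  have blk2: "blk (2 * k + 2) = Suc (blk k)" for k
    using blk_bounds[of k] by (intro blk_eqI) auto
  have blk0: "blk 0 = 0" by (intro blk_eqI) auto
  have D: "Dop (shiftS x) = (\<lambda>j. a j + b j)"
  proof
    fix j :: nat
    consider "j = 0" | k where "j = 2 * k + 1" | k where "j = 2 * k + 2"
      using zero_or_odd_or_even[of j] by blast
    thus "Dop (shiftS x) j = a j + b j"
    proof cases
      case 1
      thus ?thesis by (simp add: Dop_eq a_def b_def blk0 shiftS_def)
    next
      case (2 k)
      have "Dop (shiftS x) (2 * k + 1) = y k" unfolding Dop_eq blk1 by (simp add: y_def Dop_eq shiftS_def)
      thus ?thesis using 2 by (simp add: a_def b_def)
    next
      case (3 k)
      have "Dop (shiftS x) (2 * k + 2) = y k" unfolding Dop_eq blk2 by (simp add: y_def Dop_eq shiftS_def)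
      thus ?thesis using 3 by (simp add: a_def b_def)
    qed
  qed
  have a: "\<tau> (diag e a) = \<tau> (diag e y)"
  proof (rule trace_diag_push[OF t e _ y])
    show "inj (\<lambda>k::nat. 2 * k + 1)" by (simp add: inj_def)
    show "a (2 * k + 1) = y k" for k by (simp add: a_def)
    show "a j = 0" if "j \<notin> range (\<lambda>k::nat. 2 * k + 1)" for j
      using that by (auto simp: a_def elim: oddE)
  qed
  have b: "\<tau> (diag e b) = \<tau> (diag e y)"
  proof (rule trace_diag_push[OF t e _ y])
    show "inj (\<lambda>k::nat. 2 * k + 2)" by (simp add: inj_def)
    show "b (2 * k + 2) = y k" for k by (simp add: b_def)
    show "b j = 0" if "j \<notin> range (\<lambda>k::nat. 2 * k + 2)" for j
    proof (rule ccontr)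
      assume "b j \<noteq> 0"
      hence "even j" "j \<noteq> 0" by (auto simp: b_def split: if_splits)
      hence "j = 2 * (j div 2 - 1) + 2" by presburger
      with that show False by blast
    qed
  qed
  \<comment> \<open>Positions \<open>2k + 1\<close> and \<open>2k + 2\<close> lie one block further,
    which doubles the power of 2 and absorbs the factor 1/2.\<close>
  have yk: "\<bar>y k\<bar> \<le> (C/2) / 2 ^ blk k" for k using decay_on_block[OF y, of k] by simp
  have "\<bar>a j\<bar> \<le> C / 2 ^ blk j \<and> \<bar>b j\<bar> \<le> C / 2 ^ blk j" for j :: nat
  proof -
    consider "j = 0" | k where "j = 2 * k + 1" | k where "j = 2 * k + 2"
      using zero_or_odd_or_even[of j] by blast
    thus ?thesis
    proof cases
      case 1 thus ?thesis using C0 by (simp add: a_def b_def)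
    next
      case (2 k) thus ?thesis using yk[of k] C0 unfolding 2 blk1 by (simp add: a_def b_def)
    next
      case (3 k) thus ?thesis using yk[of k] C0 unfolding 3 blk2 by (simp add: a_def b_def)
    qed
  qed
  hence da: "decay a (2 * C)" and db: "decay b (2 * C)" using C0 by (auto intro!: decay_blk)
  have "\<tau> (diag e (Dop (shiftS x))) = \<tau> (diag e y) + \<tau> (diag e y)"
    unfolding D trace_diag_add[OF t e da db] a b ..
  also have "\<dots> = \<tau> (diag e (Dop x))"
    unfolding y_def trace_diag_scale[OF t e C] by simp
  finally show "\<tau> (diag e (Dop (shiftS x))) = \<tau> (diag e (Dop x))" .
qed

section \<open>Sequences with vanishing block sums\<close>

text \<open>Greedy choice: while the running sum \<open>s\<close> is positive take a negative term,
  otherwise a nonnegative one. Such a term exists because the remaining ones add up to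
  \<open>-s\<close>, and adding it does not leave the interval from \<open>-c\<close> to
  \<open>c\<close>.\<close>

lemma rearrange_bounded_partial_sums:
  fixes z :: "'i \<Rightarrow> real"
  assumes "finite A" "\<And>a. a \<in> A \<Longrightarrow> \<bar>z a\<bar> \<le> c" "\<bar>s\<bar> \<le> c" "s + sum z A = 0"
  shows "\<exists>xs. set xs = A \<and> distinct xs \<and> (\<forall>k. \<bar>s + sum_list (map z (take k xs))\<bar> \<le> c)"
  using assms
proof (induction "card A" arbitrary: A s)
  case 0
  thus ?case by (intro exI[of _ "[]"]) simp
next
  case (Suc n)
  have "\<exists>a\<in>A. \<bar>s + z a\<bar> \<le> c"
  proof (cases "s > 0")
    case True
    have "\<exists>a\<in>A. z a < 0"
    proof (rule ccontr)
      assume "\<not> (\<exists>a\<in>A. z a < 0)"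
      hence "sum z A \<ge> 0" by (intro sum_nonneg) auto
      thus False using True Suc.prems(4) by linarith
    qed
    then obtain a where "a \<in> A" "z a < 0" by blast
    thus ?thesis using Suc.prems(2)[of a] Suc.prems(3) True by (intro bexI[of _ a]) auto
  next
    case False
    have "\<exists>a\<in>A. z a \<ge> 0"
    proof (rule ccontr)
      assume n: "\<not> (\<exists>a\<in>A. z a \<ge> 0)"
      have "A \<noteq> {}" using Suc.hyps(2) by auto
      hence "sum z A < (\<Sum>a\<in>A. 0)" using n Suc.prems(1) by (intro sum_strict_mono) auto
      thus False using False Suc.prems(4) by simp
    qed
    then obtain a where "a \<in> A" "z a \<ge> 0" by blast
    thus ?thesis using Suc.prems(2)[of a] Suc.prems(3) False by (intro bexI[of _ a]) auto
  qed
  then obtain a where a: "a \<in> A" "\<bar>s + z a\<bar> \<le> c" by blast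
  have "n = card (A - {a})" using Suc.hyps(2) a(1) Suc.prems(1) by simp
  moreover have "(s + z a) + sum z (A - {a}) = 0"
    using Suc.prems(1,4) a(1) by (simp add: sum.remove)
  ultimately obtain xs where xs: "set xs = A - {a}" "distinct xs"
      "\<And>k. \<bar>(s + z a) + sum_list (map z (take k xs))\<bar> \<le> c"
    using Suc.hyps(1)[of "A - {a}" "s + z a"] Suc.prems(1,2) a(2) by auto
  have "\<bar>s + sum_list (map z (take k (a # xs)))\<bar> \<le> c" for k
    using xs(3)[of "k - 1"] Suc.prems(3) by (cases k) (auto simp: add.assoc)
  moreover have "set (a # xs) = A" "distinct (a # xs)" using xs a(1) by auto
  ultimately show ?case by blast
qed

text \<open>Each block is ordered separately. The earlier blocks contribute 0, so a partial sum is
  controlled by the size of the entries in the current block alone.\<close>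

lemma rearrange_blocks:
  fixes z :: "nat \<Rightarrow> real"
  assumes d: "decay z C" and sums: "\<And>n. (\<Sum>k = 2 ^ n - 1 .. 2 ^ (n + 1) - 2. z k) = 0"
  shows "\<exists>\<sigma>. bij \<sigma> \<and> (\<forall>k. blk (\<sigma> k) = blk k) \<and> (\<forall>k. \<bar>\<Sum>i\<le>k. z (\<sigma> i)\<bar> \<le> C / 2 ^ blk k)"
proof -
  have C0: "0 \<le> C" by (rule decay_nonneg[OF d])
  have "\<exists>xs. set xs = {2 ^ n - 1 .. 2 ^ (n + 1) - 2} \<and> distinct xs \<and>
      (\<forall>k. \<bar>0 + sum_list (map z (take k xs))\<bar> \<le> C / 2 ^ n)" for n
  proof (rule rearrange_bounded_partial_sums)
    show "\<bar>z a\<bar> \<le> C / 2 ^ n" if "a \<in> {2 ^ n - 1 .. 2 ^ (n + 1) - 2}" for a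
      using decay_on_block[OF d, of a] that by (simp only: mem_block_iff)
  qed (use C0 sums in auto)
  then obtain xs where xs: "\<And>n. set (xs n) = {2 ^ n - 1 .. 2 ^ (n + 1) - 2}" "\<And>n. distinct (xs n)"
      "\<And>n k. \<bar>sum_list (map z (take k (xs n)))\<bar> \<le> C / 2 ^ n"
    by (simp only: add_0) metis
  have len: "length (xs n) = 2 ^ n" for n
    using distinct_card[OF xs(2)[of n]] card_block[of n] xs(1)[of n] by simp
  \<comment> \<open>Block \<open>n\<close> starts at \<open>2 ^ n - 1\<close>, so the subtraction
    yields the position of \<open>k\<close> in its block.\<close>
  define \<sigma> where "\<sigma> k = xs (blk k) ! (k + 1 - 2 ^ blk k)" for k
  have idx: "k + 1 - 2 ^ blk k < 2 ^ blk k" for k using blk_bounds[of k] by auto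
  have blk\<sigma>: "blk (\<sigma> k) = blk k" for k
    using nth_mem[of "k + 1 - 2 ^ blk k" "xs (blk k)"] idx[of k]
    unfolding mem_block_iff[symmetric] \<sigma>_def len xs(1) by blast
  have \<sigma>n: "\<sigma> (2 ^ n - 1 + i) = xs n ! i" if "i < 2 ^ n" for n i
  proof -
    have p: "(2::nat) ^ n \<ge> 1" by simp
    hence "blk (2 ^ n - 1 + i) = n" using that by (intro blk_eqI) auto
    thus ?thesis using p by (simp add: \<sigma>_def)
  qed
  have "inj \<sigma>"
  proof (rule injI)
    fix j k assume eq: "\<sigma> j = \<sigma> k"
    hence b: "blk j = blk k" using blk\<sigma> by metis
    from eq have "xs (blk k) ! (j + 1 - 2 ^ blk k) = xs (blk k) ! (k + 1 - 2 ^ blk k)" by (simp add: \<sigma>_def b)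
    hence "j + 1 - 2 ^ blk k = k + 1 - 2 ^ blk k"
      using idx[of j] idx[of k] b by (simp add: nth_eq_iff_index_eq[OF xs(2)] len)
    thus "j = k" using blk_bounds(1)[of j] blk_bounds(1)[of k] b by simp
  qed
  moreover have "surj \<sigma>"
    unfolding surj_def
  proof
    fix j
    have "j \<in> set (xs (blk j))" unfolding xs(1) mem_block_iff ..
    then obtain i where "i < 2 ^ blk j" "xs (blk j) ! i = j" unfolding in_set_conv_nth len by blast
    thus "\<exists>x. j = \<sigma> x" using \<sigma>n by metis
  qed
  moreover have part: "(\<Sum>i<m. z (\<sigma> (2 ^ n - 1 + i))) = sum_list (map z (take m (xs n)))" if "m \<le> 2 ^ n" for m n
  proof -
    have "sum_list (map z (take m (xs n))) = (\<Sum>i<m. z (xs n ! i))"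
      using that len[of n] by (simp add: sum_list_sum_nth atLeast0LessThan)
    moreover have "(\<Sum>i<m. z (\<sigma> (2 ^ n - 1 + i))) = (\<Sum>i<m. z (xs n ! i))"
    proof (rule sum.cong[OF refl])
      fix i assume "i \<in> {..<m}"
      hence "i < 2 ^ n" using that by simp
      thus "z (\<sigma> (2 ^ n - 1 + i)) = z (xs n ! i)" by (simp only: \<sigma>n)
    qed
    ultimately show ?thesis by simp
  qed
  have full: "(\<Sum>i<2 ^ n - 1. z (\<sigma> i)) = 0" for n
  proof (induction n)
    case (Suc n)
    have "(2::nat) ^ Suc n - 1 = (2 ^ n - 1) + 2 ^ n" using one_le_power[of "2::nat" n] by simp
    moreover have "(\<Sum>i<2 ^ n. z (\<sigma> (2 ^ n - 1 + i))) = sum_list (map z (xs n))"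
      using part[of "2 ^ n" n] len[of n] by simp
    moreover have "sum_list (map z (xs n)) = 0"
      using sum_list_distinct_conv_sum_set[OF xs(2)] xs(1) sums by metis
    ultimately show ?case using Suc by (simp only: sum_lessThan_add)
  qed simp
  have "\<bar>\<Sum>i\<le>k. z (\<sigma> i)\<bar> \<le> C / 2 ^ blk k" for k
  proof -
    define n where "n = blk k"
    \<comment> \<open>The number of entries of the block up to and including \<open>k\<close>, one
      more than the position of \<open>k\<close>.\<close>
    define m where "m = k + 2 - 2 ^ n"
    have m: "m \<le> 2 ^ n" "Suc k = (2 ^ n - 1) + m"
      using blk_bounds[of k] one_le_power[of "2::nat" n] unfolding n_def m_def by auto
    have "(\<Sum>i\<le>k. z (\<sigma> i)) = sum_list (map z (take m (xs n)))"
      unfolding lessThan_Suc_atMost[symmetric] m(2) sum_lessThan_add full part[OF m(1)] by simp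
    thus ?thesis using xs(3)[of m n] by (simp add: n_def)
  qed
  ultimately show ?thesis using blk\<sigma> unfolding bij_def by blast
qed

text \<open>After the rearrangement, \<open>z\<close> is the difference of its sequence of partial sums and the
  shift of that sequence.\<close>

lemma trace_diag_zero_blocks:
  assumes t: "is_trace \<tau>" and e: "orthonormal_basis e" and d: "decay z C"
    and sums: "\<And>n. (\<Sum>k = 2 ^ n - 1 .. 2 ^ (n + 1) - 2. z k) = 0"
  shows "\<tau> (diag e z) = 0"
proof -
  have C0: "0 \<le> C" by (rule decay_nonneg[OF d])
  obtain \<sigma> where \<sigma>: "bij \<sigma>" "\<And>k. blk (\<sigma> k) = blk k" "\<And>k. \<bar>\<Sum>i\<le>k. z (\<sigma> i)\<bar> \<le> C / 2 ^ blk k"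
    using rearrange_blocks[OF d sums] by blast
  define y where "y k = (\<Sum>i\<le>k. z (\<sigma> i))" for k
  have y: "decay y (2 * C)" unfolding y_def by (rule decay_blk[OF \<sigma>(3) C0])
  have z\<sigma>: "decay (\<lambda>k. z (\<sigma> k)) (2 * C)"
    using decay_on_block[OF d, of "\<sigma> _"] \<sigma>(2) C0 by (intro decay_blk) auto
  have sy: "\<tau> (diag e (shiftS y)) = \<tau> (diag e y)"
  proof (rule trace_diag_push[OF t e _ y])
    show "inj Suc" by simp
    show "shiftS y (Suc k) = y k" for k by (simp add: shiftS_def)
    show "shiftS y j = 0" if "j \<notin> range Suc" for j using that by (cases j) (auto simp: shiftS_def)
  qed
  \<comment> \<open>The shift is the difference of \<open>y\<close> and the rearranged
    \<open>z\<close>, and inherits a bound from both.\<close>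
  have "decay (shiftS y) (2 * C + 2 * C)"
  proof -
    have "shiftS y = (\<lambda>k. y k + (-1) * z (\<sigma> k))"
    proof
      fix k show "shiftS y k = y k + (-1) * z (\<sigma> k)"
        by (cases k) (auto simp: shiftS_def y_def)
    qed
    thus ?thesis using decay_add[OF y decay_scale[OF z\<sigma>, of "-1"]] by simp
  qed
  note sd = this
  have "\<tau> (diag e z) = \<tau> (diag e (\<lambda>k. z (\<sigma> k)))"
    by (rule trace_diag_push[OF t e bij_is_inj[OF \<sigma>(1)] z\<sigma>]) (use bij_is_surj[OF \<sigma>(1)] in auto)
  moreover have "y = (\<lambda>k. z (\<sigma> k) + shiftS y k)"
  proof
    fix k show "y k = z (\<sigma> k) + shiftS y k" by (cases k) (auto simp: shiftS_def y_def)
  qed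
  hence "\<tau> (diag e y) = \<tau> (diag e (\<lambda>k. z (\<sigma> k))) + \<tau> (diag e (shiftS y))"
    using trace_diag_add[OF t e z\<sigma> sd] by simp
  ultimately show ?thesis using sy by simp
qed

section \<open>Values of a trace on positive operators\<close>

lemma block_seq_linf:
  assumes "A \<in> L1inf"
  shows "block_seq A \<in> linf"
proof -
  obtain C where C: "decay (\<lambda>n. sing_val n A) C" using L1inf_decay[OF assms] by blast
  have "(\<Sum>k = 2 ^ n - 1 .. 2 ^ (n + 1) - 2. sing_val k A) \<le> C" for n
  proof -
    have "(\<Sum>k = 2 ^ n - 1 .. 2 ^ (n + 1) - 2. sing_val k A) \<le> (\<Sum>k = 2 ^ n - 1 .. 2 ^ (n + 1) - (2::nat). C / 2 ^ n)"
    proof (rule sum_mono)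
      fix k :: nat assume "k \<in> {2 ^ n - 1 .. 2 ^ (n + 1) - 2}"
      hence "blk k = n" unfolding mem_block_iff .
      thus "sing_val k A \<le> C / 2 ^ n" using decay_on_block[OF C, of k] by simp
    qed
    also have "\<dots> = C" unfolding sum_constant card_block by simp
    finally show ?thesis .
  qed
  moreover have "0 \<le> (\<Sum>k = 2 ^ n - 1 .. 2 ^ (n + 1) - 2. sing_val k A)" for n
    by (intro sum_nonneg sing_val_nonneg)
  ultimately show ?thesis
    by (intro linfI[of _ "C / ln 2"]) (simp add: block_seq_def divide_right_mono)
qed

theorem trace_pos_eq:
  assumes t: "is_trace \<tau>" and e: "orthonormal_basis e" and A: "A \<in> L1inf" and p: "pos_op A"
  shows "\<tau> A = \<tau> (diag e (Dop (block_seq A)))"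
proof -
  obtain f where m: "maxsys A f"
    using ex_maxsys[OF L1infD(2)[OF A] orthonormal_basisD(1)[OF e]] by blast
  obtain C where C: "decay (\<lambda>n. sing_val n A) C" using L1inf_decay[OF A] by blast
  let ?\<mu> = "\<lambda>n. sing_val n A" and ?D = "Dop (block_seq A)"
  obtain D where D: "decay ?D D" using decay_Dop[OF block_seq_linf[OF A]] by blast
  have "\<tau> A = \<tau> (sop ?\<mu> f f)" using spectral_decomposition_pos[OF A p m] by simp
  also have "\<dots> = \<tau> (diag e ?\<mu>)"
    unfolding diag_eq_sop by (rule trace_sop_onseq[OF t e maxsysD(1)[OF m] C])
  finally have 1: "\<tau> A = \<tau> (diag e ?\<mu>)" .
  \<comment> \<open>The singular values minus their block averages; the factor \<open>ln 2\<close>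
    in \<open>Dop\<close> cancels the one in \<open>block_seq\<close>.\<close>
  define z where "z k = ?\<mu> k + (-1) * ?D k" for k
  have dz: "decay z (C + \<bar>-1\<bar> * D)" unfolding z_def by (rule decay_add[OF C decay_scale[OF D]])
  have "\<tau> (diag e z) = 0"
  proof (rule trace_diag_zero_blocks[OF t e dz])
    fix n
    define M where "M = (\<Sum>k = 2 ^ n - 1 .. 2 ^ (n + 1) - 2. sing_val k A)"
    have "(\<Sum>k = 2 ^ n - 1 .. 2 ^ (n + 1) - 2. ?D k) = (\<Sum>k = 2 ^ n - 1 .. 2 ^ (n + 1) - (2::nat). M / 2 ^ n)"
    proof (rule sum.cong[OF refl])
      fix k :: nat assume "k \<in> {2 ^ n - 1 .. 2 ^ (n + 1) - 2}"
      hence "blk k = n" unfolding mem_block_iff .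
      thus "?D k = M / 2 ^ n" by (simp add: Dop_eq block_seq_def M_def)
    qed
    also have "\<dots> = M" unfolding sum_constant card_block by simp
    finally show "(\<Sum>k = 2 ^ n - 1 .. 2 ^ (n + 1) - 2. z k) = 0"
      by (simp only: z_def sum.distrib sum_distrib_left[symmetric] M_def[symmetric] mult_minus_left mult_1 sum_negf add.right_inverse)
  qed
  moreover have "?\<mu> = (\<lambda>k. z k + ?D k)" by (simp add: z_def)
  hence "\<tau> (diag e ?\<mu>) = \<tau> (diag e z) + \<tau> (diag e ?D)"
    using trace_diag_add[OF t e dz D] by simp
  ultimately show ?thesis using 1 by simp
qed

section \<open>Uniqueness of the functional\<close>

lemma sop_maxsys:
  assumes e: "onseq e" and d: "\<forall>k. \<bar>s k\<bar> \<le> C" and s: "\<And>k. 0 \<le> s k" "antimono s"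
  shows "maxsys (sop s e e) e"
  unfolding maxsys_def
proof (intro conjI allI impI e)
  fix n x assume x: "\<forall>i<n. cinner x (e i) = 0"
  have "norm (blinfun_apply (sop s e e) x) \<le> s n * norm x"
    by (rule norm_sop_tail_le[OF onseq_subon[OF e] onseq_subon[OF e] d, of n])
       (use x s antimonoD[OF s(2)] in auto)
  thus "norm (blinfun_apply (sop s e e) x) \<le> norm (blinfun_apply (sop s e e) (e n)) * norm x"
    unfolding sop_basis[OF e onseq_subon[OF e] d] using e s by simp
qed

text \<open>For a nonnegative decreasing diagonal, \<open>e\<close> is itself a maximal
  system.\<close>

lemma sing_val_sop:
  assumes e: "onseq e" and d: "\<forall>k. \<bar>s k\<bar> \<le> C" and s: "\<And>k. 0 \<le> s k" "antimono s"
  shows "sing_val n (sop s e e) = s n"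
  unfolding sing_val_maxsys[OF sop_cbounded[OF onseq_subon[OF e] onseq_subon[OF e] d] sop_maxsys[OF assms]]
    sop_basis[OF e onseq_subon[OF e] d]
  using e s by simp

lemma sop_pos:
  assumes e: "subon e" and d: "\<forall>k. \<bar>s k\<bar> \<le> C" and s: "\<And>k. 0 \<le> s k"
  shows "pos_op (sop s e e)"
  unfolding pos_op_def
proof
  fix x
  have "(\<lambda>n. complex_of_real (s n * (cmod (cinner x (e n)))\<^sup>2)) sums cinner (blinfun_apply (sop s e e) x) x"
  proof -
    have "complex_of_real (s n) * cinner x (e n) * cinner (e n) x = complex_of_real (s n * (cmod (cinner x (e n)))\<^sup>2)" for n
      unfolding of_real_mult complex_norm_square cinner_commute[of "e n" x] by (simp add: mult.assoc)
    thus ?thesis using sop_sums_cinner[OF e e d, of x x] by (simp only:)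
  qed
  hence re: "(\<lambda>n. s n * (cmod (cinner x (e n)))\<^sup>2) sums Re (cinner (blinfun_apply (sop s e e) x) x)"
    and im: "(\<lambda>n::nat. 0) sums Im (cinner (blinfun_apply (sop s e e) x) x)"
    unfolding sums_complex_iff by simp_all
  thus "Im (cinner (blinfun_apply (sop s e e) x) x) = 0 \<and> 0 \<le> Re (cinner (blinfun_apply (sop s e e) x) x)"
    using sums_unique2[OF im sums_zero] sums_le[OF _ sums_zero re] s by simp
qed

text \<open>If \<open>1 \<le> x \<le> 2\<close>, then \<open>D x\<close> is decreasing because, up to the factor \<open>ln 2\<close>, its value on a block is at least
  \<open>2\<^sup>-\<^sup>n\<close> and on the next one at most \<open>2 / 2\<^sup>n\<^sup>+\<^sup>1\<close>.\<close>

lemma block_seq_diag_Dop: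
  assumes e: "orthonormal_basis e" and x: "\<And>n. 1 \<le> x n" "\<And>n. x n \<le> 2"
  shows "diag e (Dop x) \<in> L1inf" "pos_op (diag e (Dop x))" "block_seq (diag e (Dop x)) = x"
proof -
  note oe = orthonormal_basisD(1)[OF e]
  have "x \<in> linf" using x by (intro linfI[of _ 2]) (smt (verit))
  then obtain C where C: "decay (Dop x) C" using decay_Dop by blast
  note bd = decay_bounded[OF C]
  have pos: "0 \<le> Dop x k" for k using x(1)[of "blk k"] by (simp add: Dop_eq)
  show "diag e (Dop x) \<in> L1inf" by (rule diag_L1inf[OF e C])
  show "pos_op (diag e (Dop x))" unfolding diag_eq_sop by (rule sop_pos[OF onseq_subon[OF oe] bd pos])
  have step: "x (Suc n) / 2 ^ Suc n \<le> x n / 2 ^ n" for n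
    using x(1)[of n] x(2)[of "Suc n"] by (simp add: field_simps)
  have anti: "antimono (Dop x)"
  proof (rule antimonoI)
    fix j k :: nat assume "j \<le> k"
    have "(2::nat) ^ blk j < 2 ^ (blk k + 1)"
      using blk_bounds(1)[of j] blk_bounds(2)[of k] \<open>j \<le> k\<close> by linarith
    hence "blk j \<le> blk k" by (metis Suc_eq_plus1 less_Suc_eq_le one_less_numeral_iff power_less_imp_less_exp semiring_norm(76))
    hence "x (blk k) / 2 ^ blk k \<le> x (blk j) / 2 ^ blk j"
      using lift_Suc_antimono_le[of "\<lambda>n. x n / 2 ^ n", OF step] by blast
    hence "ln 2 * (x (blk k) / 2 ^ blk k) \<le> ln 2 * (x (blk j) / 2 ^ blk j)" by (rule mult_left_mono) simp
    thus "Dop x k \<le> Dop x j" by (simp add: Dop_eq)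
  qed
  show "block_seq (diag e (Dop x)) = x"
  proof
    fix n
    have "(\<Sum>k = 2 ^ n - 1 .. 2 ^ (n + 1) - 2. Dop x k) = (\<Sum>k = 2 ^ n - 1 .. 2 ^ (n + 1) - (2::nat). ln 2 * x n / 2 ^ n)"
    proof (rule sum.cong[OF refl])
      fix k :: nat assume "k \<in> {2 ^ n - 1 .. 2 ^ (n + 1) - 2}"
      hence "blk k = n" unfolding mem_block_iff .
      thus "Dop x k = ln 2 * x n / 2 ^ n" by (simp add: Dop_eq)
    qed
    also have "\<dots> = ln 2 * x n" unfolding sum_constant card_block by simp
    finally show "block_seq (diag e (Dop x)) n = x n"
      unfolding block_seq_def diag_eq_sop sing_val_sop[OF oe bd pos anti] by simp
  qed
qed

text \<open>A small multiple of any bounded sequence, shifted by the constant \<open>3/2\<close>,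
  has values between 1 and 2, so such sequences span \<open>linf\<close>. The interval is the one in
  which \<open>block_seq_diag_Dop\<close> applies.\<close>

lemma linear_on_linf_determined:
  assumes l1: "linear_on_linf \<theta>" and l2: "linear_on_linf \<theta>'"
    and eq: "\<And>x. (\<And>n. 1 \<le> x n) \<Longrightarrow> (\<And>n. x n \<le> 2) \<Longrightarrow> \<theta> x = \<theta>' x"
    and x: "x \<in> linf"
  shows "\<theta> x = \<theta>' x"
proof -
  obtain C where C: "0 \<le> C" "\<And>n. \<bar>x n\<bar> \<le> C" using linfD[OF x] by blast
  \<comment> \<open>Twice a bound of \<open>x\<close> brings the quotient within 1/2; adding 1 keeps
    \<open>D\<close> positive when \<open>C = 0\<close>.\<close>
  define D where "D = 2 * (C + 1)"
  define y where "y n = 3/2 + x n / D" for n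
  have xD: "\<bar>x n / D\<bar> \<le> 1/2" for n
    using C(1) C(2)[of n] unfolding D_def abs_divide by (simp add: field_simps)
  have y: "1 \<le> y n" "y n \<le> 2" for n using xD[of n] unfolding y_def by linarith+
  define c :: "nat \<Rightarrow> real" where "c n = 3/2" for n
  have yl: "y \<in> linf" using y by (intro linfI[of _ 2]) (smt (verit))
  have cl: "c \<in> linf" by (intro linfI[of _ 2]) (simp add: c_def)
  have xy: "x = (\<lambda>n. D * y n + (- D) * c n)" using C(1) by (simp add: y_def c_def D_def fun_eq_iff field_simps)
  have sc: "(\<lambda>n. a * z n) \<in> linf" if zl: "z \<in> linf" for a z
  proof -
    obtain B where "0 \<le> B" "\<And>n. \<bar>z n\<bar> \<le> B" using linfD[OF zl] by blast
    thus ?thesis by (intro linfI[of _ "\<bar>a\<bar> * B"]) (simp add: abs_mult mult_left_mono)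
  qed
  have "\<theta> x = of_real D * \<theta> y + of_real (- D) * \<theta> c" if "linear_on_linf \<theta>" for \<theta>
    using that sc[OF yl, of D] sc[OF cl, of "- D"] yl cl unfolding linear_on_linf_def
    by (subst xy) (simp only:)
  from this[OF l1] this[OF l2] show ?thesis
    using eq[of y] eq[of c] y by (simp add: c_def)
qed

section \<open>Ky Fan inequalities\<close>

definition pos_cone :: "('a::chilbert \<Rightarrow>\<^sub>L 'a) set" where
  "pos_cone = {A \<in> L1inf. pos_op A}"

lemma pos_coneD: "A \<in> pos_cone \<Longrightarrow> A \<in> L1inf" "A \<in> pos_cone \<Longrightarrow> pos_op A"
  by (auto simp: pos_cone_def)

lemma pos_cone_add: "A \<in> pos_cone \<Longrightarrow> B \<in> pos_cone \<Longrightarrow> A + B \<in> pos_cone"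
  by (auto simp: pos_cone_def L1inf_add pos_op_def blinfun.add_left cinner_add_left)

lemma pos_cone_scaleR: "A \<in> pos_cone \<Longrightarrow> 0 \<le> r \<Longrightarrow> r *\<^sub>R A \<in> pos_cone"
  by (auto simp: pos_cone_def L1inf_scaleR pos_op_def blinfun.scaleR_left)

definition quad :: "('a::chilbert \<Rightarrow>\<^sub>L 'a) \<Rightarrow> 'a \<Rightarrow> real" where
  "quad A x = Re (cinner (blinfun_apply A x) x)"

lemma quad_add: "quad (A + B) x = quad A x + quad B x"
  by (simp add: quad_def blinfun.add_left cinner_add_left)

text \<open>The span of the first \<open>n\<close> eigenvectors and its orthogonal complement are
  both invariant, so the mixed terms vanish.\<close>

lemma quad_split:
  assumes A: "A \<in> cbounded" and p: "pos_op A" and m: "maxsys A f"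
  shows "quad A x = (\<Sum>k<n. sing_val k A * (cmod (cinner x (f k)))\<^sup>2)
     + quad A (x - (\<Sum>k<n. scaleC (cinner x (f k)) (f k)))"
proof -
  have on: "onseq f" by (rule maxsysD(1)[OF m])
  define c where "c k = cinner x (f k)" for k
  define y where "y = (\<Sum>k<n. scaleC (c k) (f k))"
  define w where "w = x - y"
  have Af: "blinfun_apply A (f k) = sing_val k A *\<^sub>R f k" for k
    using pos_op_maxsys_eigen[OF A p m, of k] by (simp add: sing_val_maxsys[OF A m])
  have yk: "cinner y (f k) = c k" if "k < n" for k
    using that by (simp add: y_def cinner_sum_onseq[OF on])
  have wk: "cinner w (f k) = 0" if "k < n" for k
    using yk[OF that] by (simp add: w_def cinner_diff_left c_def)
  have Ay: "blinfun_apply A y = (\<Sum>k<n. scaleC (c k * of_real (sing_val k A)) (f k))"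
    unfolding y_def cbounded_sum_scaleC[OF A] by (simp add: Af scaleC_scaleC flip: scaleC_of_real)
  have "cinner w (blinfun_apply A y) = 0" unfolding Ay by (simp add: cinner_sum_right wk)
  hence wy: "cinner (blinfun_apply A w) y = 0" "cinner (blinfun_apply A y) w = 0"
    using pos_op_selfadjoint[OF A p, of w y] cinner_eq_0_commute by auto
  have "cinner (blinfun_apply A y) y = (\<Sum>k<n. c k * of_real (sing_val k A) * cinner (f k) y)"
    unfolding Ay by (simp add: cinner_sum_left)
  also have "\<dots> = (\<Sum>k<n. of_real (sing_val k A * (cmod (c k))\<^sup>2))"
  proof (rule sum.cong[OF refl])
    fix k assume "k \<in> {..<n}"
    hence "cinner (f k) y = cnj (c k)" using yk[of k] by (simp add: cinner_commute[of "f k" y])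
    thus "c k * of_real (sing_val k A) * cinner (f k) y = of_real (sing_val k A * (cmod (c k))\<^sup>2)"
      unfolding of_real_mult complex_norm_square by (simp add: mult_ac)
  qed
  finally have yy: "Re (cinner (blinfun_apply A y) y) = (\<Sum>k<n. sing_val k A * (cmod (c k))\<^sup>2)"
    by (simp flip: of_real_sum)
  have "cinner (blinfun_apply A x) x = cinner (blinfun_apply A (y + w)) (y + w)" by (simp add: w_def)
  also have "\<dots> = cinner (blinfun_apply A y) y + cinner (blinfun_apply A w) w"
    by (simp add: blinfun.add_right cinner_add_left cinner_add_right wy)
  finally show ?thesis using yy by (simp add: quad_def w_def y_def c_def)
qed

lemma quad_ge:
  assumes "A \<in> cbounded" "pos_op A" "maxsys A f"
  shows "(\<Sum>k<n. sing_val k A * (cmod (cinner x (f k)))\<^sup>2) \<le> quad A x"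
  using quad_split[OF assms, of x n] assms(2) by (simp add: quad_def pos_op_def)

text \<open>On the complement of the first \<open>n\<close> eigenvectors the form is at most
  \<open>sing_val n A\<close> times the squared norm. Pythagoras moves this part into the
  coefficients; they stay nonnegative, so Bessel's inequality can be applied after summing over
  several vectors.\<close>

lemma quad_le:
  assumes A: "A \<in> cbounded" and p: "pos_op A" and m: "maxsys A f"
  shows "quad A x \<le> (\<Sum>k<n. (sing_val k A - sing_val n A) * (cmod (cinner x (f k)))\<^sup>2) + sing_val n A * (norm x)\<^sup>2"
proof -
  have on: "onseq f" by (rule maxsysD(1)[OF m])
  define w where "w = x - (\<Sum>k<n. scaleC (cinner x (f k)) (f k))"
  have "quad A w \<le> norm (blinfun_apply A w) * norm w"
    unfolding quad_def by (rule order_trans[OF complex_Re_le_cmod norm_cinner_le])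
  also have "norm (blinfun_apply A w) \<le> sing_val n A * norm w"
    unfolding sing_val_maxsys[OF A m]
    by (rule maxsysD(2)[OF m]) (simp add: w_def cinner_diff_left cinner_sum_onseq[OF on])
  hence "norm (blinfun_apply A w) * norm w \<le> sing_val n A * norm w * norm w" by (rule mult_right_mono) simp
  also have "\<dots> = sing_val n A * (norm w)\<^sup>2" by (simp add: power2_eq_square)
  also have "\<dots> = sing_val n A * ((norm x)\<^sup>2 - (\<Sum>k<n. (cmod (cinner x (f k)))\<^sup>2))"
    unfolding w_def pythagoras_projection[OF on finite_lessThan] ..
  finally show ?thesis
    unfolding quad_split[OF assms, of x n] w_def[symmetric]
    by (simp add: left_diff_distrib sum_subtractf right_diff_distrib sum_distrib_left)
qed

text \<open>Ky Fan's maximum principle: Bessel's inequality for \<open>u\<close> bounds the total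
  weight of each eigenvector by 1. By \<open>quad_eigenvector\<close> the eigenvectors themselves
  give equality.\<close>

lemma sum_quad_le:
  assumes A: "A \<in> cbounded" and p: "pos_op A" and m: "maxsys A f" and u: "subon u"
  shows "(\<Sum>i<n. quad A (u i)) \<le> (\<Sum>k<n. sing_val k A)"
proof -
  let ?\<mu> = "\<lambda>k. sing_val k A"
  have on: "onseq f" by (rule maxsysD(1)[OF m])
  have "(\<Sum>i<n. quad A (u i))
     \<le> (\<Sum>i<n. (\<Sum>k<n. (?\<mu> k - ?\<mu> n) * (cmod (cinner (u i) (f k)))\<^sup>2) + ?\<mu> n * (norm (u i))\<^sup>2)"
    by (intro sum_mono quad_le[OF A p m])
  also have "\<dots> = (\<Sum>i<n. \<Sum>k<n. (?\<mu> k - ?\<mu> n) * (cmod (cinner (u i) (f k)))\<^sup>2) + (\<Sum>i<n. ?\<mu> n * (norm (u i))\<^sup>2)"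
    by (rule sum.distrib)
  also have "(\<Sum>i<n. \<Sum>k<n. (?\<mu> k - ?\<mu> n) * (cmod (cinner (u i) (f k)))\<^sup>2)
     = (\<Sum>k<n. (?\<mu> k - ?\<mu> n) * (\<Sum>i<n. (cmod (cinner (u i) (f k)))\<^sup>2))"
    unfolding sum_distrib_left by (rule sum.swap)
  also have "\<dots> \<le> (\<Sum>k<n. (?\<mu> k - ?\<mu> n) * 1)"
  proof (intro sum_mono mult_left_mono)
    fix k assume "k \<in> {..<n}"
    thus "0 \<le> ?\<mu> k - ?\<mu> n" using sing_val_antimono[of k n A] by simp
    have "cmod (cinner (u i) (f k)) = cmod (cinner (f k) (u i))" for i
      by (simp add: cinner_commute[of "u i" "f k"])
    thus "(\<Sum>i<n. (cmod (cinner (u i) (f k)))\<^sup>2) \<le> 1"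
      using bessel[OF u finite_lessThan, of "f k"] on by simp
  qed
  also have "(\<Sum>i<n. ?\<mu> n * (norm (u i))\<^sup>2) \<le> (\<Sum>i<n. ?\<mu> n * 1)"
    using u by (intro sum_mono mult_left_mono sing_val_nonneg) (auto simp: subon_def power_le_one)
  finally show ?thesis by (simp add: sum_subtractf)
qed

lemma quad_eigenvector:
  assumes A: "A \<in> cbounded" and p: "pos_op A" and m: "maxsys A f"
  shows "quad A (f k) = sing_val k A"
proof -
  have "quad A (f k) = Re (cinner (norm (blinfun_apply A (f k)) *\<^sub>R f k) (f k))"
    unfolding quad_def using pos_op_maxsys_eigen[OF A p m, of k] by simp
  thus ?thesis using maxsysD(1)[OF m] by (simp add: sing_val_maxsys[OF A m] cinner_self)
qed

lemma pos_cone_maxsys: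
  fixes A :: "'a::chilbert \<Rightarrow>\<^sub>L 'a"
  assumes "A \<in> pos_cone" "onseq (e :: nat \<Rightarrow> 'a)"
  shows "\<exists>f. A \<in> cbounded \<and> pos_op A \<and> maxsys A f"
  using ex_maxsys[OF L1infD(2) assms(2)] pos_coneD[OF assms(1)] L1infD(1) by blast

text \<open>The eigenvectors of \<open>A + B\<close> are admissible in the maximum principle for
  \<open>A\<close> and for \<open>B\<close>.\<close>

theorem sum_sing_val_add_le:
  fixes A B :: "'a::chilbert \<Rightarrow>\<^sub>L 'a"
  assumes A: "A \<in> pos_cone" and B: "B \<in> pos_cone" and e: "onseq (e :: nat \<Rightarrow> 'a)"
  shows "(\<Sum>k<n. sing_val k (A + B)) \<le> (\<Sum>k<n. sing_val k A) + (\<Sum>k<n. sing_val k B)"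
proof -
  obtain f where f: "A \<in> cbounded" "pos_op A" "maxsys A f" using pos_cone_maxsys[OF A e] by blast
  obtain g where g: "B \<in> cbounded" "pos_op B" "maxsys B g" using pos_cone_maxsys[OF B e] by blast
  obtain h where h: "A + B \<in> cbounded" "pos_op (A + B)" "maxsys (A + B) h"
    using pos_cone_maxsys[OF pos_cone_add[OF A B] e] by blast
  have "subon h" by (rule onseq_subon[OF maxsysD(1)[OF h(3)]])
  have "(\<Sum>k<n. sing_val k (A + B)) = (\<Sum>k<n. quad A (h k)) + (\<Sum>k<n. quad B (h k))"
    by (simp add: quad_eigenvector[OF h, symmetric] quad_add sum.distrib)
  also have "\<dots> \<le> (\<Sum>k<n. sing_val k A) + (\<Sum>k<n. sing_val k B)"
    by (intro add_mono sum_quad_le[OF f \<open>subon h\<close>] sum_quad_le[OF g \<open>subon h\<close>])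
  finally show ?thesis .
qed

text \<open>In the application the first \<open>n\<close> eigenvectors lie in the span of the
  \<open>u i\<close>, so each has its full weight there.\<close>

lemma sum_quad_ge:
  assumes f: "A \<in> cbounded" "pos_op A" "maxsys A f"
    and 1: "\<And>k. k < n \<Longrightarrow> 1 \<le> (\<Sum>i<m. (cmod (cinner (u i) (f k)))\<^sup>2)"
  shows "(\<Sum>k<n. sing_val k A) \<le> (\<Sum>i<m. quad A (u i))"
proof -
  have "(\<Sum>k<n. sing_val k A * 1) \<le> (\<Sum>k<n. sing_val k A * (\<Sum>i<m. (cmod (cinner (u i) (f k)))\<^sup>2))"
    using 1 by (intro sum_mono mult_left_mono sing_val_nonneg) auto
  also have "\<dots> = (\<Sum>i<m. \<Sum>k<n. sing_val k A * (cmod (cinner (u i) (f k)))\<^sup>2)"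
    unfolding sum_distrib_left by (rule sum.swap)
  also have "\<dots> \<le> (\<Sum>i<m. quad A (u i))" by (intro sum_mono quad_ge[OF f])
  finally show ?thesis by simp
qed

text \<open>Orthonormalising the first \<open>n\<close> eigenvectors of \<open>A\<close> together
  with those of \<open>B\<close> gives at most \<open>2 n\<close> directions. They capture the
  leading parts of both forms, and the maximum principle for \<open>A + B\<close> bounds the total
  by \<open>2 n\<close> singular values.\<close>

theorem sum_sing_val_add_ge:
  fixes A B :: "'a::chilbert \<Rightarrow>\<^sub>L 'a"
  assumes A: "A \<in> pos_cone" and B: "B \<in> pos_cone" and e: "onseq (e :: nat \<Rightarrow> 'a)"
  shows "(\<Sum>k<n. sing_val k A) + (\<Sum>k<n. sing_val k B) \<le> (\<Sum>k<n + n. sing_val k (A + B))"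
proof -
  obtain f where f: "A \<in> cbounded" "pos_op A" "maxsys A f" using pos_cone_maxsys[OF A e] by blast
  obtain g where g: "B \<in> cbounded" "pos_op B" "maxsys B g" using pos_cone_maxsys[OF B e] by blast
  obtain h where h: "A + B \<in> cbounded" "pos_op (A + B)" "maxsys (A + B) h"
    using pos_cone_maxsys[OF pos_cone_add[OF A B] e] by blast
  define v where "v k = (if k < n then f k else g (k - n))" for k
  obtain u where u: "subon u" "\<And>k. v k = (\<Sum>i\<le>k. scaleC (cinner (v k) (u i)) (u i))"
    using gram_schmidt[of v] by blast
  have v1: "1 \<le> (\<Sum>i<n + n. (cmod (cinner (u i) (v k)))\<^sup>2)" if "k < n + n" for k
  proof -
    have "norm (v k) = 1" using maxsysD(1)[OF f(3)] maxsysD(1)[OF g(3)] by (simp add: v_def)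
    hence "1 = (norm (\<Sum>i\<le>k. scaleC (cinner (v k) (u i)) (u i)))\<^sup>2" using u(2)[of k] by simp
    also have "\<dots> \<le> (\<Sum>i\<le>k. (cmod (cinner (v k) (u i)))\<^sup>2)" by (rule norm_sum_subon[OF u(1) finite_atMost])
    also have "\<dots> \<le> (\<Sum>i<n + n. (cmod (cinner (v k) (u i)))\<^sup>2)" using that by (intro sum_mono2) auto
    also have "\<dots> = (\<Sum>i<n + n. (cmod (cinner (u i) (v k)))\<^sup>2)"
      by (rule sum.cong) (simp_all add: cinner_commute[of "v k"])
    finally show ?thesis .
  qed
  have "(\<Sum>k<n. sing_val k A) + (\<Sum>k<n. sing_val k B) \<le> (\<Sum>i<n + n. quad A (u i)) + (\<Sum>i<n + n. quad B (u i))"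
  proof (intro add_mono sum_quad_ge[OF f] sum_quad_ge[OF g])
    fix k assume "k < n"
    thus "1 \<le> (\<Sum>i<n + n. (cmod (cinner (u i) (f k)))\<^sup>2)" using v1[of k] by (simp add: v_def)
    show "1 \<le> (\<Sum>i<n + n. (cmod (cinner (u i) (g k)))\<^sup>2)" using v1[of "n + k"] \<open>k < n\<close> by (simp add: v_def)
  qed
  also have "\<dots> = (\<Sum>i<n + n. quad (A + B) (u i))" by (simp add: quad_add sum.distrib)
  also have "\<dots> \<le> (\<Sum>k<n + n. sing_val k (A + B))" by (rule sum_quad_le[OF h u(1)])
  finally show ?thesis .
qed

section \<open>From shift-invariant functionals to traces\<close>

lemma linear_on_linfD:
  assumes "linear_on_linf \<theta>"
  shows "x \<in> linf \<Longrightarrow> y \<in> linf \<Longrightarrow> \<theta> (\<lambda>n. x n + y n) = \<theta> x + \<theta> y"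
    and "x \<in> linf \<Longrightarrow> \<theta> (\<lambda>n. c * x n) = of_real c * \<theta> x"
  using assms by (auto simp: linear_on_linf_def)

lemma linf_add:
  assumes "x \<in> linf" "y \<in> linf"
  shows "(\<lambda>n. x n + y n) \<in> linf"
proof -
  obtain C D where "\<And>n. \<bar>x n\<bar> \<le> C" "\<And>n. \<bar>y n\<bar> \<le> D" using linfD[OF assms(1)] linfD[OF assms(2)] by blast
  thus ?thesis by (intro linfI[of _ "C + D"] order_trans[OF abs_triangle_ineq] add_mono)
qed

lemma shift_invariant_bounded_partial_sums:
  assumes l: "linear_on_linf \<theta>" and s: "shift_invariant \<theta>" and x: "x \<in> linf"
    and b: "\<And>n. \<bar>\<Sum>m\<le>n. x m\<bar> \<le> C"
  shows "\<theta> x = 0"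
proof -
  define y where "y n = (\<Sum>m\<le>n. x m)" for n
  have y: "y \<in> linf" unfolding y_def by (rule linfI[OF b])
  have sy: "shiftS y \<in> linf"
  proof (rule linfI)
    fix n show "\<bar>shiftS y n\<bar> \<le> C"
      using b order_trans[OF abs_ge_zero b[of 0]] by (simp add: shiftS_def y_def)
  qed
  have "y = (\<lambda>n. x n + shiftS y n)"
  proof
    fix n show "y n = x n + shiftS y n" by (cases n) (auto simp: shiftS_def y_def)
  qed
  hence "\<theta> y = \<theta> x + \<theta> (shiftS y)" using linear_on_linfD(1)[OF l x sy] by simp
  thus ?thesis using s y by (simp add: shift_invariant_def)
qed

lemma sum_blocks:
  fixes h :: "nat \<Rightarrow> real"
  shows "(\<Sum>m<n. \<Sum>k = 2 ^ m - 1 .. 2 ^ (m + 1) - 2. h k) = (\<Sum>k<2 ^ n - 1. h k)"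
proof (induction n)
  case (Suc n)
  have "(2::nat) ^ Suc n - 1 = (2 ^ n - 1) + 2 ^ n" using one_le_power[of "2::nat" n] by simp
  moreover have "(\<Sum>k = 2 ^ n - 1 .. 2 ^ (n + 1) - 2. h k) = (\<Sum>i<2 ^ n. h (2 ^ n - 1 + i))"
    unfolding block_eq by (subst sum.reindex) (auto simp: inj_on_def)
  ultimately show ?case using Suc by (simp only: sum_lessThan_add sum.lessThan_Suc)
qed simp

text \<open>Summing the first blocks turns the defect into a difference of partial sums up to
  \<open>N = 2 ^ (n + 1) - 1\<close>. The Ky Fan inequalities place it between 0 and the sum of
  \<open>sing_val k (A + B)\<close> over \<open>N \<le> k < 2 * N\<close>. Each of these
  \<open>N\<close> terms is at most \<open>C / (N + 1)\<close>, so the bound \<open>C\<close> does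
  not depend on \<open>n\<close>.\<close>

lemma block_seq_additive:
  fixes A B :: "'a::chilbert \<Rightarrow>\<^sub>L 'a"
  assumes l: "linear_on_linf \<theta>" and s: "shift_invariant \<theta>"
    and A: "A \<in> pos_cone" and B: "B \<in> pos_cone" and e: "onseq (e :: nat \<Rightarrow> 'a)"
  shows "\<theta> (block_seq (A + B)) = \<theta> (block_seq A) + \<theta> (block_seq B)"
proof -
  let ?a = "block_seq A" and ?b = "block_seq B" and ?c = "block_seq (A + B)"
  let ?h = "\<lambda>k. sing_val k A + sing_val k B - sing_val k (A + B)"
  have L: "A \<in> L1inf" "B \<in> L1inf" "A + B \<in> L1inf"
    using pos_coneD(1)[OF A] pos_coneD(1)[OF B] pos_coneD(1)[OF pos_cone_add[OF A B]] by auto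
  note lin = block_seq_linf[OF L(1)] block_seq_linf[OF L(2)] block_seq_linf[OF L(3)]
  obtain C where C: "decay (\<lambda>n. sing_val n (A + B)) C" using L1inf_decay[OF L(3)] by blast
  define x where "x n = ?a n + ?b n + (-1) * ?c n" for n
  have ml: "(\<lambda>n. (-1) * ?c n) \<in> linf"
  proof -
    obtain D where "\<And>n. \<bar>?c n\<bar> \<le> D" using linfD[OF lin(3)] by blast
    thus ?thesis by (intro linfI[of _ D]) simp
  qed
  have xl: "x \<in> linf" unfolding x_def by (intro linf_add lin ml)
  have "\<bar>\<Sum>m\<le>n. x m\<bar> \<le> C / ln 2" for n
  proof -
    define N :: nat where "N = 2 ^ Suc n - 1"
    have "x m = (1 / ln 2) * (\<Sum>k = 2 ^ m - 1 .. 2 ^ (m + 1) - 2. ?h k)" for m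
      unfolding x_def block_seq_def sum_subtractf sum.distrib by (simp add: algebra_simps diff_divide_distrib)
    hence "(\<Sum>m\<le>n. x m) = (1 / ln 2) * (\<Sum>m<Suc n. \<Sum>k = 2 ^ m - 1 .. 2 ^ (m + 1) - 2. ?h k)"
      by (simp only: sum_distrib_left lessThan_Suc_atMost)
    also have "\<dots> = (\<Sum>k<N. ?h k) / ln 2" unfolding sum_blocks N_def by simp
    finally have eq: "(\<Sum>m\<le>n. x m) = (\<Sum>k<N. ?h k) / ln 2" .
    have h: "(\<Sum>k<N. ?h k) = (\<Sum>k<N. sing_val k A) + (\<Sum>k<N. sing_val k B) - (\<Sum>k<N. sing_val k (A + B))"
      by (simp add: sum.distrib sum_subtractf)
    have "0 \<le> (\<Sum>k<N. ?h k)" unfolding h using sum_sing_val_add_le[OF A B e, of N] by simp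
    moreover have "(\<Sum>k<N. ?h k) \<le> C"
    proof -
      have "(\<Sum>k<N. ?h k) \<le> (\<Sum>i<N. sing_val (N + i) (A + B))"
        unfolding h using sum_sing_val_add_ge[OF A B e, of N] by (simp add: sum_lessThan_add)
      also have "\<dots> \<le> (\<Sum>i<N. C / real (N + 1))"
        by (intro sum_mono order_trans[OF abs_ge_self decay_tail[OF C]]) simp
      also have "\<dots> = real N * (C / real (N + 1))" by simp
      also have "\<dots> \<le> C" using decay_nonneg[OF C] by (simp add: field_simps)
      finally show ?thesis .
    qed
    ultimately show ?thesis unfolding eq by (simp add: divide_right_mono)
  qed
  hence "\<theta> x = 0" by (rule shift_invariant_bounded_partial_sums[OF l s xl])
  moreover have "\<theta> x = \<theta> ?a + \<theta> ?b + of_real (-1) * \<theta> ?c"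
    unfolding x_def linear_on_linfD(1)[OF l linf_add[OF lin(1,2)] ml] linear_on_linfD(1)[OF l lin(1,2)]
      linear_on_linfD(2)[OF l lin(3)] ..
  ultimately show ?thesis by (simp add: algebra_simps)
qed

section \<open>Block sums under scaling and unitary conjugation\<close>

lemma sing_val_scaleR:
  fixes A :: "'a::chilbert \<Rightarrow>\<^sub>L 'a"
  assumes A: "A \<in> L1inf" and e: "onseq (e :: nat \<Rightarrow> 'a)"
  shows "sing_val n (r *\<^sub>R A) = \<bar>r\<bar> * sing_val n A"
proof -
  obtain f where m: "maxsys A f" using ex_maxsys[OF L1infD(2)[OF A] e] by blast
  hence "maxsys (r *\<^sub>R A) f"
    unfolding maxsys_def by (simp add: blinfun.scaleR_left mult_left_mono mult.assoc)
  from sing_val_maxsys[OF L1infD(1)[OF L1inf_scaleR[OF A]] this] show ?thesis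
    by (simp add: sing_val_maxsys[OF L1infD(1)[OF A] m] blinfun.scaleR_left)
qed

lemma block_seq_scaleR:
  fixes A :: "'a::chilbert \<Rightarrow>\<^sub>L 'a"
  assumes "A \<in> L1inf" "onseq (e :: nat \<Rightarrow> 'a)" "0 \<le> r"
  shows "block_seq (r *\<^sub>R A) = (\<lambda>n. r * block_seq A n)"
  using assms(3) by (simp add: block_seq_def fun_eq_iff sing_val_scaleR[OF assms(1,2)] sum_distrib_left mult.assoc)

lemma unitary_cinner:
  assumes "unitary U"
  shows "cinner (blinfun_apply U x) (blinfun_apply U y) = cinner x y"
proof -
  have n: "norm (blinfun_apply U x) = norm x" and U: "U \<in> cbounded" for x
    using assms by (auto simp: unitary_def)
  have i: "inner (blinfun_apply U x) (blinfun_apply U y) = inner x y" for x y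
    unfolding dot_norm by (simp add: n flip: blinfun.add_right)
  show ?thesis using i[of x y] i[of x "scaleC \<i> y"] by (simp add: cinner_def cboundedD[OF U])
qed

text \<open>\<open>U\<close> carries a maximal system of \<open>A\<close> to one of \<open>B\<close>
  with the same norms.\<close>

lemma unitary_conj_sing_val:
  fixes A B U :: "'a::chilbert \<Rightarrow>\<^sub>L 'a"
  assumes U: "unitary U" and e: "onseq (e :: nat \<Rightarrow> 'a)" and A: "A \<in> cbounded" "compact_op A" and B: "B \<in> cbounded"
    and BU: "\<And>x. blinfun_apply B (blinfun_apply U x) = blinfun_apply U (blinfun_apply A x)"
  shows "sing_val n B = sing_val n A"
proof -
  have nU: "norm (blinfun_apply U x) = norm x" for x using U by (simp add: unitary_def)
  obtain f where m: "maxsys A f" using ex_maxsys[OF A(2) e] by blast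
  have "maxsys B (\<lambda>k. blinfun_apply U (f k))"
    unfolding maxsys_def
  proof (intro conjI allI impI)
    show "onseq (\<lambda>k. blinfun_apply U (f k))"
      using maxsysD(1)[OF m] by (simp add: onseq_def unitary_cinner[OF U])
    fix n x assume x: "\<forall>i<n. cinner x (blinfun_apply U (f i)) = 0"
    obtain y where y: "x = blinfun_apply U y" using U unfolding unitary_def by (metis surjD)
    have "norm (blinfun_apply A y) \<le> norm (blinfun_apply A (f n)) * norm y"
      by (rule maxsysD(2)[OF m]) (use x in \<open>simp add: y unitary_cinner[OF U]\<close>)
    thus "norm (blinfun_apply B x) \<le> norm (blinfun_apply B (blinfun_apply U (f n))) * norm x"
      by (simp add: y BU nU)
  qed
  from sing_val_maxsys[OF B this] show ?thesis
    by (simp add: BU nU sing_val_maxsys[OF A(1) m])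
qed

text \<open>Conjugating the parts of a decomposition requires actual operators, so \<open>A\<close>
  is composed with \<open>U\<close> and its inverse, and the result is shown to stay in the
  cone.\<close>

lemma unitary_conjugate:
  fixes A U :: "'a::chilbert \<Rightarrow>\<^sub>L 'a"
  assumes U: "unitary U" and e: "onseq (e :: nat \<Rightarrow> 'a)" and A: "A \<in> pos_cone"
  shows "\<exists>B\<in>pos_cone. (\<forall>x. blinfun_apply B (blinfun_apply U x) = blinfun_apply U (blinfun_apply A x)) \<and>
     block_seq B = block_seq A"
proof -
  have nU: "norm (blinfun_apply U x) = norm x" for x using U by (simp add: unitary_def)
  have Uc: "U \<in> cbounded" using U by (simp add: unitary_def)
  have "inj (blinfun_apply U)"
  proof (rule injI)
    fix x y assume "blinfun_apply U x = blinfun_apply U y"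
    hence "norm (x - y) = 0" using nU[of "x - y"] by (simp add: blinfun.diff_right)
    thus "x = y" by simp
  qed
  define V where "V = inv (blinfun_apply U)"
  have VU: "V (blinfun_apply U x) = x" for x using \<open>inj (blinfun_apply U)\<close> by (simp add: V_def)
  have UV: "blinfun_apply U (V x) = x" for x using U by (simp add: V_def unitary_def surj_f_inv_f)
  have V_eqI: "V x = y" if "blinfun_apply U y = x" for x y using VU[of y] that by simp
  have nV: "norm (V x) = norm x" for x using nU[of "V x"] by (simp add: UV)
  have V: "bounded_linear V"
    by (rule bounded_linear_intro[where K = 1])
       (auto intro!: V_eqI simp: blinfun.add_right blinfun.scaleR_right UV nV)
  have Vc: "V (scaleC c x) = scaleC c (V x)" for c x
    by (rule V_eqI) (simp add: cboundedD[OF Uc] UV)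
  define B where "B = U o\<^sub>L A o\<^sub>L Blinfun V"
  have B: "blinfun_apply B x = blinfun_apply U (blinfun_apply A (V x))" for x
    by (simp add: B_def bounded_linear_Blinfun_apply[OF V])
  have BU: "blinfun_apply B (blinfun_apply U x) = blinfun_apply U (blinfun_apply A x)" for x
    by (simp add: B VU)
  note L = pos_coneD(1)[OF A]
  have Bc: "B \<in> cbounded" by (simp add: cbounded_def B Vc cboundedD[OF Uc] cboundedD[OF L1infD(1)[OF L]])
  have sv: "sing_val n B = sing_val n A" for n
    by (rule unitary_conj_sing_val[OF U e L1infD[OF L] Bc BU])
  have "compact_op B"
  proof -
    let ?K = "blinfun_apply U ` closure (blinfun_apply A ` ball 0 1)"
    have K: "compact ?K" using L1infD(2)[OF L]
      by (intro compact_continuous_image linear_continuous_on blinfun.bounded_linear_right)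
         (auto simp: compact_op_def)
    have "blinfun_apply B ` ball 0 1 \<subseteq> ?K"
    proof (intro image_subsetI)
      fix x :: 'a assume "x \<in> ball 0 1"
      hence "V x \<in> ball 0 1" by (simp add: nV)
      hence "blinfun_apply A (V x) \<in> closure (blinfun_apply A ` ball 0 1)"
        by (intro subsetD[OF closure_subset] imageI)
      thus "blinfun_apply B x \<in> ?K" by (simp add: B)
    qed
    hence "closure (blinfun_apply B ` ball 0 1) \<subseteq> ?K"
      using K by (intro closure_minimal compact_imp_closed)
    thus ?thesis unfolding compact_op_def by (rule compact_closed_subset[OF K closed_closure])
  qed
  moreover obtain C where "\<And>n. sing_val n A \<le> C / real (n + 1)" using L1inf_sing_val_bound[OF L] by blast
  ultimately have "B \<in> L1inf" using Bc by (intro L1infI[where C = C]) (simp_all add: sv)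
  moreover have "pos_op B"
    unfolding pos_op_def
  proof
    fix x
    have "cinner (blinfun_apply B x) x = cinner (blinfun_apply A (V x)) (V x)"
      using unitary_cinner[OF U, of "blinfun_apply A (V x)" "V x"] by (simp add: B UV)
    thus "Im (cinner (blinfun_apply B x) x) = 0 \<and> 0 \<le> Re (cinner (blinfun_apply B x) x)"
      using pos_coneD(2)[OF A] by (simp add: pos_op_def)
  qed
  moreover have "block_seq B = block_seq A" by (simp add: block_seq_def sv)
  ultimately show ?thesis using BU by (auto simp: pos_cone_def)
qed

section \<open>Decomposition into positive operators\<close>

definition pos_decomp :: "('a::chilbert \<Rightarrow>\<^sub>L 'a) \<Rightarrow> ('a \<Rightarrow>\<^sub>L 'a) \<Rightarrow> ('a \<Rightarrow>\<^sub>L 'a) \<Rightarrow> ('a \<Rightarrow>\<^sub>L 'a) \<Rightarrow> ('a \<Rightarrow>\<^sub>L 'a) \<Rightarrow> bool" where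
  "pos_decomp A P Q R S \<longleftrightarrow> P \<in> pos_cone \<and> Q \<in> pos_cone \<and> R \<in> pos_cone \<and> S \<in> pos_cone \<and>
     A = P - Q + cscale \<i> (R - S)"

text \<open>The values of the quadratic form of \<open>H\<close> are both real and imaginary, hence
  0. So \<open>H\<close> is symmetric, and polarising with \<open>x\<close> and \<open>H x\<close>
  gives \<open>H x = 0\<close>.\<close>

lemma selfadjoint_part_unique:
  assumes H: "H \<in> cbounded" and "\<And>x. Im (cinner (blinfun_apply H x) x) = 0"
    and "\<And>x. Im (cinner (blinfun_apply K x) x) = 0" and "H + cscale \<i> K = 0"
  shows "H = 0"
proof (rule blinfun_eqI)
  fix x
  have z: "cinner (blinfun_apply H y) y = 0" for y
  proof -
    have "blinfun_apply H y + scaleC \<i> (blinfun_apply K y) = 0"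
      using arg_cong[OF assms(4), of "\<lambda>T. blinfun_apply T y"] by (simp add: blinfun.add_left)
    hence "cinner (blinfun_apply H y) y + \<i> * cinner (blinfun_apply K y) y = 0"
      by (metis cinner_add_left cinner_scaleC_left cinner_zero_left)
    thus ?thesis using assms(2,3)[of y] by (simp add: complex_eq_iff)
  qed
  hence "pos_op H" by (simp add: pos_op_def)
  hence sa: "cinner (blinfun_apply H (blinfun_apply H x)) x = cinner (blinfun_apply H x) (blinfun_apply H x)"
    by (rule pos_op_selfadjoint[OF H])
  have "cinner (blinfun_apply H (blinfun_apply H x)) x + cinner (blinfun_apply H x) (blinfun_apply H x) = 0"
    using z[of "x + blinfun_apply H x"] z[of x] z[of "blinfun_apply H x"]
    by (simp add: blinfun.add_right cinner_add_left cinner_add_right)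
  hence "cinner (blinfun_apply H x) (blinfun_apply H x) = 0" unfolding sa by simp
  thus "blinfun_apply H x = blinfun_apply 0 x" by simp
qed

text \<open>The parts are not unique, since a common summand may be added to \<open>P\<close> and
  \<open>Q\<close>. The identities are written with sums so that additivity on the cone applies to
  them directly.\<close>

lemma pos_decomp_unique:
  assumes "pos_decomp A P Q R S" "pos_decomp A P' Q' R' S'"
  shows "P + Q' = P' + Q" "R + S' = R' + S"
proof -
  have pc: "P \<in> pos_cone" "Q \<in> pos_cone" "R \<in> pos_cone" "S \<in> pos_cone"
    "P' \<in> pos_cone" "Q' \<in> pos_cone" "R' \<in> pos_cone" "S' \<in> pos_cone"
    using assms by (auto simp: pos_decomp_def)
  define H where "H = (P + Q') - (P' + Q)"
  define K where "K = (R + S') - (R' + S)"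
  have cb: "H \<in> cbounded" "K \<in> cbounded"
    unfolding H_def K_def using pc by (auto intro!: cbounded_diff cbounded_add dest: pos_coneD L1infD)
  have im: "Im (cinner (blinfun_apply T x) x) = 0" if "T \<in> pos_cone" for T :: "'a \<Rightarrow>\<^sub>L 'a" and x
    using that by (simp add: pos_cone_def pos_op_def)
  have imH: "Im (cinner (blinfun_apply H x) x) = 0" and imK: "Im (cinner (blinfun_apply K x) x) = 0" for x
    using pc by (auto simp: H_def K_def im blinfun.add_left blinfun.diff_left cinner_add_left cinner_diff_left)
  have "P - Q + cscale \<i> (R - S) = P' - Q' + cscale \<i> (R' - S')"
    using assms by (simp add: pos_decomp_def)
  hence pt: "blinfun_apply P x - blinfun_apply Q x + scaleC \<i> (blinfun_apply R x - blinfun_apply S x)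
      = blinfun_apply P' x - blinfun_apply Q' x + scaleC \<i> (blinfun_apply R' x - blinfun_apply S' x)" for x
    by (metis blinfun.add_left blinfun.diff_left cscale_apply)
  have eq: "H + cscale \<i> K = 0"
  proof (rule blinfun_eqI)
    fix x
    show "blinfun_apply (H + cscale \<i> K) x = blinfun_apply 0 x"
      using pt[of x] by (simp add: H_def K_def blinfun.add_left blinfun.diff_left scaleC_add_right scaleC_diff_right algebra_simps)
  qed
  have "H = 0" by (rule selfadjoint_part_unique[OF cb(1) imH imK eq])
  thus "P + Q' = P' + Q" by (simp add: H_def)
  have "blinfun_apply K x = 0" for x
  proof -
    have "scaleC \<i> (blinfun_apply K x) = 0"
      using arg_cong[OF eq, of "\<lambda>T. blinfun_apply T x"] \<open>H = 0\<close> by simp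
    hence "scaleC (- \<i>) (scaleC \<i> (blinfun_apply K x)) = 0" by simp
    thus ?thesis by (simp add: scaleC_scaleC)
  qed
  hence "K = 0" by (intro blinfun_eqI) simp
  thus "R + S' = R' + S" by (simp add: K_def)
qed

text \<open>Polarization: for \<open>A = \<Sum> s \<langle>\<cdot>, f\<rangle> g\<close> and \<open>\<bar>w\<bar> = 1\<close> the operator
  \<open>\<Sum> s \<langle>\<cdot>, g + w f\<rangle> (g + w f)\<close> is positive, and it is a combination of four weak trace class operators.\<close>

lemma polarization_pos:
  assumes f: "subon f" and g: "subon g" and d: "decay s C" and s: "\<And>k. 0 \<le> s k" and w: "cmod w = 1"
  shows "sop s g g + sop s f f + (cscale (cnj w) (sop s f g) + cscale w (sop s g f)) \<in> pos_cone" (is "?T \<in> _")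
proof -
  note b = decay_bounded[OF d]
  have "?T \<in> L1inf" by (intro L1inf_add L1inf_cscale sop_L1inf[OF _ _ d] f g)
  moreover have "Im (cinner (blinfun_apply ?T x) x) = 0 \<and> 0 \<le> Re (cinner (blinfun_apply ?T x) x)" for x
  proof -
    let ?a = "\<lambda>n. cinner x (g n)" and ?b = "\<lambda>n. cinner x (f n)"
    have "(\<lambda>n. (of_real (s n) * ?a n * cinner (g n) x + of_real (s n) * ?b n * cinner (f n) x)
        + (cnj w * (of_real (s n) * ?b n * cinner (g n) x) + w * (of_real (s n) * ?a n * cinner (f n) x)))
       sums ((cinner (blinfun_apply (sop s g g) x) x + cinner (blinfun_apply (sop s f f) x) x)
        + (cnj w * cinner (blinfun_apply (sop s f g) x) x + w * cinner (blinfun_apply (sop s g f) x) x))"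
      by (intro sums_add sums_mult sop_sums_cinner[OF f f b] sop_sums_cinner[OF f g b] sop_sums_cinner[OF g f b] sop_sums_cinner[OF g g b])
    also have "(\<lambda>n. (of_real (s n) * ?a n * cinner (g n) x + of_real (s n) * ?b n * cinner (f n) x)
        + (cnj w * (of_real (s n) * ?b n * cinner (g n) x) + w * (of_real (s n) * ?a n * cinner (f n) x)))
       = (\<lambda>n. complex_of_real (s n * (cmod (?a n + cnj w * ?b n))\<^sup>2))"
    proof
      fix n
      have ww: "w * cnj w = 1" using w complex_norm_square[of w] by simp
      have "complex_of_real (s n * (cmod (?a n + cnj w * ?b n))\<^sup>2)
          = of_real (s n) * ((?a n + cnj w * ?b n) * (cnj (?a n) + w * cnj (?b n)))"
        unfolding of_real_mult complex_norm_square by simp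
      also have "\<dots> = of_real (s n) * (?a n * cnj (?a n) + (w * cnj w) * (?b n * cnj (?b n))
          + (cnj w * (?b n * cnj (?a n)) + w * (?a n * cnj (?b n))))"
        by (simp add: algebra_simps)
      finally show "(of_real (s n) * ?a n * cinner (g n) x + of_real (s n) * ?b n * cinner (f n) x)
        + (cnj w * (of_real (s n) * ?b n * cinner (g n) x) + w * (of_real (s n) * ?a n * cinner (f n) x))
        = complex_of_real (s n * (cmod (?a n + cnj w * ?b n))\<^sup>2)"
        unfolding ww cinner_commute[of "f n" x] cinner_commute[of "g n" x] by (simp add: algebra_simps)
    qed
    also have "(cinner (blinfun_apply (sop s g g) x) x + cinner (blinfun_apply (sop s f f) x) x)
        + (cnj w * cinner (blinfun_apply (sop s f g) x) x + w * cinner (blinfun_apply (sop s g f) x) x)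
        = cinner (blinfun_apply ?T x) x"
      by (simp add: blinfun.add_left cinner_add_left)
    finally have re: "(\<lambda>n. s n * (cmod (?a n + cnj w * ?b n))\<^sup>2) sums Re (cinner (blinfun_apply ?T x) x)"
      and im: "(\<lambda>n::nat. 0) sums Im (cinner (blinfun_apply ?T x) x)"
      unfolding sums_complex_iff by simp_all
    show ?thesis using sums_unique2[OF im sums_zero] sums_le[OF _ sums_zero re] s by simp
  qed
  ultimately show ?thesis by (simp add: pos_cone_def pos_op_def)
qed

lemma ex_pos_decomp:
  fixes A :: "'a::chilbert \<Rightarrow>\<^sub>L 'a"
  assumes A: "A \<in> L1inf" and e: "onseq (e :: nat \<Rightarrow> 'a)"
  shows "\<exists>P Q R S. pos_decomp A P Q R S"
proof -
  let ?s = "\<lambda>n. sing_val n A"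
  obtain f g where fg: "onseq f" "subon g" "A = sop ?s f g"
    using singular_value_decomposition[OF A e] by blast
  obtain C where C: "decay ?s C" using L1inf_decay[OF A] by blast
  \<comment> \<open>The weights \<open>w\<close> are 1, -1, \<i> and -\<i>. In the sum of
    \<open>w\<close> times \<open>T w\<close> the diagonal terms cancel, the terms of
    \<open>sop ?s g f\<close> cancel because the squares of the weights add up to 0, and
    \<open>sop ?s f g\<close> is left four times.\<close>
  define T where "T w = (1/4) *\<^sub>R (sop ?s g g + sop ?s f f + (cscale (cnj w) (sop ?s f g) + cscale w (sop ?s g f)))" for w
  have T: "T w \<in> pos_cone" if "cmod w = 1" for w
    unfolding T_def by (intro pos_cone_scaleR polarization_pos[OF onseq_subon[OF fg(1)] fg(2) C sing_val_nonneg that]) simp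
  have "A = T 1 - T (-1) + cscale \<i> (T \<i> - T (- \<i>))"
  proof (rule blinfun_eqI)
    fix x
    define y where "y = blinfun_apply (sop ?s f g) x"
    define z where "z = blinfun_apply (sop ?s g f) x"
    define G where "G = blinfun_apply (sop ?s g g) x + blinfun_apply (sop ?s f f) x"
    have Tx: "blinfun_apply (T w) x = (1/4) *\<^sub>R (G + (scaleC (cnj w) y + scaleC w z))" for w
      by (simp add: T_def blinfun.add_left blinfun.scaleR_left y_def z_def G_def)
    have h: "u - v + scaleC \<i> (p - q) = (u - v) + (scaleC \<i> p - scaleC \<i> q)" for u v p q :: 'a
      by (simp add: scaleC_diff_right)
    have "blinfun_apply (T 1 - T (-1) + cscale \<i> (T \<i> - T (- \<i>))) x
      = (1/4) *\<^sub>R ((G + (y + z)) - (G - (y + z)) + ((scaleC \<i> G + (y - z)) - (scaleC \<i> G - (y - z))))"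
      unfolding blinfun.add_left blinfun.diff_left cscale_apply h Tx
      by (simp add: scaleC_scaleR scaleC_add_right scaleC_diff_right scaleC_scaleC scaleC_minus_left scaleR_add_right scaleR_diff_right algebra_simps)
    also have "\<dots> = (1/4) *\<^sub>R (4 *\<^sub>R y)"
      by (rule arg_cong[of _ _ "(*\<^sub>R) (1/4)"]) (simp add: algebra_simps scaleR_add_left[of 2 2 y, simplified] scaleR_2)
    also have "\<dots> = blinfun_apply A x" by (simp add: y_def flip: fg(3))
    finally show "blinfun_apply A x = blinfun_apply (T 1 - T (-1) + cscale \<i> (T \<i> - T (- \<i>))) x" by simp
  qed
  hence "pos_decomp A (T 1) (T (-1)) (T \<i>) (T (- \<i>))"
    unfolding pos_decomp_def using T by simp
  thus ?thesis by blast
qed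

text \<open>Well defined by uniqueness of the decomposition and additivity on the cone.\<close>

definition trace_of :: "((nat \<Rightarrow> real) \<Rightarrow> complex) \<Rightarrow> ('a::chilbert \<Rightarrow>\<^sub>L 'a) \<Rightarrow> complex" where
  "trace_of \<theta> A = (SOME v. \<exists>P Q R S. pos_decomp A P Q R S \<and>
     v = \<theta> (block_seq P) - \<theta> (block_seq Q) + \<i> * (\<theta> (block_seq R) - \<theta> (block_seq S)))"

lemma trace_of_eq:
  fixes A :: "'a::chilbert \<Rightarrow>\<^sub>L 'a"
  assumes l: "linear_on_linf \<theta>" and s: "shift_invariant \<theta>" and e: "onseq (e :: nat \<Rightarrow> 'a)"
    and d: "pos_decomp A P Q R S"
  shows "trace_of \<theta> A = \<theta> (block_seq P) - \<theta> (block_seq Q) + \<i> * (\<theta> (block_seq R) - \<theta> (block_seq S))"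
  unfolding trace_of_def
proof (rule some_equality)
  show "\<exists>P' Q' R' S'. pos_decomp A P' Q' R' S' \<and>
     \<theta> (block_seq P) - \<theta> (block_seq Q) + \<i> * (\<theta> (block_seq R) - \<theta> (block_seq S))
       = \<theta> (block_seq P') - \<theta> (block_seq Q') + \<i> * (\<theta> (block_seq R') - \<theta> (block_seq S'))"
    using d by blast
next
  fix v
  assume "\<exists>P Q R S. pos_decomp A P Q R S \<and>
     v = \<theta> (block_seq P) - \<theta> (block_seq Q) + \<i> * (\<theta> (block_seq R) - \<theta> (block_seq S))"
  then obtain P' Q' R' S' where d': "pos_decomp A P' Q' R' S'"
    and v: "v = \<theta> (block_seq P') - \<theta> (block_seq Q') + \<i> * (\<theta> (block_seq R') - \<theta> (block_seq S'))" by blast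
  note add = block_seq_additive[OF l s _ _ e]
  have "\<theta> (block_seq P) + \<theta> (block_seq Q') = \<theta> (block_seq P') + \<theta> (block_seq Q)"
    using pos_decomp_unique(1)[OF d d'] d d' by (metis add pos_decomp_def)
  moreover have "\<theta> (block_seq R) + \<theta> (block_seq S') = \<theta> (block_seq R') + \<theta> (block_seq S)"
    using pos_decomp_unique(2)[OF d d'] d d' by (metis add pos_decomp_def)
  ultimately have "\<theta> (block_seq P') - \<theta> (block_seq Q') = \<theta> (block_seq P) - \<theta> (block_seq Q)"
    "\<theta> (block_seq R') - \<theta> (block_seq S') = \<theta> (block_seq R) - \<theta> (block_seq S)"
    by (simp_all add: algebra_simps)
  thus "v = \<theta> (block_seq P) - \<theta> (block_seq Q) + \<i> * (\<theta> (block_seq R) - \<theta> (block_seq S))"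
    by (simp add: v)
qed

section \<open>Linearity and unitary invariance of the extension\<close>

lemma pos_decomp_add:
  "pos_decomp A P Q R S \<Longrightarrow> pos_decomp B P' Q' R' S' \<Longrightarrow> pos_decomp (A + B) (P + P') (Q + Q') (R + R') (S + S')"
  unfolding pos_decomp_def
  by (auto intro!: pos_cone_add blinfun_eqI
      simp: blinfun.add_left blinfun.diff_left scaleC_add_right scaleC_diff_right)

lemma pos_decomp_scaleR:
  "pos_decomp A P Q R S \<Longrightarrow> 0 \<le> r \<Longrightarrow> pos_decomp (r *\<^sub>R A) (r *\<^sub>R P) (r *\<^sub>R Q) (r *\<^sub>R R) (r *\<^sub>R S)"
  unfolding pos_decomp_def
  by (auto intro!: pos_cone_scaleR blinfun_eqI
      simp: blinfun.add_left blinfun.diff_left blinfun.scaleR_left scaleC_diff_right scaleC_scaleR scaleR_add_right scaleR_diff_right)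

lemma pos_decomp_minus: "pos_decomp A P Q R S \<Longrightarrow> pos_decomp (- A) Q P S R"
  unfolding pos_decomp_def
  by (auto intro!: blinfun_eqI simp: blinfun.add_left blinfun.diff_left blinfun.minus_left scaleC_diff_right)

lemma pos_decomp_ii: "pos_decomp A P Q R S \<Longrightarrow> pos_decomp (cscale \<i> A) S R P Q"
  unfolding pos_decomp_def
  by (auto intro!: blinfun_eqI simp: blinfun.add_left blinfun.diff_left scaleC_diff_right scaleC_add_right
      scaleC_scaleC scaleC_minus_left)

text \<open>Each of the four parts is conjugated by \<open>U\<close>; the resulting combination
  agrees with \<open>B\<close> on the range of \<open>U\<close>, which is the whole space.\<close>

lemma pos_decomp_unitary:
  fixes A :: "'a::chilbert \<Rightarrow>\<^sub>L 'a"
  assumes U: "unitary U" and e: "onseq (e :: nat \<Rightarrow> 'a)" and d: "pos_decomp A P Q R S"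
    and BU: "\<And>x. blinfun_apply B (blinfun_apply U x) = blinfun_apply U (blinfun_apply A x)"
  shows "\<exists>P' Q' R' S'. pos_decomp B P' Q' R' S' \<and> block_seq P' = block_seq P \<and> block_seq Q' = block_seq Q
     \<and> block_seq R' = block_seq R \<and> block_seq S' = block_seq S"
proof -
  define I where "I T T' \<longleftrightarrow> T' \<in> pos_cone \<and> (\<forall>x. blinfun_apply T' (blinfun_apply U x) = blinfun_apply U (blinfun_apply T x))
     \<and> block_seq T' = block_seq T" for T T'
  have ex: "\<exists>T'. I T T'" if "T \<in> pos_cone" for T
    using unitary_conjugate[OF U e that] unfolding I_def by blast
  obtain P' Q' R' S' where I: "I P P'" "I Q Q'" "I R R'" "I S S'"
    using ex d unfolding pos_decomp_def by meson
  have Uc: "U \<in> cbounded" and su: "surj (blinfun_apply U)" using U by (auto simp: unitary_def)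
  have "B = P' - Q' + cscale \<i> (R' - S')"
  proof (rule blinfun_eqI)
    fix x
    obtain y where y: "x = blinfun_apply U y" using su by (metis surjD)
    show "blinfun_apply B x = blinfun_apply (P' - Q' + cscale \<i> (R' - S')) x"
      using d I unfolding y BU pos_decomp_def I_def
      by (simp add: blinfun.add_left blinfun.diff_left blinfun.add_right blinfun.diff_right cboundedD[OF Uc])
  qed
  thus ?thesis using I unfolding pos_decomp_def I_def by blast
qed

lemma zero_pos_cone:
  fixes A :: "'a::chilbert \<Rightarrow>\<^sub>L 'a"
  assumes "A \<in> pos_cone"
  shows "(0 :: 'a \<Rightarrow>\<^sub>L 'a) \<in> pos_cone"
  using pos_cone_scaleR[OF assms order_refl] by simp

theorem trace_of_is_trace:
  fixes e :: "nat \<Rightarrow> 'a::chilbert"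
  assumes l: "linear_on_linf \<theta>" and s: "shift_invariant \<theta>" and e: "onseq e"
  shows "is_trace (trace_of \<theta> :: ('a \<Rightarrow>\<^sub>L 'a) \<Rightarrow> complex)"
proof -
  let ?\<tau> = "trace_of \<theta> :: ('a \<Rightarrow>\<^sub>L 'a) \<Rightarrow> complex"
  note eq = trace_of_eq[OF l s e] and add = block_seq_additive[OF l s _ _ e]
  have tadd: "?\<tau> (A + B) = ?\<tau> A + ?\<tau> B" if A: "A \<in> L1inf" and B: "B \<in> L1inf" for A B
  proof -
    obtain P Q R S where 1: "pos_decomp A P Q R S" using ex_pos_decomp[OF A e] by blast
    obtain P' Q' R' S' where 2: "pos_decomp B P' Q' R' S'" using ex_pos_decomp[OF B e] by blast
    have pc: "P \<in> pos_cone" "Q \<in> pos_cone" "R \<in> pos_cone" "S \<in> pos_cone"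
      "P' \<in> pos_cone" "Q' \<in> pos_cone" "R' \<in> pos_cone" "S' \<in> pos_cone"
      using 1 2 by (auto simp: pos_decomp_def)
    show ?thesis
      unfolding eq[OF 1] eq[OF 2] eq[OF pos_decomp_add[OF 1 2]]
      by (simp add: add pc algebra_simps)
  qed
  \<comment> \<open>A nonnegative factor keeps the parts in the cone. Negative factors and \<i> are
    reached by exchanging the parts.\<close>
  have tpos: "?\<tau> (r *\<^sub>R A) = of_real r * ?\<tau> A" if A: "A \<in> L1inf" and r: "0 \<le> r" for A r
  proof -
    obtain P Q R S where 1: "pos_decomp A P Q R S" using ex_pos_decomp[OF A e] by blast
    have sc: "\<theta> (block_seq (r *\<^sub>R T)) = of_real r * \<theta> (block_seq T)" if "T \<in> pos_cone" for T :: "'a \<Rightarrow>\<^sub>L 'a"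
      unfolding block_seq_scaleR[OF pos_coneD(1)[OF that] e r]
      by (rule linear_on_linfD(2)[OF l block_seq_linf[OF pos_coneD(1)[OF that]]])
    have pc: "P \<in> pos_cone" "Q \<in> pos_cone" "R \<in> pos_cone" "S \<in> pos_cone"
      using 1 by (auto simp: pos_decomp_def)
    show ?thesis
      unfolding eq[OF 1] eq[OF pos_decomp_scaleR[OF 1 r]] by (simp add: sc pc algebra_simps)
  qed
  have tminus: "?\<tau> (- A) = - ?\<tau> A" if A: "A \<in> L1inf" for A
  proof -
    obtain P Q R S where 1: "pos_decomp A P Q R S" using ex_pos_decomp[OF A e] by blast
    show ?thesis unfolding eq[OF 1] eq[OF pos_decomp_minus[OF 1]] by (simp add: algebra_simps)
  qed
  have treal: "?\<tau> (r *\<^sub>R A) = of_real r * ?\<tau> A" if A: "A \<in> L1inf" for A r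
  proof (cases "0 \<le> r")
    case False
    hence "?\<tau> (r *\<^sub>R A) = - ?\<tau> ((- r) *\<^sub>R A)" using tminus[OF L1inf_scaleR[OF A, of "- r"]] by simp
    thus ?thesis using tpos[OF A, of "- r"] False by simp
  qed (rule tpos[OF A])
  have tii: "?\<tau> (cscale \<i> A) = \<i> * ?\<tau> A" if A: "A \<in> L1inf" for A
  proof -
    obtain P Q R S where 1: "pos_decomp A P Q R S" using ex_pos_decomp[OF A e] by blast
    show ?thesis unfolding eq[OF 1] eq[OF pos_decomp_ii[OF 1]] by (simp add: algebra_simps)
  qed
  show ?thesis
    unfolding is_trace_def
  proof (intro conjI ballI allI impI)
    fix A B :: "'a \<Rightarrow>\<^sub>L 'a" assume "A \<in> L1inf" "B \<in> L1inf"
    thus "?\<tau> (A + B) = ?\<tau> A + ?\<tau> B" by (rule tadd)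
  next
    fix c and A B :: "'a \<Rightarrow>\<^sub>L 'a"
    assume A: "A \<in> L1inf" and B: "\<forall>x. blinfun_apply B x = scaleC c (blinfun_apply A x)"
    \<comment> \<open>Complex homogeneity is reduced to real scalars and \<i>, for which the
      decomposition can be followed.\<close>
    have "B = Re c *\<^sub>R A + Im c *\<^sub>R cscale \<i> A"
      using B by (intro blinfun_eqI) (simp add: blinfun.add_left blinfun.scaleR_left flip: scaleC_eq_Re_Im)
    hence "?\<tau> B = of_real (Re c) * ?\<tau> A + of_real (Im c) * (\<i> * ?\<tau> A)"
      using tadd[OF L1inf_scaleR[OF A] L1inf_scaleR[OF L1inf_cscale[OF A]]]
      by (simp add: treal[OF A] treal[OF L1inf_cscale[OF A]] tii[OF A])
    also have "\<dots> = (of_real (Re c) + \<i> * of_real (Im c)) * ?\<tau> A" by (simp add: algebra_simps)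
    finally show "?\<tau> B = c * ?\<tau> A" by (simp flip: complex_eq)
  next
    fix U A B :: "'a \<Rightarrow>\<^sub>L 'a"
    assume A: "A \<in> L1inf" and U: "unitary U \<and> (\<forall>x. blinfun_apply B (blinfun_apply U x) = blinfun_apply U (blinfun_apply A x))"
    obtain P Q R S where 1: "pos_decomp A P Q R S" using ex_pos_decomp[OF A e] by blast
    obtain P' Q' R' S' where 2: "pos_decomp B P' Q' R' S'" "block_seq P' = block_seq P" "block_seq Q' = block_seq Q"
       "block_seq R' = block_seq R" "block_seq S' = block_seq S"
      using pos_decomp_unitary[OF _ e 1] U by metis
    show "?\<tau> B = ?\<tau> A" unfolding eq[OF 1] eq[OF 2(1)] 2(2-5) ..
  qed
qed

lemma trace_of_pos:
  fixes A :: "'a::chilbert \<Rightarrow>\<^sub>L 'a"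
  assumes l: "linear_on_linf \<theta>" and s: "shift_invariant \<theta>" and e: "onseq (e :: nat \<Rightarrow> 'a)" and A: "A \<in> pos_cone"
  shows "trace_of \<theta> A = \<theta> (block_seq A)"
proof -
  note z = zero_pos_cone[OF A]
  have "pos_decomp A A 0 0 0"
    unfolding pos_decomp_def using A z by (auto intro!: blinfun_eqI simp: blinfun.add_left)
  \<comment> \<open>Additivity at \<open>0 + 0\<close> shows that \<theta> vanishes at
    \<open>block_seq 0\<close>.\<close>
  from trace_of_eq[OF l s e this] block_seq_additive[OF l s z z e] show ?thesis by simp
qed

theorem theorem4p1:
  fixes e :: "nat \<Rightarrow> 'a::chilbert"
  assumes sep: "separable_space TYPE('a)"
    and infdim: "\<not> (\<exists>B::'a set. finite B \<and> span B = UNIV)"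
    and onb: "orthonormal_basis e"
  shows "(\<forall>\<tau>. is_trace \<tau> \<longrightarrow>
            (let \<theta> = (\<lambda>x. \<tau> (diag e (Dop x))) in
              linear_on_linf \<theta> \<and> shift_invariant \<theta> \<and>
              (\<forall>A\<in>L1inf. pos_op A \<longrightarrow> \<tau> A = \<theta> (block_seq A)) \<and>
              (\<forall>\<theta>'. linear_on_linf \<theta>' \<and> shift_invariant \<theta>' \<and>
                   (\<forall>A\<in>L1inf. pos_op A \<longrightarrow> \<tau> A = \<theta>' (block_seq A))
                   \<longrightarrow> (\<forall>x\<in>linf. \<theta>' x = \<theta> x))))
       \<and> (\<forall>\<theta>. linear_on_linf \<theta> \<and> shift_invariant \<theta> \<longrightarrow>
            (\<exists>\<tau>::('a \<Rightarrow>\<^sub>L 'a) \<Rightarrow> complex. is_trace \<tau> \<and> (\<forall>A\<in>L1inf. pos_op A \<longrightarrow> \<tau> A = \<theta> (block_seq A))))"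
  unfolding Let_def
proof (intro conjI allI impI ballI)
  fix \<tau> :: "('a \<Rightarrow>\<^sub>L 'a) \<Rightarrow> complex" assume t: "is_trace \<tau>"
  show lin: "linear_on_linf (\<lambda>x. \<tau> (diag e (Dop x)))" by (rule linear_on_linf_trace[OF t onb])
  show "shift_invariant (\<lambda>x. \<tau> (diag e (Dop x)))" by (rule shift_invariant_trace[OF t onb])
  show "\<tau> A = \<tau> (diag e (Dop (block_seq A)))" if "A \<in> L1inf" "pos_op A" for A
    by (rule trace_pos_eq[OF t onb that])
  fix \<theta>' x
  assume th: "linear_on_linf \<theta>' \<and> shift_invariant \<theta>' \<and> (\<forall>A\<in>L1inf. pos_op A \<longrightarrow> \<tau> A = \<theta>' (block_seq A))"
    and x: "x \<in> linf"
  show "\<theta>' x = \<tau> (diag e (Dop x))"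
  proof (rule linear_on_linf_determined[OF conjunct1[OF th] lin _ x])
    fix y :: "nat \<Rightarrow> real" assume y: "\<And>n. 1 \<le> y n" "\<And>n. y n \<le> 2"
    \<comment> \<open>Here \<open>y\<close> is the block sequence of the positive operator
      \<open>diag e (Dop y)\<close>, so the formula assumed for \<open>\<theta>'\<close> at this
      operator is the claim.\<close>
    show "\<theta>' y = \<tau> (diag e (Dop y))"
      using th block_seq_diag_Dop[OF onb y] by simp
  qed
next
  fix \<theta> assume th: "linear_on_linf \<theta> \<and> shift_invariant \<theta>"
  note oe = orthonormal_basisD(1)[OF onb]
  show "\<exists>\<tau>::('a \<Rightarrow>\<^sub>L 'a) \<Rightarrow> complex. is_trace \<tau> \<and> (\<forall>A\<in>L1inf. pos_op A \<longrightarrow> \<tau> A = \<theta> (block_seq A))"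
    using trace_of_is_trace[of \<theta>, OF _ _ oe] trace_of_pos[of \<theta>, OF _ _ oe] th by (auto simp: pos_cone_def)
qed

end
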